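(* Let $(X,\mathsf d,\mathsf m)$ be an infinitesimally strictly convex metric measure space. Then, for any measurable sets $A,B\subset X$ with $0<\mathsf m(A),\mathsf m(B)<\infty$, we have $$\limsup_{t\downarrow0}t\log\mathsf P_t(A,B)\le-\frac12\,\mathsf d(A,B)^2 .$$
   Context: Here a metric measure space $(X,\mathsf d,\mathsf m)$ consists of a complete separable metric space $(X,\mathsf d)$ (usual symmetric distance) and a fully supported Borel measure $\mathsf m$ on $X$ with $\mathsf m(B)<\infty$ for every bounded measurable $B\subset X$. Set $\mathsf d(A,B):=\inf_{x\in A,\,y\in B}\mathsf d(x,y)$, and $\log0:=-\infty$. Sobolev class. A Borel probability measure $\pi$ on $C([0,1],X)$ is a test plan if there is $C>0$ with $(e_t)_\#\pi\le C\mathsf m$ for all $t\in[0,1]$, where $e_t(\gamma):=\gamma_t$, and $\int\int_0^1|\dot\gamma_t|^2\,dt\,\pi(d\gamma)<\infty$, where $|\dot\gamma_t|:=\lim_{s\to t}\mathsf d(\gamma_s,\gamma_t)/|s-t|$ is the metric speed. The Sobolev class $S^2(X)$ consists of measurable functions $f$ for which there is a nonnegative $g\in L^2(X)$ with $$\int|f(\gamma_1)-f(\gamma_0)|\,\pi(d\gamma)\le\int\int_0^1g(\gamma_t)|\dot\gamma_t|\,dt\,\pi(d\gamma)$$ for all test plans $\pi$. The minimal such $g$ is the minimal weak upper gradient $|\mathrm Df|$. The Sobolev space is $W^{1,2}(X):=S^2(X)\cap L^2(X)$ with norm $\bigl(\|f\|_{L^2}^2+\||\mathrm Df|\|_{L^2}^2\bigr)^{1/2}$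 (not necessarily Hilbert or reflexive). Heat semigroup. The Cheeger energy $\mathsf{Ch}:L^2(X)\to[0,\infty]$ is $\mathsf{Ch}(f):=\frac12\int_X|\mathrm Df|^2\,d\mathsf m$ if $f\in W^{1,2}(X)$ and $\infty$ otherwise; it is convex, lower semi-continuous, with dense domain. For $f\in W^{1,2}(X)$ with nonempty sub-differential $\partial^-\mathsf{Ch}(f)\subset L^2(X)$, $\Delta f:=-h$ where $h$ is the element of minimal $L^2$-norm in $\partial^-\mathsf{Ch}(f)$. The heat semigroup $(\mathsf T_t)_{t\ge0}$ is the semigroup of (possibly non-linear) continuous operators on $L^2(X)$ given by gradient flow theory for convex functions on Hilbert spaces: for each $f\in L^2(X)$, $\mathsf T_0f=f$, $t\mapsto\mathsf T_tf\in L^2(X)$ is continuous on $[0,\infty)$, (locally) absolutely continuous on $(0,\infty)$, and $\frac{d}{dt}\mathsf T_tf=\frac12\Delta\mathsf T_tf$ for a.e. $t>0$. Set $\mathsf P_t(A,B):=\int_A\mathsf T_t\mathbf 1_B\,d\mathsf m$. Infinitesimal strict convexity. The cotangent module $L^2(T^*X)$ (in the sense of Gigli) is the $L^2(\mathsf m)$-normed $L^\infty(\mathsf m)$-module, with pointwise norm $|\cdot|_*$, together with the linear differential $\mathbf d:S^2(X)\to L^2(T^*X)$, uniquely characterised up to isomorphism by $|\mathbf d f|_*=|\mathrm Df|$ a.e. for all $f\in S^2(X)$ and by the requirement that $\{\mathbf d f:f\in S^2(X)\}$ generates $L^2(T^*X)$ as a module. The tangent module $L^2(TX)$ is its dual module,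 with pointwise norm $|\cdot|$. For $f\in S^2(X)$, $\mathrm{Grad}(f)$ is the set of $v\in L^2(TX)$ with $\mathbf d f(v)=|v|^2=|\mathbf d f|_*^2=|\mathrm Df|^2$ a.e. The space $(X,\mathsf d,\mathsf m)$ is infinitesimally strictly convex if $\mathrm{Grad}(f)$ consists of exactly one element for every $f\in S^2(X)$. *)

theory Defs
  imports "HOL-Probability.Probability"
begin

text \<open>
  Elements of \<open>L\<^sup>2\<close>, \<open>L\<^sup>1\<close> and \<open>L\<^sup>\<infinity>\<close> are represented by Borel functions; equalities and
  inequalities between them are meant (and stated) almost everywhere.
\<close>

definition metric_measure_space :: "'a::polish_space measure \<Rightarrow> bool" where
  "metric_measure_space m \<longleftrightarrow>
     sets m = sets borel \<and>
     (\<forall>U. open U \<and> U \<noteq> {} \<longrightarrow> 0 < emeasure m U) \<and>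
     (\<forall>B\<in>sets m. bounded B \<longrightarrow> emeasure m B < \<infinity>)"

definition L2 :: "'a measure \<Rightarrow> ('a \<Rightarrow> real) set" where
  "L2 m = {f \<in> borel_measurable m. integrable m (\<lambda>x. (f x)\<^sup>2)}"

definition l2norm :: "'a measure \<Rightarrow> ('a \<Rightarrow> real) \<Rightarrow> real" where
  "l2norm m f = sqrt (\<integral>x. (f x)\<^sup>2 \<partial>m)"

definition Linf :: "'a measure \<Rightarrow> ('a \<Rightarrow> real) set" where
  "Linf m = {f \<in> borel_measurable m. \<exists>C. AE x in m. \<bar>f x\<bar> \<le> C}"

text \<open>
  Absolute continuity on \<open>[a,b]\<close> of a curve \<open>c\<close> in a metric space, where \<open>D s t\<close> stands for the
  distance of \<open>c s\<close> and \<open>c t\<close>. Passing \<open>D\<close> instead of \<open>c\<close> allows the same notion to be used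
  for curves in \<open>X\<close> and for curves in \<open>L\<^sup>2\<close>.
\<close>
definition abs_cont_curve :: "real \<Rightarrow> real \<Rightarrow> (real \<Rightarrow> real \<Rightarrow> real) \<Rightarrow> bool" where
  "abs_cont_curve a b D \<longleftrightarrow>
     (\<exists>g. set_integrable lborel {a..b} g \<and>
        (\<forall>s t. a \<le> s \<and> s \<le> t \<and> t \<le> b \<longrightarrow> D s t \<le> (LINT r:{s..t}|lborel. g r)))"


subsection \<open>Test plans and the Sobolev class\<close>

definition path_space :: "(real \<Rightarrow> 'a::metric_space) metric" where
  "path_space = cfunspace (top_of_set {0..1}) euclidean_metric"

definition path_borel :: "(real \<Rightarrow> 'a::metric_space) measure" where
  "path_borel = sigma (mspace path_space) {U. openin (mtopology_of path_space) U}"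

definition metric_speed :: "(real \<Rightarrow> 'a::metric_space) \<Rightarrow> real \<Rightarrow> real" where
  "metric_speed \<gamma> t = Lim (at t within {0..1}) (\<lambda>s. dist (\<gamma> s) (\<gamma> t) / \<bar>s - t\<bar>)"

text \<open>
  As usual, the kinetic energy of a curve that is not absolutely continuous is understood to be
  infinite, so that a test plan is concentrated on absolutely continuous curves; for these the
  limit defining the metric speed exists at almost every time.
\<close>
definition test_plan :: "'a::polish_space measure \<Rightarrow> (real \<Rightarrow> 'a) measure \<Rightarrow> bool" where
  "test_plan m \<pi> \<longleftrightarrow>
     sets \<pi> = sets path_borel \<and> prob_space \<pi> \<and>
     (\<exists>C>0. \<forall>t\<in>{0..1}. \<forall>E\<in>sets m.
        emeasure (distr \<pi> m (\<lambda>\<gamma>. \<gamma> t)) E \<le> ennreal C * emeasure m E) \<and>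
     (AE \<gamma> in \<pi>. abs_cont_curve 0 1 (\<lambda>s t. dist (\<gamma> s) (\<gamma> t))) \<and>
     (\<integral>\<^sup>+\<gamma>. (\<integral>\<^sup>+t\<in>{0..1}. ennreal ((metric_speed \<gamma> t)\<^sup>2) \<partial>lborel) \<partial>\<pi>) < \<infinity>"

definition weak_upper_gradient ::
    "'a::polish_space measure \<Rightarrow> ('a \<Rightarrow> real) \<Rightarrow> ('a \<Rightarrow> real) \<Rightarrow> bool" where
  "weak_upper_gradient m f g \<longleftrightarrow>
     g \<in> L2 m \<and> (AE x in m. 0 \<le> g x) \<and>
     (\<forall>\<pi>. test_plan m \<pi> \<longrightarrow>
        (\<integral>\<^sup>+\<gamma>. ennreal \<bar>f (\<gamma> 1) - f (\<gamma> 0)\<bar> \<partial>\<pi>)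
          \<le> (\<integral>\<^sup>+\<gamma>. (\<integral>\<^sup>+t\<in>{0..1}. ennreal (g (\<gamma> t) * metric_speed \<gamma> t) \<partial>lborel) \<partial>\<pi>))"

definition sobolev_class :: "'a::polish_space measure \<Rightarrow> ('a \<Rightarrow> real) set" where
  "sobolev_class m = {f \<in> borel_measurable m. \<exists>g. weak_upper_gradient m f g}"

definition min_weak_upper_gradient ::
    "'a::polish_space measure \<Rightarrow> ('a \<Rightarrow> real) \<Rightarrow> ('a \<Rightarrow> real)" where
  "min_weak_upper_gradient m f =
     (SOME g. weak_upper_gradient m f g \<and>
        (\<forall>g'. weak_upper_gradient m f g' \<longrightarrow> (AE x in m. g x \<le> g' x)))"

definition W12 :: "'a::polish_space measure \<Rightarrow> ('a \<Rightarrow> real) set" where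
  "W12 m = sobolev_class m \<inter> L2 m"


subsection \<open>Cheeger energy and heat semigroup\<close>

definition cheeger :: "'a::polish_space measure \<Rightarrow> ('a \<Rightarrow> real) \<Rightarrow> ereal" where
  "cheeger m f =
     (if f \<in> W12 m then ereal (1/2 * (\<integral>x. (min_weak_upper_gradient m f x)\<^sup>2 \<partial>m)) else \<infinity>)"

definition cheeger_subdifferential ::
    "'a::polish_space measure \<Rightarrow> ('a \<Rightarrow> real) \<Rightarrow> ('a \<Rightarrow> real) set" where
  "cheeger_subdifferential m f =
     {h \<in> L2 m. \<forall>g\<in>L2 m. cheeger m f + ereal (\<integral>x. h x * (g x - f x) \<partial>m) \<le> cheeger m g}"

text \<open>\<open>has_laplacian m f l\<close>: \<open>f\<close> is in the domain of \<open>\<Delta>\<close> and \<open>\<Delta> f = l\<close>.\<close>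
definition has_laplacian ::
    "'a::polish_space measure \<Rightarrow> ('a \<Rightarrow> real) \<Rightarrow> ('a \<Rightarrow> real) \<Rightarrow> bool" where
  "has_laplacian m f l \<longleftrightarrow>
     f \<in> W12 m \<and>
     (\<exists>h\<in>cheeger_subdifferential m f.
        (\<forall>h'\<in>cheeger_subdifferential m f. l2norm m h \<le> l2norm m h') \<and> l = (\<lambda>x. - h x))"

definition heat_semigroup ::
    "'a::polish_space measure \<Rightarrow> (real \<Rightarrow> ('a \<Rightarrow> real) \<Rightarrow> ('a \<Rightarrow> real)) \<Rightarrow> bool" where
  "heat_semigroup m T \<longleftrightarrow>
     \<comment> \<open>a semigroup of continuous operators on \<open>L\<^sup>2\<close>; continuity includes compatibility with
       almost everywhere equality\<close>
     (\<forall>t\<ge>0. \<forall>f\<in>L2 m. T t f \<in> L2 m) \<and>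
     (\<forall>f\<in>L2 m. AE x in m. T 0 f x = f x) \<and>
     (\<forall>s\<ge>0. \<forall>t\<ge>0. \<forall>f\<in>L2 m. AE x in m. T (s + t) f x = T s (T t f) x) \<and>
     (\<forall>t\<ge>0. \<forall>f\<in>L2 m. \<forall>\<epsilon>>0. \<exists>\<delta>>0. \<forall>g\<in>L2 m.
        l2norm m (\<lambda>x. g x - f x) < \<delta> \<longrightarrow> l2norm m (\<lambda>x. T t g x - T t f x) < \<epsilon>) \<and>
     \<comment> \<open>its trajectories solve the gradient flow equation\<close>
     (\<forall>f\<in>L2 m.
        (\<forall>t\<ge>0. ((\<lambda>s. l2norm m (\<lambda>x. T s f x - T t f x)) \<longlongrightarrow> 0) (at t within {0..})) \<and>
        (\<forall>a b. 0 < a \<and> a < b \<longrightarrow>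
           abs_cont_curve a b (\<lambda>s t. l2norm m (\<lambda>x. T t f x - T s f x))) \<and>
        (AE t in lborel. 0 < t \<longrightarrow>
           (\<exists>l. has_laplacian m (T t f) l \<and>
             ((\<lambda>h. l2norm m (\<lambda>x. (T (t + h) f x - T t f x) / h - 1/2 * l x)) \<longlongrightarrow> 0) (at 0))))"

definition heat_transition ::
    "'a measure \<Rightarrow> (real \<Rightarrow> ('a \<Rightarrow> real) \<Rightarrow> ('a \<Rightarrow> real)) \<Rightarrow> real \<Rightarrow> 'a set \<Rightarrow> 'a set \<Rightarrow> real" where
  "heat_transition m T t A B = (LINT x:A|m. T t (indicator B) x)"


subsection \<open>Cotangent module, tangent module, infinitesimal strict convexity\<close>

text \<open>
  An \<open>L\<^sup>2\<close>-normed \<open>L\<^sup>\<infinity>\<close>-module: a Banach space (the type \<open>'c\<close>) with a bilinear multiplication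
  \<open>act\<close> by \<open>L\<^sup>\<infinity>\<close> functions and a pointwise norm \<open>pn\<close>.
\<close>
definition L2_normed_module ::
    "'a measure \<Rightarrow> (('a \<Rightarrow> real) \<Rightarrow> 'c \<Rightarrow> 'c) \<Rightarrow> ('c::banach \<Rightarrow> 'a \<Rightarrow> real) \<Rightarrow> bool" where
  "L2_normed_module m act pn \<longleftrightarrow>
     (\<forall>f\<in>Linf m. linear (act f)) \<and>
     (\<forall>f\<in>Linf m. \<forall>g\<in>Linf m. \<forall>v. act (\<lambda>x. f x + g x) v = act f v + act g v) \<and>
     (\<forall>f\<in>Linf m. \<forall>c v. act (\<lambda>x. c * f x) v = c *\<^sub>R act f v) \<and>
     (\<forall>f\<in>Linf m. \<forall>g\<in>Linf m. \<forall>v. act (\<lambda>x. f x * g x) v = act f (act g v)) \<and>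
     (\<forall>v. act (\<lambda>x. 1) v = v) \<and>
     (\<forall>v. pn v \<in> L2 m \<and> (AE x in m. 0 \<le> pn v x) \<and> norm v = l2norm m (pn v)) \<and>
     (\<forall>f\<in>Linf m. \<forall>v. AE x in m. pn (act f v) x = \<bar>f x\<bar> * pn v x)"

text \<open>
  The cotangent module with its differential \<open>d\<close> is only determined up to isomorphism, by the
  following properties. The last one says that finite \<open>L\<^sup>\<infinity>\<close>-linear combinations of differentials
  are dense.
\<close>
definition cotangent_module ::
    "'a::polish_space measure \<Rightarrow> (('a \<Rightarrow> real) \<Rightarrow> 'c \<Rightarrow> 'c) \<Rightarrow> ('c::banach \<Rightarrow> 'a \<Rightarrow> real) \<Rightarrow>
       (('a \<Rightarrow> real) \<Rightarrow> 'c) \<Rightarrow> bool" where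
  "cotangent_module m act pn d \<longleftrightarrow>
     L2_normed_module m act pn \<and>
     (\<forall>f\<in>sobolev_class m. \<forall>g\<in>sobolev_class m. d (\<lambda>x. f x + g x) = d f + d g) \<and>
     (\<forall>f\<in>sobolev_class m. \<forall>c. d (\<lambda>x. c * f x) = c *\<^sub>R d f) \<and>
     (\<forall>f\<in>sobolev_class m. AE x in m. pn (d f) x = min_weak_upper_gradient m f x) \<and>
     closure (span {act h (d f) | h f. h \<in> Linf m \<and> f \<in> sobolev_class m}) = UNIV"

text \<open>The dual module: bounded \<open>L\<^sup>\<infinity>\<close>-linear maps into \<open>L\<^sup>1\<close>.\<close>
definition dual_module ::
    "'a measure \<Rightarrow> (('a \<Rightarrow> real) \<Rightarrow> 'c \<Rightarrow> 'c) \<Rightarrow> ('c::banach \<Rightarrow> 'a \<Rightarrow> real) set" where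
  "dual_module m act =
     {V. (\<forall>w. integrable m (V w)) \<and>
         (\<forall>w w'. AE x in m. V (w + w') x = V w x + V w' x) \<and>
         (\<forall>f\<in>Linf m. \<forall>w. AE x in m. V (act f w) x = f x * V w x) \<and>
         (\<exists>C. \<forall>w. (\<integral>x. \<bar>V w x\<bar> \<partial>m) \<le> C * norm w)}"

definition is_ess_sup_family :: "'a measure \<Rightarrow> ('a \<Rightarrow> real) set \<Rightarrow> ('a \<Rightarrow> real) \<Rightarrow> bool" where
  "is_ess_sup_family m F g \<longleftrightarrow>
     g \<in> borel_measurable m \<and> (\<forall>f\<in>F. AE x in m. f x \<le> g x) \<and>
     (\<forall>g'\<in>borel_measurable m. (\<forall>f\<in>F. AE x in m. f x \<le> g' x) \<longrightarrow> (AE x in m. g x \<le> g' x))"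

definition dual_pointwise_norm ::
    "'a measure \<Rightarrow> ('c \<Rightarrow> 'a \<Rightarrow> real) \<Rightarrow> ('c \<Rightarrow> 'a \<Rightarrow> real) \<Rightarrow> ('a \<Rightarrow> real)" where
  "dual_pointwise_norm m pn V =
     (SOME g. is_ess_sup_family m {\<lambda>x. \<bar>V w x\<bar> | w. AE x in m. pn w x \<le> 1} g)"

definition Grad ::
    "'a::polish_space measure \<Rightarrow> (('a \<Rightarrow> real) \<Rightarrow> 'c \<Rightarrow> 'c) \<Rightarrow> ('c::banach \<Rightarrow> 'a \<Rightarrow> real) \<Rightarrow>
       (('a \<Rightarrow> real) \<Rightarrow> 'c) \<Rightarrow> ('a \<Rightarrow> real) \<Rightarrow> ('c \<Rightarrow> 'a \<Rightarrow> real) set" where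
  "Grad m act pn d f =
     {V \<in> dual_module m act. AE x in m.
        V (d f) x = (dual_pointwise_norm m pn V x)\<^sup>2 \<and>
        (dual_pointwise_norm m pn V x)\<^sup>2 = (pn (d f) x)\<^sup>2 \<and>
        (pn (d f) x)\<^sup>2 = (min_weak_upper_gradient m f x)\<^sup>2}"

text \<open>Two elements of the dual module are equal iff their values agree almost everywhere.\<close>
definition infinitesimally_strictly_convex ::
    "'a::polish_space measure \<Rightarrow> (('a \<Rightarrow> real) \<Rightarrow> 'c \<Rightarrow> 'c) \<Rightarrow> ('c::banach \<Rightarrow> 'a \<Rightarrow> real) \<Rightarrow>
       (('a \<Rightarrow> real) \<Rightarrow> 'c) \<Rightarrow> bool" where
  "infinitesimally_strictly_convex m act pn d \<longleftrightarrow>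
     (\<forall>f\<in>sobolev_class m. \<exists>V\<in>Grad m act pn d f. \<forall>V'\<in>Grad m act pn d f. \<forall>w.
        AE x in m. V' w x = V w x)"


subsection \<open>Logarithm on \<open>[0,\<infinity>)\<close> with the value \<open>-\<infinity>\<close> at \<open>0\<close>\<close>

definition elog :: "real \<Rightarrow> ereal" where
  "elog p = (if p = 0 then -\<infinity> else ereal (ln p))"

end

theory Submission
  imports Defs
begin

text \<open>
  Davies' method. Let \<open>f\<^sub>t = T\<^sub>t 1\<^sub>B\<close> and \<open>\<psi> = exp (\<alpha> w)\<close> with \<open>w = min (d(\<cdot>, B)) (d(A, B))\<close>.
  Testing the subdifferential of the Cheeger energy at \<open>f\<^sub>t\<close> against \<open>(1 - \<epsilon> \<psi>) f\<^sub>t\<close>, whose weak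
  upper gradient is at most \<open>(1 - \<epsilon> \<psi>) |Df\<^sub>t| + \<epsilon> \<alpha> \<psi> |f\<^sub>t|\<close>, gives
  \<open>d/dt \<integral> \<psi> f\<^sub>t\<^sup>2 \<le> \<alpha>\<^sup>2/4 \<integral> \<psi> f\<^sub>t\<^sup>2\<close>, and \<open>\<alpha> = 2 d(A, B) / t\<close> yields
  \<open>\<integral>\<^sub>A f\<^sub>t\<^sup>2 \<le> exp (- d(A, B)\<^sup>2 / t) m(B)\<close>; the Cauchy-Schwarz inequality concludes. The Leibniz bound
  for weak upper gradients is proved along almost every curve of a test plan, to which the integrated
  definition localises by restricting the plan to sets of curves and by stopping its curves.
\<close>

subsection \<open>Absolutely continuous functions on the line\<close>

text \<open>Testing it with a competitor that differs from f_t by a term of order \<epsilon>, and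
  dividing by \<epsilon>, recovers the one inequality that an integration by parts would supply. The
  truncation of w makes \<psi> bounded, so that \<psi> f_t^2 is integrable and 1 - \<epsilon> \<psi>
  is nonnegative for small \<epsilon>. To first order in \<epsilon> the square of the gradient bound
  exceeds |Df_t|^2 by 2 \<epsilon> \<psi> (\<alpha> |f_t| |Df_t| - |Df_t|^2), and completing the
  square bounds the bracket by \<alpha>^2/4 f_t^2. The logarithm also demands that P_t(A, B) be
  nonnegative; this comes from the same kind of energy estimate, applied to the negative part of
  f_t.\<close>

definition primitive :: "(real \<Rightarrow> real) \<Rightarrow> real \<Rightarrow> real" where
  "primitive k t = (LINT r:{..t}|lborel. k r)"

lemma primitive_diff:
  assumes "integrable lborel k" "s \<le> t"
  shows "primitive k t - primitive k s = (LINT r:{s..t}|lborel. k r)"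
proof -
  have "primitive k t = (LINT r:{..s} \<union> {s<..t}|lborel. k r)"
    unfolding primitive_def using assms by (simp add: ivl_disj_un_one)
  also have "\<dots> = primitive k s + (LINT r:{s<..t}|lborel. k r)"
    unfolding primitive_def using assms
    by (intro set_integral_Un) (auto simp: set_integrable_def intro!: integrable_mult_indicator[where 'b=real, simplified])
  also have "(LINT r:{s<..t}|lborel. k r) = (LINT r:{s..t}|lborel. k r)"
    unfolding set_lebesgue_integral_def
    by (intro integral_cong_AE; (use assms in measurable)?)
       (use AE_lborel_singleton[of s] in \<open>auto elim!: eventually_mono simp: indicator_def\<close>)
  finally show ?thesis by simp
qed

lemma primitive_diff':
  assumes "integrable lborel k" "s \<le> t"
  shows "primitive k t - primitive k s = integral {s..t} k"
  using assms by (subst primitive_diff)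
    (auto intro!: set_borel_integral_eq_integral(2) integrable_mult_indicator[where 'b=real, simplified] simp: set_integrable_def)

text \<open>Lebesgue's differentiation theorem. It is invoked for averages over
  \<open>{x..x+h}\<close>, which are difference quotients from the right; its instance for the
  reflected function \<open>k (- x)\<close> yields those from the left.\<close>

lemma primitive_has_derivative_AE:
  fixes k :: "real \<Rightarrow> real"
  assumes k: "integrable lborel k"
  shows "AE t in lborel. (primitive k has_real_derivative k t) (at t)"
proof -
  have int: "k integrable_on cbox a b" for a b
    using k by (intro set_borel_integral_eq_integral(1))
      (auto simp: set_integrable_def intro: integrable_mult_indicator[where 'b=real, simplified])
  have int': "(\<lambda>x. k (- x)) integrable_on cbox a b" for a b
    using int[of "-b" "-a"] Henstock_Kurzweil_Integration.integrable_reflect_real[where f=k and a="-b" and b="-a"]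
    by (simp only: cbox_interval minus_minus)
  obtain N where N: "negligible N" "\<And>x e. x \<notin> N \<Longrightarrow> 0 < e \<Longrightarrow>
      \<exists>d>0. \<forall>h. 0 < h \<and> h < d \<longrightarrow> norm (integral (cbox x (x + h *\<^sub>R One)) k /\<^sub>R h ^ DIM(real) - k x) < e"
    using integrable_ccontinuous_explicit[OF int] by blast
  obtain M where M: "negligible M" "\<And>x e. x \<notin> M \<Longrightarrow> 0 < e \<Longrightarrow>
      \<exists>d>0. \<forall>h. 0 < h \<and> h < d \<longrightarrow>
        norm (integral (cbox x (x + h *\<^sub>R One)) (\<lambda>x. k (- x)) /\<^sub>R h ^ DIM(real) - k (- x)) < e"
    using integrable_ccontinuous_explicit[OF int'] by blast
  have "negligible (N \<union> uminus ` M)"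
    using N M by (auto intro!: negligible_Un negligible_differentiable_image_negligible simp: )
  then have "AE t in lebesgue. t \<notin> N \<union> uminus ` M"
    by (metis AE_not_in negligible_iff_null_sets)
  then have ae: "AE t in lborel. t \<notin> N \<union> uminus ` M"
    by (simp add: AE_completion_iff)
  show ?thesis
    using ae
  proof (eventually_elim)
    case (elim t)
    have "\<exists>d>0. \<forall>y. y \<noteq> t \<and> dist y t < d \<longrightarrow> dist ((primitive k y - primitive k t) / (y - t)) (k t) < e"
      if e: "e > 0" for e
    proof -
      obtain d1 where d1: "d1 > 0" "\<And>h. 0 < h \<Longrightarrow> h < d1 \<Longrightarrow> \<bar>integral {t..t+h} k / h - k t\<bar> < e"
        using N(2)[of t e] elim e by (auto simp: divide_inverse mult.commute)
      have "- t \<notin> M" using elim by force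
      then obtain d2 where d2: "d2 > 0" "\<And>h. 0 < h \<Longrightarrow> h < d2 \<Longrightarrow> \<bar>integral {-t..-t+h} (\<lambda>x. k (-x)) / h - k t\<bar> < e"
        using M(2)[of "-t" e] e by (auto simp: divide_inverse mult.commute)
      show ?thesis
      proof (intro exI[of _ "min d1 d2"] conjI allI impI)
        fix y assume y: "y \<noteq> t \<and> dist y t < min d1 d2"
        show "dist ((primitive k y - primitive k t) / (y - t)) (k t) < e"
        proof (cases "t < y")
          case True
          then show ?thesis
            using y d1(2)[of "y - t"] primitive_diff'[OF k, of t y] by (auto simp: dist_real_def)
        next
          case False
          have "integral {- t..- t + (t - y)} (\<lambda>x. k (- x)) = integral {y..t} k"
            using Henstock_Kurzweil_Integration.integral_reflect_real[of t y k] by simp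
          then have "\<bar>integral {y..t} k / (t - y) - k t\<bar> < e"
            using y d2(2)[of "t - y"] False by (auto simp: dist_real_def)
          moreover have "(primitive k y - primitive k t) / (y - t) = integral {y..t} k / (t - y)"
            using primitive_diff'[OF k, of y t] False y by (simp add: field_simps)
          ultimately show ?thesis by (simp add: dist_real_def)
        qed
      qed (use d1 d2 in auto)
    qed
    then show ?case
      by (auto simp: has_field_derivative_iff Lim_at)
  qed
qed

lemma primitive_isCont:
  assumes "integrable lborel k"
  shows "isCont (primitive k) t"
proof -
  have c: "continuous_on {t-1..t+1} (\<lambda>x. integral {t-1..x} k)"
    using assms by (intro indefinite_integral_continuous_1 set_borel_integral_eq_integral(1))
      (auto simp: set_integrable_def intro: integrable_mult_indicator[where 'b=real, simplified])
  have "continuous_on {t-1..t+1} (\<lambda>x. integral {t-1..x} k + primitive k (t-1))"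
    by (intro continuous_intros c)
  moreover have "integral {t-1..x} k + primitive k (t-1) = primitive k x" if "x \<in> {t-1..t+1}" for x
    using primitive_diff'[OF assms, of "t-1" x] that by simp
  ultimately have "continuous_on {t-1..t+1} (primitive k)"
    using continuous_on_cong by (smt (verit, best))
  then show ?thesis
    by (rule continuous_on_interior) (auto simp: interior_atLeastAtMost_real)
qed

lemma isCont_if_primitive_bound:
  fixes F :: "real \<Rightarrow> real"
  assumes "integrable lborel k" and le: "\<And>s. \<bar>F s - F t\<bar> \<le> \<bar>primitive k s - primitive k t\<bar>"
  shows "isCont F t"
proof -
  have "((\<lambda>s. \<bar>primitive k s - primitive k t\<bar>) \<longlongrightarrow> 0) (at t)"
    by (rule tendsto_rabs_zero[OF LIM_zero[OF primitive_isCont[OF assms(1), of t, unfolded isCont_def]]])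
  then have "((\<lambda>s. F s - F t) \<longlongrightarrow> 0) (at t)"
    by - (rule Lim_null_comparison[OF always_eventually], use le in auto)
  then show ?thesis unfolding isCont_def by (rule LIM_zero_cancel)
qed

lemma primitive_mono:
  assumes "integrable lborel k" "\<And>x. 0 \<le> k x" "s \<le> t"
  shows "primitive k s \<le> primitive k t"
  using primitive_diff[OF assms(1,3)] assms(2)
  by (metis (mono_tags, lifting) diff_ge_0_iff_ge indicator_pos_le integral_nonneg_AE mult_nonneg_nonneg
      AE_I2 real_scaleR_def set_lebesgue_integral_def)

lemma emeasure_density_Ioc:
  assumes "integrable lborel k" "\<And>x. 0 \<le> k x" "s \<le> t"
  shows "emeasure (density lborel (\<lambda>x. ennreal (k x))) {s<..t} = ennreal (primitive k t - primitive k s)"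
proof -
  have "emeasure (density lborel (\<lambda>x. ennreal (k x))) {s<..t} = (\<integral>\<^sup>+x. ennreal (k x * indicator {s..t} x) \<partial>lborel)"
    using assms(1) AE_lborel_singleton[of s]
    by (subst emeasure_density) (auto intro!: nn_integral_cong_AE simp: indicator_def elim!: eventually_mono)
  also have "\<dots> = ennreal (\<integral>x. k x * indicator {s..t} x \<partial>lborel)"
    using assms by (intro nn_integral_eq_integral)
     (auto simp: mult.commute intro: integrable_mult_indicator[where 'b=real, simplified])
  also have "(\<integral>x. k x * indicator {s..t} x \<partial>lborel) = primitive k t - primitive k s"
    using assms by (subst primitive_diff) (auto simp: set_lebesgue_integral_def mult.commute)
  finally show ?thesis .
qed

lemma measure_eqI_Ioc:
  fixes M N :: "real measure"
  assumes "sets M = sets borel" "sets N = sets borel"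
    and eq: "\<And>a b. a \<le> b \<Longrightarrow> emeasure M {a<..b} = emeasure N {a<..b}"
    and fin: "\<And>a b. a \<le> b \<Longrightarrow> emeasure M {a<..b} \<noteq> \<infinity>"
  shows "M = N"
proof (rule measure_eqI_generator_eq[where E="range (\<lambda>(a,b). {a<..b})" and \<Omega>=UNIV and A="\<lambda>n. {- real n<..real n}"])
  show "Int_stable (range (\<lambda>(a, b). {a<..b::real}))"
    by (auto simp: Int_stable_def intro!: range_eqI[where x="(max _ _, min _ _)"])
  show "\<And>X. X \<in> range (\<lambda>(a, b). {a<..b}) \<Longrightarrow> emeasure M X = emeasure N X"
  proof clarsimp
    fix a b :: real show "emeasure M {a<..b} = emeasure N {a<..b}"
      using eq[of a b] by (cases "a \<le> b") auto
  qed
  show "sets M = sigma_sets UNIV (range (\<lambda>(a, b). {a<..b}))"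
    "sets N = sigma_sets UNIV (range (\<lambda>(a, b). {a<..b}))"
    using assms by (auto simp: borel_sigma_sets_Ioc)
  show "(\<Union>i. {- real i<..real i}) = UNIV"
  proof safe
    fix x :: real
    obtain n where "\<bar>x\<bar> < real n" using reals_Archimedean2 by blast
    then show "x \<in> (\<Union>i. {- real i<..real i})" by (auto intro!: exI[of _ n])
  qed simp
  show "emeasure M {- real i<..real i} \<noteq> \<infinity>" for i using fin[of "- real i" "real i"] by simp
qed auto

text \<open>The fundamental theorem of calculus for absolutely continuous functions, with the
  modulus of continuity given as the primitive of an integrable \<open>k\<close>. The modulus
  excludes singular parts such as the Cantor function, so that the almost everywhere derivative
  determines all increments.\<close>

lemma abs_cont_representation:
  fixes F :: "real \<Rightarrow> real"
  assumes k: "integrable lborel k" "\<And>x. 0 \<le> k x"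
    and F: "\<And>s t. s \<le> t \<Longrightarrow> \<bar>F t - F s\<bar> \<le> primitive k t - primitive k s"
  obtains u where "integrable lborel u" "\<And>s t. s \<le> t \<Longrightarrow> F t - F s = primitive u t - primitive u s"
    "AE t in lborel. (F has_real_derivative u t) (at t)"
proof -
  let ?P = "primitive k"
  have Fc: "isCont F t" for t
  proof (rule isCont_if_primitive_bound[OF k(1)])
    show "\<bar>F s - F t\<bar> \<le> \<bar>?P s - ?P t\<bar>" for s
      using F[of s t] F[of t s] by (cases "s \<le> t") auto
  qed
  \<comment> \<open>\<open>?P + F\<close> and \<open>?P - F\<close> are nondecreasing and their Stieltjes measures add up to \<open>2 k dt\<close>, so
     that both are absolutely continuous and have Radon-Nikodym densities.\<close>
  define F1 where "F1 t = ?P t + F t" for t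
  define F2 where "F2 t = ?P t - F t" for t
  have mono: "s \<le> t \<Longrightarrow> F1 s \<le> F1 t" "s \<le> t \<Longrightarrow> F2 s \<le> F2 t" for s t
    using F[of s t] by (auto simp: F1_def F2_def)
  have cont: "continuous (at_right a) F1" "continuous (at_right a) F2" for a
    unfolding F1_def[abs_def] F2_def[abs_def]
    by (rule continuous_at_imp_continuous_at_within, intro isCont_add isCont_diff Fc primitive_isCont k(1))+
  define M1 where "M1 = interval_measure F1"
  define M2 where "M2 = interval_measure F2"
  have M12[simp]: "sets M1 = sets borel" "sets M2 = sets borel" "space M1 = UNIV" "space M2 = UNIV"
    by (auto simp: M1_def M2_def)
  have Ioc: "s \<le> t \<Longrightarrow> emeasure M1 {s<..t} = F1 t - F1 s" "s \<le> t \<Longrightarrow> emeasure M2 {s<..t} = F2 t - F2 s" for s t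
    unfolding M1_def M2_def using mono cont by (auto intro: emeasure_interval_measure_Ioc)
  define \<nu> where "\<nu> = measure_of UNIV (sets borel) (\<lambda>E. emeasure M1 E + emeasure M2 E)"
  have \<nu>: "emeasure \<nu> E = emeasure M1 E + emeasure M2 E" if "E \<in> sets borel" for E
    unfolding \<nu>_def
  proof (rule emeasure_measure_of_sigma)
    show "sigma_algebra UNIV (sets (borel::real measure))"
      using sets.sigma_algebra_axioms[of "borel::real measure"] by simp
    show "countably_additive (sets borel) (\<lambda>E. emeasure M1 E + emeasure M2 E)"
      by (auto simp: countably_additive_def suminf_add[symmetric] suminf_emeasure)
  qed (use that in \<open>auto simp: positive_def\<close>)
  have "\<nu> = density lborel (\<lambda>x. ennreal (2 * k x))"
  proof (rule measure_eqI_Ioc)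
    fix a b :: real assume ab: "a \<le> b"
    have "emeasure \<nu> {a<..b} = ennreal (F1 b - F1 a) + ennreal (F2 b - F2 a)"
      by (simp add: \<nu> Ioc ab)
    also have "\<dots> = ennreal ((F1 b - F1 a) + (F2 b - F2 a))"
      using mono[OF ab] by (intro ennreal_plus[symmetric]) auto
    also have "(F1 b - F1 a) + (F2 b - F2 a) = primitive (\<lambda>x. 2 * k x) b - primitive (\<lambda>x. 2 * k x) a"
      by (simp add: F1_def F2_def primitive_def)
    finally have *: "emeasure \<nu> {a<..b} = ennreal (primitive (\<lambda>x. 2 * k x) b - primitive (\<lambda>x. 2 * k x) a)" .
    then show "emeasure \<nu> {a<..b} = emeasure (density lborel (\<lambda>x. ennreal (2 * k x))) {a<..b}"
      using k ab by (subst emeasure_density_Ioc) auto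
    show "emeasure \<nu> {a<..b} \<noteq> \<infinity>" using * by simp
  qed (auto simp: \<nu>_def sets.sigma_sets_eq[of "borel::real measure", simplified])
  then have le: "emeasure M1 E \<le> emeasure (density lborel (\<lambda>x. ennreal (2 * k x))) E" if "E \<in> sets borel" for E
    using \<nu>[OF that] by simp
  have "absolutely_continuous lborel M1"
  proof -
    have "absolutely_continuous lborel (density lborel (\<lambda>x. ennreal (2 * k x)))"
      using k by (intro absolutely_continuousI_density) auto
    show ?thesis
      unfolding absolutely_continuous_def
    proof
      fix E :: "real set" assume "E \<in> null_sets lborel"
      then have E: "E \<in> null_sets (density lborel (\<lambda>x. ennreal (2 * k x)))" and b: "E \<in> sets borel"
        using \<open>absolutely_continuous lborel (density _ _)\<close> by (auto simp: absolutely_continuous_def)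
      show "E \<in> null_sets M1"
        using le[OF b] null_setsD1[OF E] b by (intro null_setsI) auto
    qed
  qed
  then obtain v where v: "v \<in> borel_measurable lborel" "density lborel v = M1"
    using sigma_finite_measure.Radon_Nikodym[OF sigma_finite_lborel, of M1] by auto
  have "emeasure M1 UNIV \<le> (\<integral>\<^sup>+x. ennreal (2 * k x) \<partial>lborel)"
    using le[of UNIV] k by (simp add: emeasure_density)
  also have "\<dots> < \<infinity>" 
    using k by (subst nn_integral_eq_integral) auto
  finally have fin: "(\<integral>\<^sup>+x. v x \<partial>lborel) < \<infinity>"
    using v(2) emeasure_density[OF v(1), of UNIV] by simp
  then have vfin: "AE x in lborel. v x \<noteq> \<infinity>"
    using v by (intro nn_integral_PInf_AE) auto
  define w where "w x = enn2real (v x)" for x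
  have w: "AE x in lborel. ennreal (w x) = v x"
    using vfin by eventually_elim (simp add: w_def ennreal_enn2real_if)
  have wint: "integrable lborel w"
  proof (rule integrableI_nonneg)
    show "w \<in> borel_measurable lborel" using v unfolding w_def by measurable
    show "(\<integral>\<^sup>+ x. ennreal (w x) \<partial>lborel) < \<infinity>" using fin nn_integral_cong_AE[OF w] by simp
  qed (simp add: w_def)
  have M1d: "M1 = density lborel (\<lambda>x. ennreal (w x))"
    unfolding v(2)[symmetric]
  proof (rule density_cong[OF v(1)])
    show "AE x in lborel. v x = ennreal (w x)" using w by eventually_elim simp
  qed (use wint in auto)
  \<comment> \<open>\<open>F\<close> is \<open>F1\<close> minus the primitive of \<open>k\<close>,
    so its density is that of \<open>F1\<close> minus \<open>k\<close>.\<close>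
  define u where "u x = w x - k x" for x
  have prim_u: "primitive u t = primitive w t - ?P t" for t
    unfolding u_def primitive_def using wint k(1)
    by (intro set_integral_diff) (auto simp: set_integrable_def intro!: integrable_mult_indicator[where 'b=real, simplified])
  have eq: "F t - F s = primitive u t - primitive u s" if "s \<le> t" for s t
  proof -
    have "ennreal (F1 t - F1 s) = ennreal (primitive w t - primitive w s)"
      using Ioc(1)[OF that] emeasure_density_Ioc[OF wint _ that] M1d by (simp add: w_def)
    then have "F1 t - F1 s = primitive w t - primitive w s"
      using mono(1)[OF that] primitive_mono[OF wint _ that] by (simp add: w_def)
    then show ?thesis by (simp add: prim_u F1_def)
  qed
  have uint: "integrable lborel u" using wint k(1) by (simp add: u_def[abs_def])
  have Feq: "F = (\<lambda>t. primitive u t + (F 0 - primitive u 0))"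
  proof
    fix t show "F t = primitive u t + (F 0 - primitive u 0)"
      using eq[of 0 t] eq[of t 0] by (cases "0 \<le> t") auto
  qed
  have "AE t in lborel. (F has_real_derivative u t) (at t)"
    using primitive_has_derivative_AE[OF uint]
    by eventually_elim (subst Feq, auto intro!: derivative_eq_intros)
  then show thesis using that uint eq by blast
qed

lemma nn_integral_primitive:
  assumes "integrable lborel v" "\<And>x. 0 \<le> v x" "s \<le> t"
  shows "(\<integral>\<^sup>+r\<in>{s..t}. ennreal (v r) \<partial>lborel) = ennreal (primitive v t - primitive v s)"
proof -
  have "(\<integral>\<^sup>+r\<in>{s..t}. ennreal (v r) \<partial>lborel) = (\<integral>\<^sup>+r. ennreal (indicator {s..t} r *\<^sub>R v r) \<partial>lborel)"
    by (intro nn_integral_cong) (simp add: indicator_def)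
  also have "\<dots> = ennreal (\<integral>r. indicator {s..t} r *\<^sub>R v r \<partial>lborel)"
    by (intro nn_integral_eq_integral integrable_mult_indicator assms(1)) (simp_all add: assms(2))
  also have "\<dots> = ennreal (primitive v t - primitive v s)"
    using primitive_diff[OF assms(1,3)] by (simp add: set_lebesgue_integral_def)
  finally show ?thesis .
qed

lemma primitive_lincomb:
  assumes "integrable lborel k" "integrable lborel v"
  shows "primitive (\<lambda>x. a * k x + b * v x) t = a * primitive k t + b * primitive v t"
proof -
  have "set_integrable lborel {..t} (\<lambda>x. a * k x)" "set_integrable lborel {..t} (\<lambda>x. b * v x)"
    unfolding set_integrable_def using assms by (simp_all add: integrable_mult_indicator[where 'b=real, simplified])
  then show ?thesis
    unfolding primitive_def by (simp add: set_integral_add(2))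
qed

lemma primitive_bounds:
  assumes "integrable lborel k" "\<And>x. 0 \<le> k x"
  shows "0 \<le> primitive k t" "primitive k t \<le> (LINT x|lborel. k x)"
proof -
  show "0 \<le> primitive k t"
    unfolding primitive_def set_lebesgue_integral_def using assms(2) by (intro integral_nonneg_AE) simp
  show "primitive k t \<le> (LINT x|lborel. k x)"
    unfolding primitive_def set_lebesgue_integral_def
    using assms by (intro integral_mono integrable_mult_indicator) (auto simp: indicator_def)
qed

text \<open>Continuing a curve constantly outside \<open>{a..b}\<close> frees later arguments from
  the interval: one global modulus \<open>primitive k\<close> bounds all increments.
  \<open>D\<close> is abstract because it is a distance in X in one application and an increment of
  a real function in another. The bound \<open>g\<close> may change sign, hence the absolute value
  in \<open>k\<close>.\<close>

lemma clamped_primitive: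
  fixes D :: "real \<Rightarrow> real \<Rightarrow> real"
  assumes "a \<le> b" and g: "set_integrable lborel {a..b} g" and diag: "\<And>s. D s s = 0"
    and D: "\<And>s t. a \<le> s \<Longrightarrow> s \<le> t \<Longrightarrow> t \<le> b \<Longrightarrow> D s t \<le> (LINT r:{s..t}|lborel. g r)"
  obtains k where "integrable lborel k" "\<And>x. 0 \<le> k x"
    "\<And>s t. s \<le> t \<Longrightarrow> D (max a (min b s)) (max a (min b t)) \<le> primitive k t - primitive k s"
proof -
  define k where "k r = \<bar>indicator {a..b} r *\<^sub>R g r\<bar>" for r
  have k: "integrable lborel k" using g unfolding k_def set_integrable_def by (rule integrable_abs)
  have k0: "0 \<le> k x" for x by (simp add: k_def)
  have "D (max a (min b s)) (max a (min b t)) \<le> primitive k t - primitive k s" if "s \<le> t" for s t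
  \<comment> \<open>If the clamped times coincide they may lie outside \<open>{s..t}\<close>, and
    \<open>D s s = 0\<close> is used; if they differ, the interval between them is contained in
    \<open>{s..t}\<close>.\<close>
  proof (cases "max a (min b s) = max a (min b t)")
    case True then show ?thesis using primitive_mono[OF k k0 that] diag by simp
  next
    case False
    let ?I = "{max a (min b s)..max a (min b t)}"
    have "s \<le> max a (min b s)" "max a (min b t) \<le> t" using False \<open>a \<le> b\<close> that by linarith+
    then have sub: "?I \<subseteq> {s..t}" "?I \<subseteq> {a..b}" using \<open>a \<le> b\<close> by auto
    have "a \<le> max a (min b s)" "max a (min b s) \<le> max a (min b t)" "max a (min b t) \<le> b"
      using \<open>a \<le> b\<close> that by linarith+
    then have "D (max a (min b s)) (max a (min b t)) \<le> (LINT r:?I|lborel. g r)" by (rule D)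
    also have "\<dots> = (LINT r:?I|lborel. indicator {a..b} r *\<^sub>R g r)"
      unfolding set_lebesgue_integral_def
    proof (rule Bochner_Integration.integral_cong[OF refl])
      fix r show "indicat_real ?I r *\<^sub>R g r = indicat_real ?I r *\<^sub>R indicat_real {a..b} r *\<^sub>R g r"
      proof (cases "r \<in> ?I")
        case True then have "r \<in> {a..b}" using sub by blast
        then show ?thesis by simp
      qed simp
    qed
    also have "\<dots> \<le> (LINT r:{s..t}|lborel. k r)"
      unfolding set_lebesgue_integral_def
    proof (rule integral_mono)
      show "integrable lborel (\<lambda>x. indicat_real ?I x *\<^sub>R indicat_real {a..b} x *\<^sub>R g x)"
        by (rule integrable_mult_indicator[OF _ g[unfolded set_integrable_def]]) simp
      show "integrable lborel (\<lambda>x. indicat_real {s..t} x *\<^sub>R k x)"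
        using k by (intro integrable_mult_indicator) auto
      show "indicat_real ?I x *\<^sub>R indicat_real {a..b} x *\<^sub>R g x \<le> indicat_real {s..t} x *\<^sub>R k x" for x
      proof (cases "x \<in> ?I")
        case True then have "x \<in> {s..t}" using sub by blast
        then show ?thesis using True by (simp add: k_def)
      qed (simp add: k0)
    qed
    also have "\<dots> = primitive k t - primitive k s" using primitive_diff[OF k that] by simp
    finally show ?thesis .
  qed
  then show thesis using that k k0 by blast
qed

section \<open>Gronwall's inequality and Lipschitz extension on the line\<close>

lemma set_integral_le_abs:
  fixes g :: "real \<Rightarrow> real"
  assumes g: "set_integrable lborel {a..b} g" and s: "a \<le> s" "s \<le> b"
  shows "(LINT r:{a..s}|lborel. g r) \<le> (LINT r:{a..b}|lborel. \<bar>g r\<bar>)"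
  unfolding set_lebesgue_integral_def
proof (rule integral_mono)
  show "integrable lborel (\<lambda>r. indicat_real {a..s} r *\<^sub>R g r)"
    using set_integrable_subset[OF g, of "{a..s}"] s unfolding set_integrable_def by simp
  show "integrable lborel (\<lambda>r. indicat_real {a..b} r *\<^sub>R \<bar>g r\<bar>)"
    using set_integrable_abs[OF g] unfolding set_integrable_def .
  show "indicat_real {a..s} r *\<^sub>R g r \<le> indicat_real {a..b} r *\<^sub>R \<bar>g r\<bar>" for r
    using s by (auto simp: indicator_def)
qed

text \<open>The integrating factor turns \<open>N\<close> into \<open>E\<close>, whose derivative is
  at most 0 almost everywhere on the interval. That alone does not make a function decrease;
  absolute continuity does, and the bound \<open>R\<close> on |N| is what makes the product
  \<open>E\<close> absolutely continuous.\<close>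

lemma gronwall_abs_cont:
  fixes N :: "real \<Rightarrow> real"
  assumes ab: "0 \<le> a" "a < b" and c: "0 \<le> c"
    and g: "set_integrable lborel {a..b} g"
    and N: "\<And>s t. a \<le> s \<Longrightarrow> s \<le> t \<Longrightarrow> t \<le> b \<Longrightarrow> \<bar>N t - N s\<bar> \<le> (LINT r:{s..t}|lborel. g r)"
    and der: "AE t in lborel. t \<in> {a<..<b} \<longrightarrow> (\<exists>D. (N has_real_derivative D) (at t) \<and> D \<le> c * N t)"
  shows "N b \<le> exp (c * (b - a)) * N a"
proof -
  define R where "R = \<bar>N a\<bar> + (LINT r:{a..b}|lborel. \<bar>g r\<bar>)"
  have NR: "\<bar>N s\<bar> \<le> R" if "a \<le> s" "s \<le> b" for s
  proof -
    have "\<bar>N s - N a\<bar> \<le> (LINT r:{a..s}|lborel. g r)" using N[of a s] that by simp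
    also have "\<dots> \<le> (LINT r:{a..b}|lborel. \<bar>g r\<bar>)" by (rule set_integral_le_abs[OF g that])
    finally show ?thesis by (simp add: R_def)
  qed
  define E where "E t = exp (- c * t) * N t" for t
  define D where "D s t = \<bar>E t - E s\<bar>" for s t
  have const: "set_integrable lborel {s..t} (\<lambda>r. c * R)" for s t :: real
    unfolding set_integrable_def by (rule integrable_scaleR_left) (simp add: integrable_indicator_iff emeasure_lborel_Icc_eq)
  have "D s t \<le> (LINT r:{s..t}|lborel. g r + c * R)" if st: "a \<le> s" "s \<le> t" "t \<le> b" for s t
  proof -
    have "E t - E s = exp (- c * t) * (N t - N s) + N s * (exp (- c * t) - exp (- c * s))"
      by (simp add: E_def algebra_simps)
    then have "D s t \<le> exp (- c * t) * \<bar>N t - N s\<bar> + \<bar>N s\<bar> * \<bar>exp (- c * t) - exp (- c * s)\<bar>"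
      unfolding D_def by (metis abs_exp_cancel abs_mult abs_triangle_ineq)
    also have "\<dots> \<le> 1 * (LINT r:{s..t}|lborel. g r) + R * (c * (t - s))"
    proof (intro add_mono mult_mono)
      show "exp (- c * t) \<le> 1" using ab c st by simp
      show "\<bar>N t - N s\<bar> \<le> (LINT r:{s..t}|lborel. g r)" by (rule N[OF st])
      show "\<bar>N s\<bar> \<le> R" using NR st by simp
      then show "0 \<le> R" by linarith
      have "1 - exp (- c * (t - s)) \<le> c * (t - s)" using exp_ge_add_one_self[of "- c * (t - s)"] by simp
      moreover have "exp (- c * s) \<le> 1" using ab c st by simp
      moreover have "0 \<le> 1 - exp (- c * (t - s))" using c st by simp
      ultimately have "exp (- c * s) * (1 - exp (- c * (t - s))) \<le> 1 * (c * (t - s))"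
        by (intro mult_mono) auto
      moreover have "exp (- c * s) * (1 - exp (- c * (t - s))) = exp (- c * s) - exp (- c * t)"
        by (simp add: algebra_simps flip: exp_add)
      moreover have "exp (- c * t) \<le> exp (- c * s)" using c st by (simp add: mult_left_mono)
      ultimately show "\<bar>exp (- c * t) - exp (- c * s)\<bar> \<le> c * (t - s)" by linarith
    qed simp_all
    also have "\<dots> = (LINT r:{s..t}|lborel. g r + c * R)"
    proof -
      have gs: "set_integrable lborel {s..t} g" by (rule set_integrable_subset[OF g]) (use st in auto)
      have "(LINT r:{s..t}|lborel. c * R) = c * R * (t - s)"
        using st by (simp add: set_lebesgue_integral_def)
      then show ?thesis unfolding set_integral_add(2)[OF gs const] by auto
    qed
    finally show ?thesis .
  qed
  moreover have "set_integrable lborel {a..b} (\<lambda>r. g r + c * R)"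
    by (rule set_integral_add(1)[OF g const])
  ultimately obtain k where k: "integrable lborel k" "\<And>x. 0 \<le> k x"
    "\<And>s t. s \<le> t \<Longrightarrow> D (max a (min b s)) (max a (min b t)) \<le> primitive k t - primitive k s"
    using clamped_primitive[of a b "\<lambda>r. g r + c * R" D] ab unfolding D_def by auto
  define F where "F t = E (max a (min b t))" for t
  have "\<bar>F t - F s\<bar> \<le> primitive k t - primitive k s" if "s \<le> t" for s t
    using k(3)[OF that] by (simp add: F_def D_def)
  from abs_cont_representation[OF k(1,2) this] obtain u where u: "integrable lborel u"
    "\<And>s t. s \<le> t \<Longrightarrow> F t - F s = primitive u t - primitive u s"
    "AE t in lborel. (F has_real_derivative u t) (at t)" by blast
  have "AE t in lborel. indicator {a..b} t *\<^sub>R u t \<le> 0"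
    using u(3) der AE_lborel_singleton[of a] AE_lborel_singleton[of b]
  proof eventually_elim
    case (elim t)
    show ?case
    \<comment> \<open>Inside the open interval clamping is the identity, so \<open>F\<close> and
      \<open>E\<close> have the same derivative; the two endpoints form a null set.\<close>
    proof (cases "t \<in> {a<..<b}")
      case True
      then obtain d where d: "(N has_real_derivative d) (at t)" "d \<le> c * N t" using elim(2) by blast
      have "(E has_real_derivative (exp (- c * t) * (d - c * N t))) (at t)"
        unfolding E_def by (auto intro!: derivative_eq_intros d(1) simp: algebra_simps)
      then have "(F has_real_derivative (exp (- c * t) * (d - c * N t))) (at t)"
      proof (rule has_field_derivative_transform_within_open[OF _ open_greaterThanLessThan True])
        fix x assume "x \<in> {a<..<b}"
        then have "max a (min b x) = x" by auto
        then show "E x = F x" by (simp add: F_def)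
      qed
      then have "u t = exp (- c * t) * (d - c * N t)" using elim(1) by (rule DERIV_unique[symmetric])
      then have "u t \<le> 0" using d(2) by (simp add: mult_nonneg_nonpos)
      then show ?thesis using True by simp
    next
      case False
      then have "t \<notin> {a..b}" using elim by auto
      then show ?thesis by simp
    qed
  qed
  then have "0 \<le> (LINT t|lborel. - (indicator {a..b} t *\<^sub>R u t))"
    by (intro integral_nonneg_AE) (auto elim: eventually_mono)
  then have "(LINT t|lborel. indicator {a..b} t *\<^sub>R u t) \<le> 0" by simp
  then have "F b - F a \<le> 0"
    using u(2)[of a b] primitive_diff[OF u(1), of a b] ab by (simp add: set_lebesgue_integral_def)
  then have "exp (- c * b) * N b \<le> exp (- c * a) * N a" using ab by (simp add: F_def E_def)
  then have "exp (c * b) * (exp (- c * b) * N b) \<le> exp (c * b) * (exp (- c * a) * N a)"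
    by (rule mult_left_mono) simp
  then show ?thesis by (simp add: algebra_simps flip: exp_add mult.assoc)
qed

text \<open>McShane's extension: \<open>\<phi>\<close> is 1-Lipschitz on \<open>S\<close> for the
  pseudometric |K p - K q|, and the infimal convolution \<open>F\<close> keeps this constant. It
  serves to extend a function along a curve from rational times to all times without enlarging its
  modulus.\<close>

lemma mcshane_extension:
  fixes \<phi> :: "real \<Rightarrow> real" and K :: "real \<Rightarrow> real"
  assumes "q0 \<in> S" and \<phi>: "\<And>p q. p \<in> S \<Longrightarrow> q \<in> S \<Longrightarrow> \<bar>\<phi> p - \<phi> q\<bar> \<le> \<bar>K p - K q\<bar>"
  obtains F where "\<And>q. q \<in> S \<Longrightarrow> F q = \<phi> q" "\<And>s t. \<bar>F s - F t\<bar> \<le> \<bar>K s - K t\<bar>"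
proof -
  define F where "F t = (INF q\<in>S. \<phi> q + \<bar>K q - K t\<bar>)" for t
  have bdd: "bdd_below ((\<lambda>q. \<phi> q + \<bar>K q - K t\<bar>) ` S)" for t
  proof (rule bdd_belowI2)
    fix q assume "q \<in> S"
    then show "\<phi> q0 - \<bar>K q0 - K t\<bar> \<le> \<phi> q + \<bar>K q - K t\<bar>"
      using \<phi>[OF assms(1), of q] by linarith
  qed
  have le: "F s \<le> F t + \<bar>K s - K t\<bar>" for s t
  proof -
    have "F s - \<bar>K s - K t\<bar> \<le> F t"
      unfolding F_def[of t]
    proof (rule cINF_greatest)
      fix q assume "q \<in> S"
      then have "F s \<le> \<phi> q + \<bar>K q - K s\<bar>" unfolding F_def by (intro cINF_lower bdd)
      then show "F s - \<bar>K s - K t\<bar> \<le> \<phi> q + \<bar>K q - K t\<bar>" by linarith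
    qed (use assms in auto)
    then show ?thesis by simp
  qed
  have "F q = \<phi> q" if "q \<in> S" for q
  proof (rule antisym)
    have "F q \<le> \<phi> q + \<bar>K q - K q\<bar>" unfolding F_def using that by (intro cINF_lower bdd)
    then show "F q \<le> \<phi> q" by simp
    show "\<phi> q \<le> F q" unfolding F_def
    proof (rule cINF_greatest)
      fix p assume "p \<in> S" then show "\<phi> q \<le> \<phi> p + \<bar>K p - K q\<bar>" using \<phi>[OF that, of p] by linarith
    qed (use assms in auto)
  qed
  moreover have "\<bar>F s - F t\<bar> \<le> \<bar>K s - K t\<bar>" for s t using le[of s t] le[of t s] by linarith
  ultimately show thesis by (rule that)
qed

lemma has_derivative_abs_bound:
  fixes F G :: "real \<Rightarrow> real"
  assumes F: "(F has_real_derivative u) (at r)" and G: "(G has_real_derivative k) (at r)"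
    and le: "\<forall>\<^sub>F s in at r. \<bar>F s - F r\<bar> \<le> \<bar>G s - G r\<bar>"
  shows "\<bar>u\<bar> \<le> \<bar>k\<bar>"
proof -
  have 1: "((\<lambda>s. \<bar>(F s - F r) / (s - r)\<bar>) \<longlongrightarrow> \<bar>u\<bar>) (at r)"
    using F by (intro tendsto_rabs) (simp add: has_field_derivative_iff)
  have 2: "((\<lambda>s. \<bar>(G s - G r) / (s - r)\<bar>) \<longlongrightarrow> \<bar>k\<bar>) (at r)"
    using G by (intro tendsto_rabs) (simp add: has_field_derivative_iff)
  show ?thesis
  proof (rule tendsto_le[OF _ 2 1])
    show "\<forall>\<^sub>F s in at r. \<bar>(F s - F r) / (s - r)\<bar> \<le> \<bar>(G s - G r) / (s - r)\<bar>"
      using le by eventually_elim (simp add: divide_right_mono)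
  qed simp
qed

text \<open>The passage from derivative bounds to upper gradient inequalities. The condition on
  \<open>h\<close> ranges over all derivatives of \<open>F\<close>, so it is void where
  \<open>F\<close> is not differentiable; such times are negligible because \<open>F\<close> is
  absolutely continuous.\<close>

lemma derivative_bound_imp_increment_bound:
  fixes F :: "real \<Rightarrow> real" and h :: "real \<Rightarrow> ennreal"
  assumes k: "integrable lborel k" "\<And>x. 0 \<le> k x"
    and F: "\<And>s t. s \<le> t \<Longrightarrow> \<bar>F t - F s\<bar> \<le> primitive k t - primitive k s"
    and h: "AE r in lborel. r \<in> {0<..<1} \<longrightarrow> (\<forall>u. (F has_real_derivative u) (at r) \<longrightarrow> ennreal \<bar>u\<bar> \<le> h r)"
  shows "ennreal \<bar>F 1 - F 0\<bar> \<le> (\<integral>\<^sup>+r\<in>{0..1}. h r \<partial>lborel)"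
proof -
  obtain u where u: "integrable lborel u" "\<And>s t. s \<le> t \<Longrightarrow> F t - F s = primitive u t - primitive u s"
    "AE t in lborel. (F has_real_derivative u t) (at t)"
    using abs_cont_representation[OF k F] by blast
  have "F 1 - F 0 = (LINT r|lborel. indicator {0..1} r *\<^sub>R u r)"
    using u(2)[of 0 1] primitive_diff[OF u(1), of 0 1] by (simp add: set_lebesgue_integral_def)
  then have "ennreal \<bar>F 1 - F 0\<bar> \<le> ennreal (LINT r|lborel. \<bar>indicator {0..1} r *\<^sub>R u r\<bar>)"
    by (intro ennreal_leI) (simp only: integral_abs_bound)
  also have "\<dots> = (\<integral>\<^sup>+r. ennreal \<bar>indicator {0..1} r *\<^sub>R u r\<bar> \<partial>lborel)"
    by (intro nn_integral_eq_integral[symmetric] integrable_abs integrable_mult_indicator u(1)) auto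
  also have "\<dots> \<le> (\<integral>\<^sup>+r\<in>{0..1}. h r \<partial>lborel)"
  proof (rule nn_integral_mono_AE)
    show "AE r in lborel. ennreal \<bar>indicator {0..1} r *\<^sub>R u r\<bar> \<le> h r * indicator {0..1} r"
      using u(3) h AE_lborel_singleton[of 0] AE_lborel_singleton[of 1]
      by eventually_elim (auto simp: indicator_def)
  qed
  finally show ?thesis .
qed

subsection \<open>Metric speed\<close>

text \<open>The lower bound for the difference quotients comes from a single function
  \<open>F q\<close>, the upper bound from the derivative of the primitive of \<open>v\<close>. The
  two meet because \<open>v\<close>, although defined as a supremum of derivatives, is shown to be
  an admissible modulus for the curve.\<close>

lemma metric_speed_curve:
  fixes \<eta> :: "real \<Rightarrow> 'a::metric_space"
  assumes k: "integrable lborel k" "\<And>x. 0 \<le> k x"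
    and \<eta>: "\<And>s t. s \<le> t \<Longrightarrow> dist (\<eta> s) (\<eta> t) \<le> primitive k t - primitive k s"
  obtains v where "integrable lborel v" "\<And>x. 0 \<le> v x" "\<And>x. v x \<le> k x"
    "\<And>s t. s \<le> t \<Longrightarrow> dist (\<eta> s) (\<eta> t) \<le> primitive v t - primitive v s"
    "AE t in lborel. ((\<lambda>s. dist (\<eta> s) (\<eta> t) / \<bar>s - t\<bar>) \<longlongrightarrow> v t) (at t)"
proof -
  let ?P = "primitive k"
  \<comment> \<open>Since \<open>d(\<eta> s, \<eta> t)\<close> is the supremum of \<open>|F q t - F q s|\<close> over \<open>q\<close>, the metric speed is the
     supremum of the derivatives of the functions \<open>F q\<close>.\<close>
  define F where "F q t = dist (\<eta> t) (\<eta> (real_of_rat q))" for q t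
  have Fd: "\<bar>F q t - F q s\<bar> \<le> dist (\<eta> s) (\<eta> t)" for q s t
    unfolding F_def using dist_triangle[of "\<eta> t" "\<eta> (real_of_rat q)" "\<eta> s"]
      dist_triangle[of "\<eta> s" "\<eta> (real_of_rat q)" "\<eta> t"] by (simp add: dist_commute abs_le_iff)
  have FP: "\<bar>F q t - F q s\<bar> \<le> ?P t - ?P s" if "s \<le> t" for q s t
    using Fd[of q t s] \<eta>[OF that] by simp
  have "\<exists>u. integrable lborel u \<and> (\<forall>s t. s \<le> t \<longrightarrow> F q t - F q s = primitive u t - primitive u s) \<and>
    (AE t in lborel. (F q has_real_derivative u t) (at t))" for q
    using abs_cont_representation[OF k FP[of _ _ q]] by metis
  then obtain u where u: "\<And>q. integrable lborel (u q)"
      "\<And>q s t. s \<le> t \<Longrightarrow> F q t - F q s = primitive (u q) t - primitive (u q) s"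
      "\<And>q. AE t in lborel. (F q has_real_derivative u q t) (at t)"
    by metis
  have ulek: "AE t in lborel. \<forall>q. \<bar>u q t\<bar> \<le> k t"
    unfolding AE_all_countable
  proof
    fix q
    show "AE t in lborel. \<bar>u q t\<bar> \<le> k t"
      using u(3)[of q] primitive_has_derivative_AE[OF k(1)]
    proof eventually_elim
      case (elim t)
      have "\<bar>F q s - F q t\<bar> \<le> \<bar>?P s - ?P t\<bar>" for s
        using FP[of s t q] FP[of t s q] by (cases "s \<le> t") auto
      then have "\<bar>u q t\<bar> \<le> \<bar>k t\<bar>"
        by (intro has_derivative_abs_bound[OF elim] always_eventually allI)
      then show ?case using k(2) by simp
    qed
  qed
  \<comment> \<open>Almost everywhere |u q t| is at most k t, so the truncation changes nothing
    there; it keeps the supremum finite at every t and dominates \<open>v\<close> by an integrable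
    function.\<close>
  define v where "v t = (SUP q. min \<bar>u q t\<bar> (k t))" for t
  have bdd: "bdd_above (range (\<lambda>q. min \<bar>u q t\<bar> (k t)))" for t
    by (intro bdd_aboveI[of _ "k t"]) auto
  have v_ge: "min \<bar>u q t\<bar> (k t) \<le> v t" for q t
    unfolding v_def by (intro cSUP_upper bdd) simp
  have v0: "0 \<le> v t" for t using v_ge[of 0 t] k(2)[of t] by linarith
  have vk: "v t \<le> k t" for t unfolding v_def by (intro cSUP_least) auto
  have vm: "v \<in> borel_measurable lborel"
    unfolding v_def[abs_def] using u(1) k(1) bdd by (intro borel_measurable_cSUP) auto
  have vint: "integrable lborel v"
    by (rule Bochner_Integration.integrable_bound[OF k(1) vm]) (use v0 vk k(2) in auto)
  let ?V = "primitive v"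
  have Vmono: "?V s \<le> ?V t" if "s \<le> t" for s t
    by (rule primitive_mono[OF vint v0 that])
  have uv: "AE t in lborel. \<bar>u q t\<bar> \<le> v t" for q
    using ulek by eventually_elim (use v_ge in \<open>metis min.absorb1\<close>)
  have FV: "\<bar>F q t - F q s\<bar> \<le> ?V t - ?V s" if "s \<le> t" for q s t
  proof -
    have "\<bar>F q t - F q s\<bar> = \<bar>LINT r:{s..t}|lborel. u q r\<bar>"
      using u(2)[OF that] primitive_diff[OF u(1) that] by simp
    also have "\<dots> \<le> (LINT r|lborel. \<bar>indicator {s..t} r *\<^sub>R u q r\<bar>)"
      unfolding set_lebesgue_integral_def by (rule integral_abs_bound)
    also have "\<dots> \<le> (LINT r|lborel. indicator {s..t} r *\<^sub>R v r)"
    proof (rule integral_mono_AE)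
      show "integrable lborel (\<lambda>r. \<bar>indicator {s..t} r *\<^sub>R u q r\<bar>)"
        by (intro integrable_abs integrable_mult_indicator u(1)) simp
      show "integrable lborel (\<lambda>r. indicator {s..t} r *\<^sub>R v r)"
        by (intro integrable_mult_indicator vint) simp
      show "AE r in lborel. \<bar>indicator {s..t} r *\<^sub>R u q r\<bar> \<le> indicator {s..t} r *\<^sub>R v r"
        using uv[of q] by eventually_elim (simp add: indicator_def)
    qed
    also have "\<dots> = ?V t - ?V s"
      using primitive_diff[OF vint that] by (simp add: set_lebesgue_integral_def)
    finally show ?thesis .
  qed
  \<comment> \<open>A rational time q just after s has its point within e/2 of
    \<open>\<eta> s\<close>, so |F q t - F q s| falls short of the distance between
    \<open>\<eta> s\<close> and \<open>\<eta> t\<close> by at most e.\<close>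
  have dV: "dist (\<eta> s) (\<eta> t) \<le> ?V t - ?V s" if "s \<le> t" for s t
  proof (rule field_le_epsilon)
    fix e :: real assume "0 < e"
    then obtain d where d: "d > 0" "\<And>x. \<bar>x - s\<bar> < d \<Longrightarrow> \<bar>?P x - ?P s\<bar> < e / 2"
      using primitive_isCont[OF k(1), of s] unfolding isCont_def LIM_def dist_real_def
      by (metis abs_zero diff_self half_gt_zero)
    obtain q where q: "s < real_of_rat q" "real_of_rat q < s + d"
      using of_rat_dense[of s "s + d"] d by auto
    have "dist (\<eta> s) (\<eta> (real_of_rat q)) \<le> e / 2"
      using \<eta>[of s "real_of_rat q"] d(2)[of "real_of_rat q"] q by linarith
    moreover have "dist (\<eta> s) (\<eta> t) \<le> \<bar>F q t - F q s\<bar> + 2 * dist (\<eta> s) (\<eta> (real_of_rat q))"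
      unfolding F_def using dist_triangle[of "\<eta> s" "\<eta> t" "\<eta> (real_of_rat q)"] by (simp add: dist_commute)
    ultimately show "dist (\<eta> s) (\<eta> t) \<le> ?V t - ?V s + e"
      using FV[OF that, of q] by linarith
  qed
  have u3: "AE t in lborel. \<forall>q. (F q has_real_derivative u q t) (at t)"
    unfolding AE_all_countable using u(3) by blast
  have "AE t in lborel. ((\<lambda>s. dist (\<eta> s) (\<eta> t) / \<bar>s - t\<bar>) \<longlongrightarrow> v t) (at t)"
    using primitive_has_derivative_AE[OF vint] ulek u3
  proof eventually_elim
    case (elim t)
    show ?case
    proof (rule order_tendstoI)
      fix a assume "a < v t"
      then obtain q where q: "a < min \<bar>u q t\<bar> (k t)"
        unfolding v_def using bdd by (subst (asm) less_cSUP_iff) auto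
      have "((\<lambda>s. \<bar>(F q s - F q t) / (s - t)\<bar>) \<longlongrightarrow> \<bar>u q t\<bar>) (at t)"
        using elim(3) by (intro tendsto_rabs) (simp add: has_field_derivative_iff)
      then have "\<forall>\<^sub>F s in at t. a < \<bar>(F q s - F q t) / (s - t)\<bar>"
        using q by (intro order_tendstoD) auto
      then show "\<forall>\<^sub>F s in at t. a < dist (\<eta> s) (\<eta> t) / \<bar>s - t\<bar>"
      proof eventually_elim
        case (elim s)
        have "\<bar>(F q s - F q t) / (s - t)\<bar> \<le> dist (\<eta> s) (\<eta> t) / \<bar>s - t\<bar>"
          using Fd[of q s t] by (simp add: divide_right_mono dist_commute)
        then show ?case using elim by linarith
      qed
    next
      fix a assume "v t < a"
      moreover have "((\<lambda>s. \<bar>(?V s - ?V t) / (s - t)\<bar>) \<longlongrightarrow> \<bar>v t\<bar>) (at t)"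
        using elim(1) by (intro tendsto_rabs) (simp add: has_field_derivative_iff)
      ultimately have "\<forall>\<^sub>F s in at t. \<bar>(?V s - ?V t) / (s - t)\<bar> < a"
        using v0[of t] by (intro order_tendstoD(2)) auto
      then show "\<forall>\<^sub>F s in at t. dist (\<eta> s) (\<eta> t) / \<bar>s - t\<bar> < a"
      proof eventually_elim
        case (elim s)
        have "dist (\<eta> s) (\<eta> t) \<le> \<bar>?V s - ?V t\<bar>"
          using dV[of s t] dV[of t s] by (cases "s \<le> t") (auto simp: dist_commute)
        then have "dist (\<eta> s) (\<eta> t) / \<bar>s - t\<bar> \<le> \<bar>(?V s - ?V t) / (s - t)\<bar>"
          by (simp add: divide_right_mono)
        then show ?case using elim by linarith
      qed
    qed
  qed
  then show thesis using that vint v0 vk dV by blast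
qed

definition clamp01 :: "real \<Rightarrow> real" where "clamp01 t = max 0 (min 1 t)"

lemma clamp01_simps[simp]: "clamp01 0 = 0" "clamp01 1 = 1" "0 \<le> clamp01 t" "clamp01 t \<le> 1"
   "clamp01 (clamp01 t) = clamp01 t"
  by (auto simp: clamp01_def)

lemma clamp01_id: "t \<in> {0..1} \<Longrightarrow> clamp01 t = t"
  by (auto simp: clamp01_def)

text \<open>
  \<^const>\<open>metric_speed\<close> is a limit, with an unspecified value where the limit does not exist;
  \<open>speed\<close> is jointly measurable in \<open>\<gamma>\<close> and \<open>t\<close>, and along an absolutely continuous curve the two
  agree almost everywhere.
\<close>
definition speed :: "(real \<Rightarrow> 'a::metric_space) \<Rightarrow> real \<Rightarrow> ennreal" where
  "speed \<gamma> t = limsup (\<lambda>n. ennreal (real (Suc n) * dist (\<gamma> (clamp01 (t + 1 / real (Suc n)))) (\<gamma> (clamp01 t))))"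

abbreviation "kinetic \<gamma> \<equiv> \<integral>\<^sup>+t\<in>{0..1}. (speed \<gamma> t)\<^sup>2 \<partial>lborel"

abbreviation "speed_length \<gamma> s t \<equiv> \<integral>\<^sup>+r\<in>{s..t}. speed \<gamma> r \<partial>lborel"

abbreviation "abs_cont_path \<gamma> \<equiv> abs_cont_curve 0 1 (\<lambda>s t. dist (\<gamma> s) (\<gamma> t))"

lemma abs_cont_curve_primitive:
  assumes "abs_cont_path \<gamma>"
  obtains k where "integrable lborel k" "\<And>x. 0 \<le> k x"
    "\<And>s t. s \<le> t \<Longrightarrow> dist (\<gamma> (clamp01 s)) (\<gamma> (clamp01 t)) \<le> primitive k t - primitive k s"
proof -
  obtain g where g: "set_integrable lborel {0..1} g"
    "\<And>s t. 0 \<le> s \<Longrightarrow> s \<le> t \<Longrightarrow> t \<le> 1 \<Longrightarrow> dist (\<gamma> s) (\<gamma> t) \<le> (LINT r:{s..t}|lborel. g r)"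
    using assms unfolding abs_cont_curve_def by blast
  show thesis
  proof (rule clamped_primitive[of 0 1 g "\<lambda>s t. dist (\<gamma> s) (\<gamma> t)"])
    fix k
    assume "integrable lborel k" "\<And>x. 0 \<le> k x"
      "\<And>s t. s \<le> t \<Longrightarrow> dist (\<gamma> (max 0 (min 1 s))) (\<gamma> (max 0 (min 1 t))) \<le> primitive k t - primitive k s"
    then show thesis by (intro that[of k]) (simp_all add: clamp01_def)
  qed (use g in auto)
qed

text \<open>Both notions of speed are identified with the two-sided limit \<open>v\<close>:
  \<open>speed\<close> samples it along the steps 1/(n+1), and \<open>metric_speed\<close> is the
  same limit at interior times, where clamping and the restriction to \<open>{0..1}\<close> are
  invisible.\<close>

lemma abs_cont_curve_speed:
  fixes \<gamma> :: "real \<Rightarrow> 'a::metric_space"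
  assumes "abs_cont_path \<gamma>"
  obtains v where "integrable lborel v" "\<And>x. 0 \<le> v x"
    "\<And>s t. s \<le> t \<Longrightarrow> dist (\<gamma> (clamp01 s)) (\<gamma> (clamp01 t)) \<le> primitive v t - primitive v s"
    "AE t in lborel. ((\<lambda>s. dist (\<gamma> (clamp01 s)) (\<gamma> (clamp01 t)) / \<bar>s - t\<bar>) \<longlongrightarrow> v t) (at t)"
    "AE t in lborel. speed \<gamma> t = ennreal (v t)"
    "AE t in lborel. t \<in> {0..1} \<longrightarrow> metric_speed \<gamma> t = v t"
proof -
  obtain k where k: "integrable lborel k" "\<And>x. 0 \<le> k x"
    "\<And>s t. s \<le> t \<Longrightarrow> dist (\<gamma> (clamp01 s)) (\<gamma> (clamp01 t)) \<le> primitive k t - primitive k s"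
    using abs_cont_curve_primitive[OF assms] by blast
  obtain v where v: "integrable lborel v" "\<And>x. 0 \<le> v x"
    "\<And>s t. s \<le> t \<Longrightarrow> dist (\<gamma> (clamp01 s)) (\<gamma> (clamp01 t)) \<le> primitive v t - primitive v s"
    and lim: "AE t in lborel. ((\<lambda>s. dist (\<gamma> (clamp01 s)) (\<gamma> (clamp01 t)) / \<bar>s - t\<bar>) \<longlongrightarrow> v t) (at t)"
    by (rule metric_speed_curve[of k "\<lambda>t. \<gamma> (clamp01 t)", OF k]; (rule that)?; assumption)
  have 1: "AE t in lborel. speed \<gamma> t = ennreal (v t)"
    using lim
  proof eventually_elim
    case (elim t)
    have "filterlim (\<lambda>n. t + 1 / real (Suc n)) (at t) sequentially"
      unfolding filterlim_at
    proof
      show "(\<lambda>n. t + 1 / real (Suc n)) \<longlonglongrightarrow> t"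
        using LIMSEQ_inverse_real_of_nat_add[of t] by (simp add: inverse_eq_divide)
      show "\<forall>\<^sub>F n in sequentially. t + 1 / real (Suc n) \<in> UNIV \<and> t + 1 / real (Suc n) \<noteq> t"
        by (rule always_eventually) simp
    qed
    then have "(\<lambda>n. dist (\<gamma> (clamp01 (t + 1 / real (Suc n)))) (\<gamma> (clamp01 t)) / \<bar>t + 1 / real (Suc n) - t\<bar>) \<longlonglongrightarrow> v t"
      by (rule filterlim_compose[OF elim])
    then have "(\<lambda>n. real (Suc n) * dist (\<gamma> (clamp01 (t + 1 / real (Suc n)))) (\<gamma> (clamp01 t))) \<longlonglongrightarrow> v t"
      by (simp add: mult.commute)
    then have "(\<lambda>n. ennreal (real (Suc n) * dist (\<gamma> (clamp01 (t + 1 / real (Suc n)))) (\<gamma> (clamp01 t)))) \<longlonglongrightarrow> ennreal (v t)"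
      by (rule tendsto_ennrealI)
    then show ?case unfolding speed_def by (rule lim_imp_Limsup[OF sequentially_bot])
  qed
  have 2: "AE t in lborel. t \<in> {0..1} \<longrightarrow> metric_speed \<gamma> t = v t"
    using lim AE_lborel_singleton[of 0] AE_lborel_singleton[of 1]
  proof eventually_elim
    case (elim t)
    show ?case
    proof
      assume "t \<in> {0..1}"
      then have t: "t \<in> {0<..<1}" using elim by auto
      have "at t within {0..1} = at t" using t by (intro at_within_interior) auto
      moreover have "((\<lambda>s. dist (\<gamma> s) (\<gamma> t) / \<bar>s - t\<bar>) \<longlongrightarrow> v t) (at t)"
      proof (rule Lim_transform_eventually[OF elim(1)])
        have "\<forall>\<^sub>F s in at t. s \<in> {0<..<1}" using t by (intro eventually_at_in_open') auto
        then show "\<forall>\<^sub>F s in at t. dist (\<gamma> (clamp01 s)) (\<gamma> (clamp01 t)) / \<bar>s - t\<bar> = dist (\<gamma> s) (\<gamma> t) / \<bar>s - t\<bar>"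
          by eventually_elim (use t in \<open>simp add: clamp01_id\<close>)
      qed
      ultimately show "metric_speed \<gamma> t = v t"
        unfolding metric_speed_def by (simp add: tendsto_Lim)
    qed
  qed
  show thesis by (rule that[OF v lim 1 2])
qed

subsection \<open>The space of curves\<close>

text \<open>Compactness of [0,1] makes the boundedness built into \<open>cfunspace\<close>
  automatic.\<close>

lemma path_space_iff:
  "\<gamma> \<in> mspace path_space \<longleftrightarrow> \<gamma> \<in> extensional {0..1} \<and> continuous_on {0..1} \<gamma>"
proof -
  have "compactin (top_of_set {0..1::real}) (topspace (top_of_set {0..1}))"
    by (simp add: compactin_subtopology)
  from compactin_mspace_cfunspace[OF this, of euclidean_metric] show ?thesis
    unfolding path_space_def by (auto simp: continuous_map_iff_continuous)
qed

lemma openin_path_subset: "openin (mtopology_of path_space) U \<Longrightarrow> U \<subseteq> mspace path_space"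
  using openin_subset[of "mtopology_of path_space" U] by simp

lemma space_path_borel: "space path_borel = mspace path_space"
  unfolding path_borel_def by (intro space_measure_of) (auto dest: openin_path_subset)

text \<open>Distances at single times are at most the distance in \<open>path_space\<close>. A
  criterion in terms of pointwise distances keeps the supremum distance out of later measurability
  arguments.\<close>

lemma open_in_path_borel:
  assumes "U \<subseteq> mspace path_space"
    and "\<And>\<gamma>. \<gamma> \<in> U \<Longrightarrow> \<exists>r>0. \<forall>\<gamma>'\<in>mspace path_space. (\<forall>t\<in>{0..1}. dist (\<gamma> t) (\<gamma>' t) < r) \<longrightarrow> \<gamma>' \<in> U"
  shows "openin (mtopology_of path_space) U"
proof -
  interpret P: Metric_space "mspace path_space" "mdist path_space" by simp
  have d: "dist (\<gamma> t) (\<gamma>' t) \<le> mdist path_space \<gamma> \<gamma>'"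
    if "\<gamma> \<in> mspace path_space" "\<gamma>' \<in> mspace path_space" "t \<in> {0..1}" for \<gamma> \<gamma>' :: "real \<Rightarrow> 'a" and t
    using mdist_cfunspace_imp_mdist_le[OF that(1,2)[unfolded path_space_def] order_refl] that(3)
    by (simp add: path_space_def)
  show ?thesis
    unfolding mtopology_of_def P.openin_mtopology
  proof (intro conjI allI impI assms(1))
    fix \<gamma> assume g: "\<gamma> \<in> U"
    then obtain r where r: "r > 0" "\<And>\<gamma>'. \<gamma>' \<in> mspace path_space \<Longrightarrow> (\<forall>t\<in>{0..1}. dist (\<gamma> t) (\<gamma>' t) < r) \<Longrightarrow> \<gamma>' \<in> U"
      using assms(2) by blast
    have "P.mball \<gamma> r \<subseteq> U"
    proof
      fix \<gamma>' assume "\<gamma>' \<in> P.mball \<gamma> r"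
      then have "\<gamma> \<in> mspace path_space" "\<gamma>' \<in> mspace path_space" "mdist path_space \<gamma> \<gamma>' < r" by auto
      then show "\<gamma>' \<in> U" using d[of \<gamma> \<gamma>'] by (intro r(2)) (auto simp del: atLeastAtMost_iff intro: le_less_trans)
    qed
    then show "\<exists>r>0. P.mball \<gamma> r \<subseteq> U" using r(1) by blast
  qed
qed

lemma sets_path_borelI: "openin (mtopology_of path_space) U \<Longrightarrow> U \<in> sets path_borel"
  unfolding path_borel_def by (subst sets_measure_of) (auto dest: openin_path_subset)

lemma eval_measurable:
  fixes t :: real
  assumes "t \<in> {0..1}"
  shows "(\<lambda>\<gamma>. \<gamma> t) \<in> path_borel \<rightarrow>\<^sub>M (borel :: 'a::metric_space measure)"
proof (rule borel_measurableI)
  fix S :: "'a set" assume "open S"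
  show "(\<lambda>\<gamma>. \<gamma> t) -` S \<inter> space path_borel \<in> sets path_borel"
  proof (intro sets_path_borelI open_in_path_borel)
    fix \<gamma> :: "real \<Rightarrow> 'a" assume "\<gamma> \<in> (\<lambda>\<gamma>. \<gamma> t) -` S \<inter> space path_borel"
    then have "\<gamma> t \<in> S" by simp
    then obtain r where "r > 0" "\<And>y. dist y (\<gamma> t) < r \<Longrightarrow> y \<in> S"
      using \<open>open S\<close> unfolding open_dist by blast
    then show "\<exists>r>0. \<forall>\<gamma>'\<in>mspace path_space. (\<forall>t\<in>{0..1}. dist (\<gamma> t) (\<gamma>' t) < r) \<longrightarrow>
        \<gamma>' \<in> (\<lambda>\<gamma>. \<gamma> t) -` S \<inter> space path_borel"
      using assms by (intro exI[of _ r]) (auto simp: space_path_borel dist_commute)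
  qed (auto simp: space_path_borel)
qed

text \<open>Freezing the curve outside \<open>{s..t}\<close>, rather than rescaling time, leaves the
  speed inside unchanged, so that integrals of slope times speed simply restrict to
  \<open>{s..t}\<close>. The endpoints become \<open>\<gamma> s\<close> and
  \<open>\<gamma> t\<close>, which turns an endpoint inequality into one for any pair of times. The
  restricted abstraction keeps the result extensional, as \<open>path_space\<close> demands.\<close>

definition stop :: "real \<Rightarrow> real \<Rightarrow> (real \<Rightarrow> 'a) \<Rightarrow> (real \<Rightarrow> 'a)" where
  "stop s t \<gamma> = (\<lambda>r\<in>{0..1}. \<gamma> (max s (min t r)))"

lemma stop_apply: "r \<in> {0..1} \<Longrightarrow> stop s t \<gamma> r = \<gamma> (max s (min t r))"
  by (simp add: stop_def)

lemma stop_path_space: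
  assumes "0 \<le> s" "s \<le> t" "t \<le> 1" "\<gamma> \<in> mspace path_space"
  shows "stop s t \<gamma> \<in> mspace path_space"
proof -
  have "continuous_on {0..1} (\<lambda>r. \<gamma> (max s (min t r)))"
  proof (rule continuous_on_compose2[of "{0..1}" \<gamma>])
    show "continuous_on {0..1} (\<lambda>r. max s (min t r))" by (intro continuous_intros)
  qed (use assms in \<open>auto simp: path_space_iff\<close>)
  then have "continuous_on {0..1} (stop s t \<gamma>)"
    by (rule continuous_on_eq) (simp add: stop_def)
  then show ?thesis by (simp add: path_space_iff stop_def)
qed

lemma stop_measurable:
  assumes "0 \<le> s" "s \<le> t" "t \<le> 1"
  shows "stop s t \<in> path_borel \<rightarrow>\<^sub>M (path_borel :: (real \<Rightarrow> 'a::metric_space) measure)"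
  unfolding path_borel_def[of, where 'a='a] 
proof (rule measurable_measure_of)
  show "stop s t \<in> space (sigma (mspace path_space) {U. openin (mtopology_of path_space) U}) \<rightarrow> mspace path_space"
    using assms stop_path_space unfolding path_borel_def[symmetric] space_path_borel by blast
  fix U :: "(real \<Rightarrow> 'a) set" assume "U \<in> {U. openin (mtopology_of path_space) U}"
  then have U: "openin (mtopology_of path_space) U" by simp
  interpret P: Metric_space "mspace path_space" "mdist path_space :: (real \<Rightarrow> 'a) \<Rightarrow> _" by simp
  have "openin (mtopology_of path_space) (stop s t -` U \<inter> mspace path_space)"
  proof (rule open_in_path_borel)
    fix \<gamma> assume g: "\<gamma> \<in> stop s t -` U \<inter> mspace path_space"
    then obtain r where r: "r > 0" "P.mball (stop s t \<gamma>) r \<subseteq> U"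
      using U unfolding mtopology_of_def P.openin_mtopology by blast
    show "\<exists>r>0. \<forall>\<gamma>'\<in>mspace path_space. (\<forall>t\<in>{0..1}. dist (\<gamma> t) (\<gamma>' t) < r) \<longrightarrow>
        \<gamma>' \<in> stop s t -` U \<inter> mspace path_space"
    \<comment> \<open>Strict bounds at each time give only a weak bound on the supremum distance,
      hence r/2.\<close>
    proof (intro exI[of _ "r/2"] conjI ballI impI)
      fix \<gamma>' :: "real \<Rightarrow> 'a" assume g': "\<gamma>' \<in> mspace path_space" "\<forall>t\<in>{0..1}. dist (\<gamma> t) (\<gamma>' t) < r/2"
      have st: "stop s t \<gamma> \<in> mspace path_space" "stop s t \<gamma>' \<in> mspace path_space"
        using g g' assms by (auto intro: stop_path_space)
      have "mdist path_space (stop s t \<gamma>) (stop s t \<gamma>') \<le> r/2"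
        unfolding path_space_def
      proof (rule mdist_cfunspace_le)
        fix x assume "x \<in> topspace (top_of_set {0..1::real})"
        moreover from this have "max s (min t x) \<in> {0..1}" using assms by (auto simp: max_def min_def)
        ultimately show "mdist euclidean_metric (stop s t \<gamma> x) (stop s t \<gamma>' x) \<le> r/2"
          using g'(2)[rule_format, of "max s (min t x)"] by (simp add: stop_apply)
      qed (use r in auto)
      then have "stop s t \<gamma>' \<in> P.mball (stop s t \<gamma>) r" using st r(1) by simp
      then show "\<gamma>' \<in> stop s t -` U \<inter> mspace path_space" using r(2) g' by blast
    qed (use r in auto)
  qed auto
  then show "stop s t -` U \<inter> space (sigma (mspace path_space) {U. openin (mtopology_of path_space) U})
    \<in> sets (sigma (mspace path_space) {U. openin (mtopology_of path_space) U})"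
    unfolding path_borel_def[symmetric] space_path_borel by (rule sets_path_borelI)
qed (auto dest: openin_path_subset)

section \<open>Joint measurability in the curve and the time\<close>

lemma path_clamp_continuous:
  assumes "\<gamma> \<in> mspace path_space"
  shows "continuous_on UNIV (\<lambda>t. \<gamma> (clamp01 t))"
proof (rule continuous_on_compose2[of "{0..1}" \<gamma>])
  show "continuous_on UNIV clamp01" unfolding clamp01_def[abs_def] by (intro continuous_intros)
qed (use assms in \<open>auto simp: path_space_iff\<close>)

text \<open>Time is rounded down to multiples of 1/(n+1). Each approximation evaluates the curve at
  countably many fixed times and is therefore measurable; continuity of the curve gives pointwise
  convergence. Clamping makes the evaluation meaningful at every real time, so that the product can
  be taken with the whole line.\<close>

lemma eval_joint_measurable:
  "(\<lambda>p. fst p (clamp01 (snd p))) \<in> path_borel \<Otimes>\<^sub>M borel \<rightarrow>\<^sub>M (borel :: 'a::metric_space measure)"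
proof (rule borel_measurable_LIMSEQ_metric)
  fix n :: nat
  have "(\<lambda>p. (\<lambda>i p. fst p (clamp01 (real_of_int i / real (Suc n)))) \<lfloor>snd p * real (Suc n)\<rfloor> p)
    \<in> (path_borel :: (real \<Rightarrow> 'a) measure) \<Otimes>\<^sub>M borel \<rightarrow>\<^sub>M borel"
  proof (rule measurable_compose_countable[of "\<lambda>i p. fst p (clamp01 (real_of_int i / real (Suc n)))" _ _ "\<lambda>p. \<lfloor>snd p * real (Suc n)\<rfloor>"])
    show "(\<lambda>p. fst p (clamp01 (real_of_int i / real (Suc n)))) \<in> (path_borel :: (real \<Rightarrow> 'a) measure) \<Otimes>\<^sub>M borel \<rightarrow>\<^sub>M borel" for i
      by (rule measurable_compose[OF measurable_fst eval_measurable]) simp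
  qed measurable
  then show "(\<lambda>p. fst p (clamp01 (\<lfloor>snd p * real (Suc n)\<rfloor> / real (Suc n))))
    \<in> (path_borel :: (real \<Rightarrow> 'a) measure) \<Otimes>\<^sub>M borel \<rightarrow>\<^sub>M borel" by simp
next
  fix p :: "(real \<Rightarrow> 'a) \<times> real" assume "p \<in> space (path_borel \<Otimes>\<^sub>M borel)"
  then have p: "fst p \<in> mspace path_space" by (auto simp: space_pair_measure space_path_borel)
  have "(\<lambda>n. \<lfloor>snd p * real (Suc n)\<rfloor> / real (Suc n)) \<longlonglongrightarrow> snd p"
  proof (rule real_tendsto_sandwich)
    show "(\<lambda>n. snd p - 1 / real (Suc n)) \<longlonglongrightarrow> snd p"
      using LIMSEQ_inverse_real_of_nat_add_minus[of "snd p"] by (simp add: inverse_eq_divide)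
    show "(\<lambda>n. snd p) \<longlonglongrightarrow> snd p" by simp
    show "\<forall>\<^sub>F n in sequentially. \<lfloor>snd p * real (Suc n)\<rfloor> / real (Suc n) \<le> snd p"
      by (intro always_eventually allI) (simp add: divide_le_eq)
    show "\<forall>\<^sub>F n in sequentially. snd p - 1 / real (Suc n) \<le> \<lfloor>snd p * real (Suc n)\<rfloor> / real (Suc n)"
    proof (intro always_eventually allI)
      fix n
      have "snd p * real (Suc n) - 1 \<le> \<lfloor>snd p * real (Suc n)\<rfloor>" by linarith
      then have "(snd p * real (Suc n) - 1) / real (Suc n) \<le> \<lfloor>snd p * real (Suc n)\<rfloor> / real (Suc n)"
        by (rule divide_right_mono) simp
      then show "snd p - 1 / real (Suc n) \<le> \<lfloor>snd p * real (Suc n)\<rfloor> / real (Suc n)"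
        by (simp add: diff_divide_distrib)
    qed
  qed
  then show "(\<lambda>n. fst p (clamp01 (\<lfloor>snd p * real (Suc n)\<rfloor> / real (Suc n)))) \<longlonglongrightarrow> fst p (clamp01 (snd p))"
    by (rule continuous_on_tendsto_compose[OF path_clamp_continuous[OF p]]) simp_all
qed

lemma eval_joint_measurable':
  assumes "f \<in> M \<rightarrow>\<^sub>M path_borel" "g \<in> M \<rightarrow>\<^sub>M borel"
  shows "(\<lambda>x. f x (clamp01 (g x))) \<in> M \<rightarrow>\<^sub>M (borel :: 'a::metric_space measure)"
  by (rule measurable_compose[OF measurable_Pair[OF assms] eval_joint_measurable, unfolded fst_conv snd_conv])

lemma speed_measurable:
  assumes f: "f \<in> M \<rightarrow>\<^sub>M path_borel" and g: "g \<in> M \<rightarrow>\<^sub>M borel"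
  shows "(\<lambda>x. speed (f x :: real \<Rightarrow> 'a::polish_space) (g x)) \<in> borel_measurable M"
  unfolding speed_def
proof (rule borel_measurable_limsup)
  fix n
  have "(\<lambda>x. g x + 1 / real (Suc n)) \<in> borel_measurable M" using g by simp
  from eval_joint_measurable'[OF f this] eval_joint_measurable'[OF f g]
  have "(\<lambda>x. dist (f x (clamp01 (g x + 1 / real (Suc n)))) (f x (clamp01 (g x)))) \<in> borel_measurable M"
    by (rule borel_measurable_dist)
  then show "(\<lambda>x. ennreal (real (Suc n) * dist (f x (clamp01 (g x + 1 / real (Suc n)))) (f x (clamp01 (g x))))) \<in> borel_measurable M"
    by (rule measurable_compose[OF borel_measurable_times[OF borel_measurable_const] measurable_ennreal])
qed

text \<open>
  A measurable description of the absolutely continuous curves of finite energy: by continuity the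
  countably many inequalities below imply those for all pairs of times.
\<close>
definition regular_curve :: "(real \<Rightarrow> 'a::metric_space) \<Rightarrow> bool" where
  "regular_curve \<gamma> \<longleftrightarrow> kinetic \<gamma> < \<infinity> \<and>
     (\<forall>p q::rat. 0 \<le> p \<and> p \<le> q \<and> q \<le> 1 \<longrightarrow>
        ennreal (dist (\<gamma> (real_of_rat p)) (\<gamma> (real_of_rat q))) \<le> speed_length \<gamma> (real_of_rat p) (real_of_rat q))"

lemma speed_path_measurable:
  "\<gamma> \<in> mspace path_space \<Longrightarrow> speed (\<gamma> :: real \<Rightarrow> 'a::polish_space) \<in> borel_measurable borel"
  using speed_measurable[of "\<lambda>_. \<gamma>" borel "\<lambda>t. t"] by (simp add: space_path_borel)

lemma speed_joint_measurable:
  "(\<lambda>(\<gamma>, t). speed (\<gamma> :: real \<Rightarrow> 'a::polish_space) t) \<in> borel_measurable (path_borel \<Otimes>\<^sub>M borel)"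
  unfolding split_beta' by (rule speed_measurable) simp_all

lemma case_prod_speed_measurable:
  "case_prod speed \<in> borel_measurable ((path_borel :: (real \<Rightarrow> 'a::polish_space) measure) \<Otimes>\<^sub>M lborel)"
  using speed_joint_measurable[where 'a='a]
  by (subst measurable_cong_sets[OF sets_pair_measure_cong[OF refl sets_lborel] refl]) simp

lemma energy_measurable:
  "(\<lambda>\<gamma>. kinetic \<gamma>) \<in> borel_measurable (path_borel :: (real \<Rightarrow> 'a::polish_space) measure)"
proof -
  note case_prod_speed_measurable[measurable]
  show ?thesis by measurable
qed

lemma regular_curve_measurable:
  "{\<gamma> \<in> space path_borel. regular_curve (\<gamma> :: real \<Rightarrow> 'a::polish_space)} \<in> sets path_borel"
proof -
  note case_prod_speed_measurable[measurable]
  have 2: "(\<lambda>\<gamma>. speed_length \<gamma> p q) \<in> borel_measurable (path_borel :: (real \<Rightarrow> 'a) measure)" for p q :: real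
    by measurable
  have 3: "{\<gamma> \<in> space path_borel. 0 \<le> p \<and> p \<le> q \<and> q \<le> 1 \<longrightarrow>
        ennreal (dist (\<gamma> (real_of_rat p)) (\<gamma> (real_of_rat q))) \<le> speed_length \<gamma> (real_of_rat p) (real_of_rat q)}
        \<in> sets (path_borel :: (real \<Rightarrow> 'a) measure)" for p q :: rat
  proof (cases "0 \<le> p \<and> p \<le> q \<and> q \<le> 1")
    case True
    then have pq: "real_of_rat p \<in> {0..1}" "real_of_rat q \<in> {0..1}"
      by (auto simp: zero_le_of_rat_iff of_rat_le_1_iff)
    have "(\<lambda>\<gamma>. ennreal (dist (\<gamma> (real_of_rat p)) (\<gamma> (real_of_rat q)))) \<in> borel_measurable (path_borel :: (real \<Rightarrow> 'a) measure)"
      by (rule measurable_compose[OF borel_measurable_dist[OF eval_measurable[OF pq(1)] eval_measurable[OF pq(2)]] measurable_ennreal])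
    from borel_measurable_le[OF this 2] show ?thesis using True by simp
  next
    case False
    then have "{\<gamma> \<in> space path_borel. 0 \<le> p \<and> p \<le> q \<and> q \<le> 1 \<longrightarrow>
        ennreal (dist (\<gamma> (real_of_rat p)) (\<gamma> (real_of_rat q))) \<le> speed_length \<gamma> (real_of_rat p) (real_of_rat q)}
        = space (path_borel :: (real \<Rightarrow> 'a) measure)" by blast
    then show ?thesis by simp
  qed
  show ?thesis
    unfolding regular_curve_def
    by (intro sets.sets_Collect_conj sets.sets_Collect_countable_All 3 borel_measurable_less energy_measurable borel_measurable_const)
qed

lemma regular_curve_dist:
  fixes \<gamma> :: "real \<Rightarrow> 'a::polish_space"
  assumes \<gamma>: "\<gamma> \<in> mspace path_space" "regular_curve \<gamma>" and st: "0 \<le> s" "s \<le> t" "t \<le> 1"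
  shows "ennreal (dist (\<gamma> s) (\<gamma> t)) \<le> speed_length \<gamma> s t"
proof (cases "s = t")
  case False
  then have "s < t" using st by simp
  have cont: "continuous_on {0..1} \<gamma>" using \<gamma> by (simp add: path_space_iff)
  show ?thesis
  proof (rule ennreal_le_epsilon)
    fix e :: real assume "0 < e"
    obtain d1 where d1: "d1 > 0" "\<And>x. x \<in> {0..1} \<Longrightarrow> dist x s < d1 \<Longrightarrow> dist (\<gamma> x) (\<gamma> s) < e/2"
      using cont[unfolded continuous_on_iff, rule_format, of s "e/2"] st \<open>0 < e\<close> by auto
    obtain d2 where d2: "d2 > 0" "\<And>x. x \<in> {0..1} \<Longrightarrow> dist x t < d2 \<Longrightarrow> dist (\<gamma> x) (\<gamma> t) < e/2"
      using cont[unfolded continuous_on_iff, rule_format, of t "e/2"] st \<open>0 < e\<close> by auto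
    \<comment> \<open>The two rationals are placed on opposite sides of the midpoint, which gives p
      \<le> q and keeps the interval between them inside \<open>{s..t}\<close>.\<close>
    obtain p where p: "s < real_of_rat p" "real_of_rat p < min (s + d1) ((s + t) / 2)"
      using of_rat_dense[of s "min (s + d1) ((s + t) / 2)"] d1 \<open>s < t\<close> by auto
    obtain q where q: "max (t - d2) ((s + t) / 2) < real_of_rat q" "real_of_rat q < t"
      using of_rat_dense[of "max (t - d2) ((s + t) / 2)" t] d2 \<open>s < t\<close> by auto
    have pq: "0 \<le> real_of_rat p" "real_of_rat p \<le> real_of_rat q" "real_of_rat q \<le> 1" using p q st by (auto simp del: zero_le_of_rat_iff of_rat_le_1_iff)
    then have pq': "0 \<le> p" "p \<le> q" "q \<le> 1" by (auto simp: zero_le_of_rat_iff of_rat_le_1_iff of_rat_less_eq)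
    have b: "real_of_rat p \<in> {0..1}" "real_of_rat q \<in> {0..1}" "dist (real_of_rat p) s < d1" "dist (real_of_rat q) t < d2"
      using p q pq st by (auto simp: dist_real_def simp del: zero_le_of_rat_iff of_rat_le_1_iff)
    have "dist (\<gamma> s) (\<gamma> t) \<le> dist (\<gamma> (real_of_rat p)) (\<gamma> (real_of_rat q)) + e"
      using d1(2)[OF b(1) b(3)] d2(2)[OF b(2) b(4)]
        dist_triangle[of "\<gamma> s" "\<gamma> t" "\<gamma> (real_of_rat p)"] dist_triangle[of "\<gamma> (real_of_rat p)" "\<gamma> t" "\<gamma> (real_of_rat q)"]
      by (simp add: dist_commute)
    then have "ennreal (dist (\<gamma> s) (\<gamma> t)) \<le> ennreal (dist (\<gamma> (real_of_rat p)) (\<gamma> (real_of_rat q))) + ennreal e"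
      using \<open>0 < e\<close> by (simp add: ennreal_leI flip: ennreal_plus)
    also have "ennreal (dist (\<gamma> (real_of_rat p)) (\<gamma> (real_of_rat q))) \<le> speed_length \<gamma> (real_of_rat p) (real_of_rat q)"
      using \<gamma>(2) pq' unfolding regular_curve_def by blast
    also have "\<dots> \<le> speed_length \<gamma> s t"
      using p q by (intro nn_integral_mono mult_left_mono) (auto simp: indicator_def)
    finally show "ennreal (dist (\<gamma> s) (\<gamma> t)) \<le> speed_length \<gamma> s t + ennreal e"
      by (simp add: add_right_mono)
  qed
qed simp

text \<open>Finite kinetic energy makes the speed finite almost everywhere on [0,1] and, since x is
  at most 1 + x^2, integrable there; its real-valued version \<open>g\<close> is then an admissible
  modulus.\<close>

lemma regular_curve_abs_cont:
  fixes \<gamma> :: "real \<Rightarrow> 'a::polish_space"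
  assumes \<gamma>: "\<gamma> \<in> mspace path_space" "regular_curve \<gamma>"
  shows "abs_cont_path \<gamma>"
proof -
  define g where "g r = indicator {0..1} r * enn2real (speed \<gamma> r)" for r
  have [measurable]: "speed \<gamma> \<in> borel_measurable borel" by (rule speed_path_measurable[OF \<gamma>(1)])
  have fin2: "(\<integral>\<^sup>+t. (speed \<gamma> t)\<^sup>2 * indicator {0..1} t \<partial>lborel) \<noteq> \<infinity>"
    using \<gamma>(2) by (auto simp: regular_curve_def)
  have "AE t in lborel. (speed \<gamma> t)\<^sup>2 * indicator {0..1} t \<noteq> \<infinity>"
    by (rule nn_integral_PInf_AE[OF _ fin2]) measurable
  then have ae: "AE t in lborel. speed \<gamma> t * indicator {0..1} t = ennreal (g t)"
    by eventually_elim (auto simp: g_def indicator_def ennreal_enn2real_if ennreal_top_mult power2_eq_square)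
  have "(\<integral>\<^sup>+t. ennreal (g t) \<partial>lborel) = (\<integral>\<^sup>+t. speed \<gamma> t * indicator {0..1} t \<partial>lborel)"
    by (intro nn_integral_cong_AE) (use ae in eventually_elim, simp)
  also have "\<dots> \<le> (\<integral>\<^sup>+t. indicator {0..1} t + (speed \<gamma> t)\<^sup>2 * indicator {0..1} t \<partial>lborel)"
  proof (rule nn_integral_mono)
    fix t
    have "x \<le> 1 + x\<^sup>2" for x :: ennreal
    proof (cases "x \<le> 1")
      case True then show ?thesis by (simp add: add_increasing2)
    next
      case False
      then have "1 * x \<le> x * x" by (intro mult_right_mono) auto
      then show ?thesis by (simp add: add_increasing power2_eq_square)
    qed
    then show "speed \<gamma> t * indicator {0..1} t \<le> indicator {0..1} t + (speed \<gamma> t)\<^sup>2 * indicator {0..1} t"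
      by (simp add: indicator_def)
  qed
  also have "\<dots> = 1 + (\<integral>\<^sup>+t. (speed \<gamma> t)\<^sup>2 * indicator {0..1} t \<partial>lborel)"
    by (simp add: nn_integral_add)
  also have "\<dots> < \<infinity>" using fin2 by (simp add: less_top)
  finally have gfin: "(\<integral>\<^sup>+t. ennreal (g t) \<partial>lborel) < \<infinity>" .
  have gint: "integrable lborel g"
    by (rule integrableI_nonneg[OF _ _ gfin]) (auto simp: g_def[abs_def])
  have g0: "0 \<le> g r" for r by (simp add: g_def)
  show ?thesis
    unfolding abs_cont_curve_def
  proof (intro exI[of _ g] conjI allI impI)
    show "set_integrable lborel {0..1} g"
      unfolding set_integrable_def by (intro integrable_mult_indicator gint) simp
    fix s t :: real assume st: "0 \<le> s \<and> s \<le> t \<and> t \<le> 1"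
    have "ennreal (dist (\<gamma> s) (\<gamma> t)) \<le> speed_length \<gamma> s t"
      using regular_curve_dist[OF \<gamma>] st by blast
    also have "\<dots> = (\<integral>\<^sup>+r\<in>{s..t}. ennreal (g r) \<partial>lborel)"
    proof (rule nn_integral_cong_AE)
      show "AE r in lborel. speed \<gamma> r * indicator {s..t} r = ennreal (g r) * indicator {s..t} r"
        using ae by eventually_elim (use st in \<open>auto simp: indicator_def split: if_splits\<close>)
    qed
    also have "\<dots> = ennreal (LINT r:{s..t}|lborel. g r)"
      using st primitive_diff[OF gint, of s t] by (subst nn_integral_primitive[OF gint g0]) simp_all
    finally show "dist (\<gamma> s) (\<gamma> t) \<le> (LINT r:{s..t}|lborel. g r)"
      by (subst (asm) ennreal_le_iff) (auto simp: set_lebesgue_integral_def g0 intro!: integral_nonneg_AE)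
  qed
qed

lemma abs_cont_metric_speed:
  fixes \<gamma> :: "real \<Rightarrow> 'a::metric_space"
  assumes "abs_cont_path \<gamma>"
  shows "AE t in lborel. t \<in> {0..1} \<longrightarrow> speed \<gamma> t = ennreal (metric_speed \<gamma> t) \<and> 0 \<le> metric_speed \<gamma> t"
proof -
  obtain v where v: "\<And>x. 0 \<le> v x" 
    "AE t in lborel. speed \<gamma> t = ennreal (v t)"
    "AE t in lborel. t \<in> {0..1} \<longrightarrow> metric_speed \<gamma> t = v t"
    by (rule abs_cont_curve_speed[OF assms]) (rule that; assumption)
  show ?thesis using v(2,3) by eventually_elim (simp add: v(1))
qed

lemma regular_curveI:
  fixes \<gamma> :: "real \<Rightarrow> 'a::metric_space"
  assumes ac: "abs_cont_path \<gamma>"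
    and fin: "(\<integral>\<^sup>+t\<in>{0..1}. ennreal ((metric_speed \<gamma> t)\<^sup>2) \<partial>lborel) < \<infinity>"
  shows "regular_curve \<gamma>"
proof -
  obtain v where v: "integrable lborel v" "\<And>x. 0 \<le> v x" 
    "\<And>s t. s \<le> t \<Longrightarrow> dist (\<gamma> (clamp01 s)) (\<gamma> (clamp01 t)) \<le> primitive v t - primitive v s"
    "AE t in lborel. speed \<gamma> t = ennreal (v t)"
    by (rule abs_cont_curve_speed[OF ac]; (rule that)?; assumption)
  have "kinetic \<gamma> = (\<integral>\<^sup>+t\<in>{0..1}. ennreal ((metric_speed \<gamma> t)\<^sup>2) \<partial>lborel)"
  proof (rule nn_integral_cong_AE)
    show "AE t in lborel. (speed \<gamma> t)\<^sup>2 * indicator {0..1} t = ennreal ((metric_speed \<gamma> t)\<^sup>2) * indicator {0..1} t"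
      using abs_cont_metric_speed[OF ac] by eventually_elim (auto simp: indicator_def ennreal_power)
  qed
  moreover have "ennreal (dist (\<gamma> s) (\<gamma> t)) \<le> speed_length \<gamma> s t"
    if "0 \<le> s" "s \<le> t" "t \<le> 1" for s t
  proof -
    have "speed_length \<gamma> s t = (\<integral>\<^sup>+r\<in>{s..t}. ennreal (v r) \<partial>lborel)"
    proof (rule nn_integral_cong_AE)
      show "AE r in lborel. speed \<gamma> r * indicator {s..t} r = ennreal (v r) * indicator {s..t} r"
        using v(4) by eventually_elim simp
    qed
    then show ?thesis
      using v(3)[OF that(2)] that nn_integral_primitive[OF v(1,2) that(2)] by (simp add: clamp01_id ennreal_leI)
  qed
  ultimately show ?thesis
    using fin unfolding regular_curve_def
    by (auto simp: zero_le_of_rat_iff of_rat_le_1_iff of_rat_less_eq)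
qed

subsection \<open>Test plans\<close>

lemma abs_cont_energy:
  fixes \<gamma> :: "real \<Rightarrow> 'a::metric_space"
  assumes "abs_cont_path \<gamma>"
  shows "(\<integral>\<^sup>+t\<in>{0..1}. ennreal ((metric_speed \<gamma> t)\<^sup>2) \<partial>lborel) = kinetic \<gamma>"
proof (rule nn_integral_cong_AE)
  show "AE t in lborel. ennreal ((metric_speed \<gamma> t)\<^sup>2) * indicator {0..1} t = (speed \<gamma> t)\<^sup>2 * indicator {0..1} t"
    using abs_cont_metric_speed[OF assms] by eventually_elim (auto simp: indicator_def ennreal_power)
qed

text \<open>The defining conditions speak of the existence of a modulus and of a limit with an
  unspecified default, neither of which is visibly measurable. \<open>regular_curve\<close> is a
  measurable event and \<open>speed\<close> a jointly measurable function, so in this form the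
  conditions can be transported to conditioned and stopped plans.\<close>

lemma test_plan_iff:
  fixes m :: "'a::polish_space measure"
  shows "test_plan m \<pi> \<longleftrightarrow> sets \<pi> = sets path_borel \<and> prob_space \<pi> \<and>
     (\<exists>C>0. \<forall>t\<in>{0..1}. \<forall>E\<in>sets m. emeasure (distr \<pi> m (\<lambda>\<gamma>. \<gamma> t)) E \<le> ennreal C * emeasure m E) \<and>
     (AE \<gamma> in \<pi>. regular_curve \<gamma>) \<and>
     (\<integral>\<^sup>+\<gamma>. kinetic \<gamma> \<partial>\<pi>) < \<infinity>" (is "_ \<longleftrightarrow> ?R")
proof
  assume tp: "test_plan m \<pi>"
  have eq: "(\<integral>\<^sup>+\<gamma>. (\<integral>\<^sup>+t\<in>{0..1}. ennreal ((metric_speed \<gamma> t)\<^sup>2) \<partial>lborel) \<partial>\<pi>)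
    = (\<integral>\<^sup>+\<gamma>. kinetic \<gamma> \<partial>\<pi>)"
  proof (rule nn_integral_cong_AE)
    have "AE \<gamma> in \<pi>. abs_cont_path \<gamma>" using tp by (simp add: test_plan_def)
    then show "AE \<gamma> in \<pi>. (\<integral>\<^sup>+t\<in>{0..1}. ennreal ((metric_speed \<gamma> t)\<^sup>2) \<partial>lborel) = kinetic \<gamma>"
      by eventually_elim (rule abs_cont_energy)
  qed
  have s: "sets \<pi> = sets path_borel" using tp by (simp add: test_plan_def)
  have fin: "(\<integral>\<^sup>+\<gamma>. kinetic \<gamma> \<partial>\<pi>) < \<infinity>"
    using tp eq by (simp add: test_plan_def)
  have "AE \<gamma> in \<pi>. kinetic \<gamma> \<noteq> \<infinity>"
    by (rule nn_integral_PInf_AE) (use fin energy_measurable measurable_cong_sets[OF s refl] in auto)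
  moreover have "AE \<gamma> in \<pi>. abs_cont_path \<gamma>" using tp by (simp add: test_plan_def)
  ultimately have "AE \<gamma> in \<pi>. regular_curve \<gamma>"
  proof eventually_elim
    case (elim \<gamma>)
    then show ?case using abs_cont_energy[OF elim(2)] by (intro regular_curveI) (auto simp: less_top)
  qed
  then show ?R using tp fin s by (simp add: test_plan_def)
next
  assume R: ?R
  have "AE \<gamma> in \<pi>. \<gamma> \<in> space \<pi>" by (rule AE_space)
  moreover have sp: "space \<pi> = mspace path_space"
    using R sets_eq_imp_space_eq[of \<pi> path_borel] by (simp add: space_path_borel)
  moreover have "AE \<gamma> in \<pi>. regular_curve \<gamma>" using R by blast
  ultimately have ac: "AE \<gamma> in \<pi>. abs_cont_path \<gamma>"
    by (auto elim!: eventually_elim2 intro: regular_curve_abs_cont)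
  have eq: "(\<integral>\<^sup>+\<gamma>. (\<integral>\<^sup>+t\<in>{0..1}. ennreal ((metric_speed \<gamma> t)\<^sup>2) \<partial>lborel) \<partial>\<pi>)
    = (\<integral>\<^sup>+\<gamma>. kinetic \<gamma> \<partial>\<pi>)"
    by (rule nn_integral_cong_AE) (use ac in eventually_elim, rule abs_cont_energy)
  show "test_plan m \<pi>" using R ac eq by (simp add: test_plan_def)
qed

section \<open>Compression and Fubini estimates for a fixed test plan\<close>

locale plan =
  fixes m :: "'a::polish_space measure" and \<pi> :: "(real \<Rightarrow> 'a) measure"
  assumes sets_m: "sets m = sets borel" and test_plan: "test_plan m \<pi>"
begin

sublocale prob_space \<pi> using test_plan by (simp add: test_plan_def)

sublocale P: pair_sigma_finite \<pi> lborel ..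

lemma sets_plan: "sets \<pi> = sets path_borel" using test_plan by (simp add: test_plan_def)

lemma space_plan: "space \<pi> = mspace path_space"
  using sets_eq_imp_space_eq[OF sets_plan] by (simp add: space_path_borel)

lemma space_m: "space m = UNIV" using sets_eq_imp_space_eq[OF sets_m] by simp

lemma measurable_plan: "measurable \<pi> M = measurable path_borel M"
  by (rule measurable_cong_sets[OF sets_plan refl])

lemma eval_plan: "t \<in> {0..1} \<Longrightarrow> (\<lambda>\<gamma>. \<gamma> t) \<in> \<pi> \<rightarrow>\<^sub>M m"
  using eval_measurable[of t] by (simp add: measurable_plan measurable_cong_sets[OF refl sets_m])

lemma pair_plan: "measurable (\<pi> \<Otimes>\<^sub>M lborel) M = measurable (path_borel \<Otimes>\<^sub>M borel) M"
  by (rule measurable_cong_sets[OF sets_pair_measure_cong[OF sets_plan sets_lborel] refl])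

lemma eval_joint_plan: "(\<lambda>p. fst p (clamp01 (snd p))) \<in> \<pi> \<Otimes>\<^sub>M lborel \<rightarrow>\<^sub>M m"
  using eval_joint_measurable by (simp add: pair_plan measurable_cong_sets[OF refl sets_m])

lemma speed_joint_plan: "(\<lambda>p. speed (fst p) (snd p)) \<in> borel_measurable (\<pi> \<Otimes>\<^sub>M lborel)"
  using speed_joint_measurable by (simp add: pair_plan split_beta')

lemma regular_AE: "AE \<gamma> in \<pi>. \<gamma> \<in> mspace path_space \<and> regular_curve \<gamma>"
  using test_plan AE_space[of \<pi>] unfolding test_plan_iff space_plan by (auto elim!: eventually_elim2)

text \<open>The law of the curve at time t is dominated by C m as a measure, so the bound passes
  from sets to nonnegative functions; one \<open>C\<close> serves all times.\<close>

lemma compression: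
  obtains C where "C > 0"
    "\<And>h t. h \<in> borel_measurable m \<Longrightarrow> t \<in> {0..1} \<Longrightarrow> (\<integral>\<^sup>+\<gamma>. h (\<gamma> t) \<partial>\<pi>) \<le> ennreal C * (\<integral>\<^sup>+x. h x \<partial>m)"
proof -
  obtain C where C: "C > 0" "\<And>t E. t \<in> {0..1} \<Longrightarrow> E \<in> sets m \<Longrightarrow> emeasure (distr \<pi> m (\<lambda>\<gamma>. \<gamma> t)) E \<le> ennreal C * emeasure m E"
    using test_plan unfolding test_plan_def by blast
  have "(\<integral>\<^sup>+\<gamma>. h (\<gamma> t) \<partial>\<pi>) \<le> ennreal C * (\<integral>\<^sup>+x. h x \<partial>m)"
    if h: "h \<in> borel_measurable m" and t: "t \<in> {0..1}" for h t
  proof -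
    have "(\<integral>\<^sup>+\<gamma>. h (\<gamma> t) \<partial>\<pi>) = (\<integral>\<^sup>+x. h x \<partial>distr \<pi> m (\<lambda>\<gamma>. \<gamma> t))"
      using eval_plan[OF t] h by (simp add: nn_integral_distr)
    also have "\<dots> \<le> (\<integral>\<^sup>+x. h x \<partial>density m (\<lambda>_. ennreal C))"
    proof (rule nn_integral_mono_measure)
      show "distr \<pi> m (\<lambda>\<gamma>. \<gamma> t) \<le> density m (\<lambda>_. ennreal C)"
        using C(2)[OF t] by (subst le_measure) (auto simp: emeasure_density_const)
    qed simp
    also have "\<dots> = ennreal C * (\<integral>\<^sup>+x. h x \<partial>m)"
      using h by (simp add: nn_integral_density nn_integral_cmult)
    finally show ?thesis .
  qed
  then show thesis using that C(1) by blast
qed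

lemma AE_eval:
  assumes "AE x in m. P x" "t \<in> {0..1}"
  shows "AE \<gamma> in \<pi>. P (\<gamma> t)"
proof -
  obtain N where N: "{x \<in> space m. \<not> P x} \<subseteq> N" "emeasure m N = 0" "N \<in> sets m"
    using AE_E[OF assms(1)] by blast
  obtain C where C: "\<And>h t. h \<in> borel_measurable m \<Longrightarrow> t \<in> {0..1} \<Longrightarrow> (\<integral>\<^sup>+\<gamma>. h (\<gamma> t) \<partial>\<pi>) \<le> ennreal C * (\<integral>\<^sup>+x. h x \<partial>m)"
    using compression by blast
  have "(\<integral>\<^sup>+\<gamma>. indicator N (\<gamma> t) \<partial>\<pi>) \<le> ennreal C * (\<integral>\<^sup>+x. indicator N x \<partial>m)"
    using N by (intro C assms) simp
  then have "(\<integral>\<^sup>+\<gamma>. indicator N (\<gamma> t) \<partial>\<pi>) = 0" using N by simp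
  moreover have "(\<lambda>\<gamma>. indicator N (\<gamma> t) :: ennreal) \<in> borel_measurable \<pi>"
    by (rule measurable_compose[OF eval_plan[OF assms(2)]]) (use N in simp)
  ultimately have "AE \<gamma> in \<pi>. (indicator N (\<gamma> t) :: ennreal) = 0"
    by (simp add: nn_integral_0_iff_AE)
  then show ?thesis by eventually_elim (use N space_m in \<open>auto simp: indicator_def split: if_splits\<close>)
qed

text \<open>Fubini exchanges the quantifiers: a null set of exceptional curves for each time becomes
  a null set of exceptional times for almost every curve.\<close>

lemma AE_curve_of_AE:
  assumes meas: "{p \<in> space (\<pi> \<Otimes>\<^sub>M lborel). P (fst p) (snd p)} \<in> sets (\<pi> \<Otimes>\<^sub>M lborel)"
    and "\<And>t. AE \<gamma> in \<pi>. P \<gamma> t"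
  shows "AE \<gamma> in \<pi>. AE t in lborel. P \<gamma> t"
  using P.AE_commute[OF meas] assms(2) by simp

lemma AE_eval_AE:
  assumes "AE x in m. P x"
  shows "AE \<gamma> in \<pi>. AE t in lborel. t \<in> {0..1} \<longrightarrow> P (\<gamma> t)"
proof -
  obtain N where N: "{x \<in> space m. \<not> P x} \<subseteq> N" "emeasure m N = 0" "N \<in> sets m"
    using AE_E[OF assms(1)] by blast
  \<comment> \<open>Fubini needs a jointly measurable event, so a Borel null set \<open>N\<close>
    containing the exceptional points stands in for \<open>P\<close>, and clamping makes the event
    meaningful for every real t.\<close>
  have "AE \<gamma> in \<pi>. AE t in lborel. \<gamma> (clamp01 t) \<notin> N"
  proof (rule AE_curve_of_AE)
    show "AE \<gamma> in \<pi>. \<gamma> (clamp01 t) \<notin> N" for t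
      using AE_eval[of "\<lambda>x. x \<notin> N" "clamp01 t"] N AE_not_in[of N m] by (auto simp: null_sets_def)
    have "(\<lambda>p. fst p (clamp01 (snd p))) -` (- N) \<inter> space (\<pi> \<Otimes>\<^sub>M lborel) \<in> sets (\<pi> \<Otimes>\<^sub>M lborel)"
      by (rule measurable_sets[OF eval_joint_plan]) (use N(3) in \<open>simp add: sets_m\<close>)
    then show "{p \<in> space (\<pi> \<Otimes>\<^sub>M lborel). fst p (clamp01 (snd p)) \<notin> N} \<in> sets (\<pi> \<Otimes>\<^sub>M lborel)"
      by (rule back_subst[of "\<lambda>A. A \<in> sets (\<pi> \<Otimes>\<^sub>M lborel)"]) auto
  qed
  then show ?thesis
  proof eventually_elim
    case (elim \<gamma>)
    then show ?case by eventually_elim (use N space_m in \<open>auto simp: clamp01_id\<close>)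
  qed
qed

text \<open>The compression bound is averaged over a time interval of length 1, so the constant
  survives unchanged.\<close>

lemma nn_integral_occupation:
  assumes "C > 0" "\<And>h t. h \<in> borel_measurable m \<Longrightarrow> t \<in> {0..1} \<Longrightarrow> (\<integral>\<^sup>+\<gamma>. h (\<gamma> t) \<partial>\<pi>) \<le> ennreal C * (\<integral>\<^sup>+x. h x \<partial>m)"
    and h: "h \<in> borel_measurable m"
  shows "(\<integral>\<^sup>+\<gamma>. (\<integral>\<^sup>+t\<in>{0..1}. h (\<gamma> t) \<partial>lborel) \<partial>\<pi>) \<le> ennreal C * (\<integral>\<^sup>+x. h x \<partial>m)"
proof -
  have meas: "(\<lambda>p. h (fst p (clamp01 (snd p))) * indicator {0..1} (snd p)) \<in> borel_measurable (\<pi> \<Otimes>\<^sub>M lborel)"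
    by (intro borel_measurable_times_ennreal measurable_compose[OF eval_joint_plan h] measurable_compose[OF measurable_snd]) simp
  have "(\<integral>\<^sup>+\<gamma>. (\<integral>\<^sup>+t\<in>{0..1}. h (\<gamma> t) \<partial>lborel) \<partial>\<pi>) = (\<integral>\<^sup>+\<gamma>. (\<integral>\<^sup>+t. h (\<gamma> (clamp01 t)) * indicator {0..1} t \<partial>lborel) \<partial>\<pi>)"
    by (intro nn_integral_cong) (auto simp: indicator_def clamp01_id)
  also have "\<dots> = (\<integral>\<^sup>+t. (\<integral>\<^sup>+\<gamma>. h (\<gamma> (clamp01 t)) * indicator {0..1} t \<partial>\<pi>) \<partial>lborel)"
    using P.Fubini[OF meas] by simp
  also have "\<dots> \<le> (\<integral>\<^sup>+t. (ennreal C * (\<integral>\<^sup>+x. h x \<partial>m)) * indicator {0..1::real} t \<partial>lborel)"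
  proof (rule nn_integral_mono)
    fix t :: real
    show "(\<integral>\<^sup>+\<gamma>. h (\<gamma> (clamp01 t)) * indicator {0..1} t \<partial>\<pi>) \<le> (ennreal C * (\<integral>\<^sup>+x. h x \<partial>m)) * indicator {0..1} t"
      using assms(2)[OF h, of "clamp01 t"] by (cases "t \<in> {0..1}") simp_all
  qed
  also have "\<dots> = ennreal C * (\<integral>\<^sup>+x. h x \<partial>m)"
    by (simp add: nn_integral_cmult_indicator)
  finally show ?thesis .
qed

end

lemma speed_stop:
  fixes \<gamma> :: "real \<Rightarrow> 'a::metric_space"
  assumes st: "0 \<le> s" "s \<le> t" "t \<le> 1" and r: "r \<noteq> s" "r \<noteq> t"
  shows "speed (stop s t \<gamma>) r = (if s < r \<and> r < t then speed \<gamma> r else 0)"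
proof -
  have X: "(\<lambda>n. r + 1 / real (Suc n)) \<longlonglongrightarrow> r"
    using LIMSEQ_inverse_real_of_nat_add[of r] by (simp add: inverse_eq_divide)
  have st_eq: "stop s t \<gamma> (clamp01 x) = \<gamma> (max s (min t (clamp01 x)))" for x
    by (simp add: stop_apply)
  have pos: "0 < 1 / real (Suc n)" for n by simp
  consider "r < s" | "t < r" | "s < r" "r < t" using r by linarith
  then show ?thesis
  proof cases
    case 1
    have "\<forall>\<^sub>F n in sequentially. r + 1 / real (Suc n) < s" using order_tendstoD(2)[OF X 1] .
    then have "\<forall>\<^sub>F n in sequentially. ennreal (real (Suc n) * dist (stop s t \<gamma> (clamp01 (r + 1 / real (Suc n)))) (stop s t \<gamma> (clamp01 r))) = 0"
    proof eventually_elim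
      case (elim n)
      then have "max s (min t (clamp01 (r + 1 / real (Suc n)))) = s" "max s (min t (clamp01 r)) = s"
        using st 1 by (auto simp: clamp01_def max_def min_def)
      then show ?case by (simp add: st_eq)
    qed
    then have "speed (stop s t \<gamma>) r = limsup (\<lambda>n. 0)" unfolding speed_def by (rule Limsup_eq)
    then show ?thesis using 1 by (simp add: Limsup_const)
  next
    case 2
    have sat: "max s (min t (clamp01 x)) = t" if "t < x" for x
      using st 2 that by (auto simp: clamp01_def max_def min_def)
    have "max s (min t (clamp01 (r + 1 / real (Suc n)))) = t" "max s (min t (clamp01 r)) = t" for n
    proof -
      show "max s (min t (clamp01 (r + 1 / real (Suc n)))) = t" by (rule sat) (use 2 pos[of n] in linarith)
      show "max s (min t (clamp01 r)) = t" by (rule sat[OF 2])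
    qed
    then show ?thesis unfolding speed_def st_eq using 2 by (simp add: Limsup_const)
  next
    case 3
    have id: "max s (min t (clamp01 x)) = clamp01 x" if "s < x" "x < t" for x
      using st that by (auto simp: clamp01_def max_def min_def)
    have "\<forall>\<^sub>F n in sequentially. r + 1 / real (Suc n) < t" using order_tendstoD(2)[OF X 3(2)] .
    then have "\<forall>\<^sub>F n in sequentially. ennreal (real (Suc n) * dist (stop s t \<gamma> (clamp01 (r + 1 / real (Suc n)))) (stop s t \<gamma> (clamp01 r)))
      = ennreal (real (Suc n) * dist (\<gamma> (clamp01 (r + 1 / real (Suc n)))) (\<gamma> (clamp01 r)))"
    proof eventually_elim
      case (elim n)
      have "s < r + 1 / real (Suc n)" using 3 pos[of n] by linarith
      then show ?case using elim 3 id by (simp only: st_eq)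
    qed
    then show ?thesis using 3 unfolding speed_def by (simp add: Limsup_eq)
  qed
qed

lemma speed_stop_AE:
  assumes "0 \<le> s" "s \<le> t" "t \<le> 1"
  shows "AE r in lborel. speed (stop s t \<gamma>) r = speed \<gamma> r * indicator {s..t} r"
  using AE_lborel_singleton[of s] AE_lborel_singleton[of t]
  by eventually_elim (use assms in \<open>auto simp: speed_stop indicator_def\<close>)

lemma regular_curve_stop:
  fixes \<gamma> :: "real \<Rightarrow> 'a::polish_space"
  assumes \<gamma>: "\<gamma> \<in> mspace path_space" "regular_curve \<gamma>" and st: "0 \<le> s" "s \<le> t" "t \<le> 1"
  shows "regular_curve (stop s t \<gamma>)"
proof -
  have "kinetic (stop s t \<gamma>) \<le> kinetic \<gamma>"
  proof (rule nn_integral_mono_AE)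
    show "AE r in lborel. (speed (stop s t \<gamma>) r)\<^sup>2 * indicator {0..1} r \<le> (speed \<gamma> r)\<^sup>2 * indicator {0..1} r"
      using speed_stop_AE[OF st, of \<gamma>] by eventually_elim (simp add: indicator_def)
  qed
  moreover have dist: "ennreal (dist (stop s t \<gamma> p) (stop s t \<gamma> q)) \<le> speed_length (stop s t \<gamma>) p q"
    if pq: "0 \<le> p" "p \<le> q" "q \<le> 1" for p q
  proof (cases "max s (min t p) = max s (min t q)")
    case True
    then show ?thesis using pq by (simp add: stop_apply)
  next
    case False
    let ?p = "max s (min t p)" and ?q = "max s (min t q)"
    have "p \<le> ?p" "?q \<le> q" using False pq st by linarith+
    then have sub: "{?p..?q} \<subseteq> {p..q} \<inter> {s..t}" using st by auto
    have "ennreal (dist (stop s t \<gamma> p) (stop s t \<gamma> q)) \<le> speed_length \<gamma> ?p ?q"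
    proof -
      have "0 \<le> ?p" "?p \<le> ?q" "?q \<le> 1" using pq st by linarith+
      from regular_curve_dist[OF \<gamma> this] show ?thesis
        using pq stop_apply[of p s t \<gamma>] stop_apply[of q s t \<gamma>] by simp
    qed
    also have "\<dots> \<le> speed_length (stop s t \<gamma>) p q"
    proof (rule nn_integral_mono_AE)
      show "AE r in lborel. speed \<gamma> r * indicator {?p..?q} r \<le> speed (stop s t \<gamma>) r * indicator {p..q} r"
        using speed_stop_AE[OF st, of \<gamma>]
      proof eventually_elim
        case (elim r)
        show ?case
        proof (cases "r \<in> {?p..?q}")
          case True
          then have "r \<in> {p..q}" "r \<in> {s..t}" using sub by blast+
          then show ?thesis using True elim by simp
        qed simp
      qed
    qed
    finally show ?thesis .
  qed
  ultimately show ?thesis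
    using \<gamma>(2) unfolding regular_curve_def
  proof (intro conjI allI impI)
    fix p q :: rat assume "0 \<le> p \<and> p \<le> q \<and> q \<le> 1"
    then have "0 \<le> real_of_rat p" "real_of_rat p \<le> real_of_rat q" "real_of_rat q \<le> 1"
      by (simp_all add: of_rat_less_eq)
    then show "ennreal (dist (stop s t \<gamma> (real_of_rat p)) (stop s t \<gamma> (real_of_rat q)))
      \<le> speed_length (stop s t \<gamma>) (real_of_rat p) (real_of_rat q)"
      by (rule dist)
  qed (auto simp: le_less_trans)
qed

context plan
begin

text \<open>Conditioning on \<open>A\<close> multiplies the compression constant by 1 / prob A;
  stopping evaluates the curve at another time of [0,1] and cannot raise its energy. These two
  operations localise an inequality assumed for all test plans, in the curve and in time.\<close>

lemma plan_stop:
  assumes st: "0 \<le> s" "s \<le> t" "t \<le> 1" and A: "A \<in> sets \<pi>" "emeasure \<pi> A \<noteq> 0"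
  shows "plan m (distr (uniform_measure \<pi> A) path_borel (stop s t))"
proof
  let ?U = "uniform_measure \<pi> A"
  let ?D = "distr ?U path_borel (stop s t)"
  interpret U: prob_space ?U
    using A by (intro prob_space_uniform_measure) auto
  have stopU: "stop s t \<in> ?U \<rightarrow>\<^sub>M path_borel"
    by (subst measurable_cong_sets[OF sets_uniform_measure refl], subst measurable_plan) (rule stop_measurable[OF st])
  show "sets m = sets borel" by (rule sets_m)
  show "test_plan m ?D"
    unfolding test_plan_iff
  proof (intro conjI)
    show "prob_space ?D" by (rule U.prob_space_distr[OF stopU])
    obtain C where C: "C > 0" "\<And>t E. t \<in> {0..1} \<Longrightarrow> E \<in> sets m \<Longrightarrow> emeasure (distr \<pi> m (\<lambda>\<gamma>. \<gamma> t)) E \<le> ennreal C * emeasure m E"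
      using test_plan unfolding test_plan_def by blast
    have pA: "emeasure \<pi> A = ennreal (prob A)" "0 < prob A"
      using A by (simp_all add: emeasure_eq_measure zero_less_measure_iff)
    have "emeasure (distr ?D m (\<lambda>\<gamma>. \<gamma> r)) E \<le> ennreal (C / prob A) * emeasure m E"
      if r: "r \<in> {0..1}" and E: "E \<in> sets m" for r E
    proof -
      let ?r = "max s (min t r)"
      have r': "?r \<in> {0..1}" using st r by (auto simp: max_def min_def)
      have er: "(\<lambda>\<gamma>. \<gamma> r) \<in> path_borel \<rightarrow>\<^sub>M m" using eval_plan[OF r] by (simp add: measurable_plan)
      have "emeasure (distr ?D m (\<lambda>\<gamma>. \<gamma> r)) E = emeasure ?U ((\<lambda>\<gamma>. stop s t \<gamma> r) -` E \<inter> space ?U)"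
        using measurable_compose[OF stopU er] E er stopU
        by (subst distr_distr) (auto simp: emeasure_distr comp_def)
      also have "(\<lambda>\<gamma>. stop s t \<gamma> r) -` E \<inter> space ?U = (\<lambda>\<gamma>. \<gamma> ?r) -` E \<inter> space \<pi>"
        using r by (simp add: stop_apply)
      also have "emeasure ?U \<dots> = emeasure \<pi> (A \<inter> ((\<lambda>\<gamma>. \<gamma> ?r) -` E \<inter> space \<pi>)) / emeasure \<pi> A"
        using measurable_sets[OF eval_plan[OF r'] E] A(1) by simp
      also have "\<dots> \<le> emeasure (distr \<pi> m (\<lambda>\<gamma>. \<gamma> ?r)) E / emeasure \<pi> A"
        using measurable_sets[OF eval_plan[OF r'] E] eval_plan[OF r'] E
        by (intro divide_right_mono_ennreal) (auto simp: emeasure_distr intro!: emeasure_mono)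
      also have "\<dots> \<le> (ennreal C * emeasure m E) / emeasure \<pi> A"
        by (intro divide_right_mono_ennreal C r' E)
      also have "\<dots> = ennreal (C / prob A) * emeasure m E"
        using pA C(1) by (simp add: ennreal_times_divide mult.commute flip: divide_ennreal)
      finally show ?thesis .
    qed
    then show "\<exists>C>0. \<forall>t\<in>{0..1}. \<forall>E\<in>sets m. emeasure (distr ?D m (\<lambda>\<gamma>. \<gamma> t)) E \<le> ennreal C * emeasure m E"
      using C(1) pA(2) by (intro exI[of _ "C / prob A"]) auto
    show "AE \<gamma> in ?D. regular_curve \<gamma>"
    proof (subst AE_distr_iff[OF stopU regular_curve_measurable], rule AE_uniform_measureI[OF A(1)])
      show "AE \<gamma> in \<pi>. \<gamma> \<in> A \<longrightarrow> regular_curve (stop s t \<gamma>)"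
        using regular_AE by eventually_elim (use regular_curve_stop[OF _ _ st] in blast)
    qed
    have "(\<integral>\<^sup>+\<gamma>. kinetic \<gamma> \<partial>?D) = (\<integral>\<^sup>+\<gamma>. kinetic (stop s t \<gamma>) \<partial>?U)"
      by (subst nn_integral_distr[OF stopU]) (simp_all add: energy_measurable)
    also have "\<dots> \<le> (\<integral>\<^sup>+\<gamma>. kinetic \<gamma> \<partial>?U)"
    proof (rule nn_integral_mono, rule nn_integral_mono_AE)
      fix \<gamma>
      show "AE r in lborel. (speed (stop s t \<gamma>) r)\<^sup>2 * indicator {0..1} r \<le> (speed \<gamma> r)\<^sup>2 * indicator {0..1} r"
        using speed_stop_AE[OF st, of \<gamma>] by eventually_elim (simp add: indicator_def)
    qed
    also have "\<dots> = (\<integral>\<^sup>+\<gamma>. kinetic \<gamma> * indicator A \<gamma> \<partial>\<pi>) / emeasure \<pi> A"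
      using energy_measurable A(1) by (intro nn_integral_uniform_measure) (simp_all add: measurable_plan)
    also have "\<dots> < \<infinity>"
    proof -
      have "(\<integral>\<^sup>+\<gamma>. kinetic \<gamma> * indicator A \<gamma> \<partial>\<pi>) \<le> (\<integral>\<^sup>+\<gamma>. kinetic \<gamma> \<partial>\<pi>)"
        by (intro nn_integral_mono) (simp add: indicator_def)
      also have "\<dots> < \<infinity>" using test_plan by (simp add: test_plan_iff)
      finally show ?thesis using A(2) by (auto simp: ennreal_divide_eq_top_iff simp flip: less_top)
    qed
    finally show "(\<integral>\<^sup>+\<gamma>. kinetic \<gamma> \<partial>?D) < \<infinity>" .
  qed simp
qed

end

subsection \<open>Weak upper gradients along curves\<close>

text \<open>The integrand of the upper gradient inequality, with \<open>speed\<close> in place of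
  \<open>metric_speed\<close> and with clamped time, so that it is jointly measurable in the curve
  and the time. \<open>ennreal\<close> sends negative values of \<open>g\<close> to 0; a weak upper
  gradient takes them only on a null set.\<close>

definition slope_action :: "('a \<Rightarrow> real) \<Rightarrow> (real \<Rightarrow> 'a::metric_space) \<Rightarrow> real \<Rightarrow> ennreal" where
  "slope_action g \<gamma> r = ennreal (g (\<gamma> (clamp01 r))) * speed \<gamma> r"

abbreviation "action g \<gamma> s t \<equiv> \<integral>\<^sup>+r\<in>{s..t}. slope_action g \<gamma> r \<partial>lborel"

text \<open>The test set is the one where v < u; finiteness of the integral of v turns the strict
  pointwise inequality into a strict inequality of integrals. Null sets are exempt from the
  hypothesis because a plan cannot be conditioned on them.\<close>

lemma AE_le_if_nn_integral_le:
  fixes u v :: "'b \<Rightarrow> ennreal"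
  assumes [measurable]: "u \<in> borel_measurable M" "v \<in> borel_measurable M"
    and fin: "(\<integral>\<^sup>+x. v x \<partial>M) < \<infinity>"
    and le: "\<And>A. A \<in> sets M \<Longrightarrow> emeasure M A \<noteq> 0 \<Longrightarrow> (\<integral>\<^sup>+x. u x * indicator A x \<partial>M) \<le> (\<integral>\<^sup>+x. v x * indicator A x \<partial>M)"
  shows "AE x in M. u x \<le> v x"
proof (rule ccontr)
  assume neg: "\<not> (AE x in M. u x \<le> v x)"
  let ?A = "{x \<in> space M. v x < u x}"
  have A[measurable]: "?A \<in> sets M" by measurable
  have "emeasure M ?A \<noteq> 0"
  proof
    assume "emeasure M ?A = 0"
    then have "AE x in M. x \<notin> ?A" using A by (intro AE_not_in) (auto simp: null_sets_def)
    moreover have "AE x in M. x \<in> space M" by (rule AE_space)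
    ultimately have "AE x in M. u x \<le> v x" by eventually_elim (simp add: not_less)
    then show False using neg by simp
  qed
  then have "(\<integral>\<^sup>+x. u x * indicator ?A x \<partial>M) \<le> (\<integral>\<^sup>+x. v x * indicator ?A x \<partial>M)"
    by (rule le[OF A])
  moreover have "(\<integral>\<^sup>+x. v x * indicator ?A x \<partial>M) < (\<integral>\<^sup>+x. u x * indicator ?A x \<partial>M)"
  proof (rule nn_integral_less)
    have "(\<integral>\<^sup>+x. v x * indicator ?A x \<partial>M) \<le> (\<integral>\<^sup>+x. v x \<partial>M)"
      by (intro nn_integral_mono) (simp add: indicator_def)
    then show "(\<integral>\<^sup>+x. v x * indicator ?A x \<partial>M) \<noteq> \<infinity>" using fin by auto
    show "AE x in M. v x * indicator ?A x \<le> u x * indicator ?A x"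
      by (intro AE_I2) (simp add: indicator_def less_imp_le)
    show "\<not> (AE x in M. u x * indicator ?A x \<le> v x * indicator ?A x)"
    proof
      assume "AE x in M. u x * indicator ?A x \<le> v x * indicator ?A x"
      moreover have "AE x in M. x \<in> space M" by (rule AE_space)
      ultimately have "AE x in M. u x \<le> v x"
      proof eventually_elim
        case (elim x)
        then show ?case by (cases "v x < u x") (simp_all add: not_less)
      qed
      then show False using neg by simp
    qed
  qed measurable
  ultimately show False by simp
qed

lemma wugD:
  assumes "weak_upper_gradient m f g"
  shows "g \<in> L2 m" "AE x in m. 0 \<le> g x" "g \<in> borel_measurable m" "integrable m (\<lambda>x. (g x)\<^sup>2)"
  using assms by (auto simp: weak_upper_gradient_def L2_def)

context plan
begin

lemma slope_action_measurable:
  assumes "g \<in> borel_measurable m"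
  shows "(\<lambda>p. slope_action g (fst p) (snd p)) \<in> borel_measurable (\<pi> \<Otimes>\<^sub>M lborel)"
  unfolding slope_action_def
  by (intro borel_measurable_times_ennreal speed_joint_plan
      measurable_compose[OF measurable_compose[OF eval_joint_plan assms] measurable_ennreal])

lemma slope_action_integral_measurable:
  assumes "g \<in> borel_measurable m" "S \<in> sets borel"
  shows "(\<lambda>\<gamma>. \<integral>\<^sup>+r\<in>S. slope_action g \<gamma> r \<partial>lborel) \<in> borel_measurable \<pi>"
proof -
  have [measurable]: "(\<lambda>(\<gamma>, r). slope_action g \<gamma> r) \<in> borel_measurable (\<pi> \<Otimes>\<^sub>M lborel)"
    using slope_action_measurable[OF assms(1)] by (simp add: split_beta')
  note assms(2)[measurable]
  show ?thesis by measurable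
qed

lemma action_eq:
  "(\<integral>\<^sup>+\<gamma>. (\<integral>\<^sup>+t\<in>{0..1}. ennreal (g (\<gamma> t) * metric_speed \<gamma> t) \<partial>lborel) \<partial>\<pi>)
    = (\<integral>\<^sup>+\<gamma>. action g \<gamma> 0 1 \<partial>\<pi>)"
proof (rule nn_integral_cong_AE)
  show "AE \<gamma> in \<pi>. (\<integral>\<^sup>+t\<in>{0..1}. ennreal (g (\<gamma> t) * metric_speed \<gamma> t) \<partial>lborel)
      = action g \<gamma> 0 1"
    using regular_AE
  proof eventually_elim
    case (elim \<gamma>)
    then have "abs_cont_path \<gamma>" by (simp add: regular_curve_abs_cont)
    from abs_cont_metric_speed[OF this]
    have "AE t in lborel. ennreal (g (\<gamma> t) * metric_speed \<gamma> t) * indicator {0..1} t = slope_action g \<gamma> t * indicator {0..1} t"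
    proof eventually_elim
      case (elim t)
      then show ?case
        by (cases "t \<in> {0..1}") (simp_all add: slope_action_def clamp01_id ennreal_mult'')
    qed
    then show ?case by (rule nn_integral_cong_AE)
  qed
qed

text \<open>Bounding a product by the sum of the squares separates the two sources of control in a
  test plan: compression bounds the integral of g^2 along the curves by its integral over X, and the
  kinetic energy is finite.\<close>

lemma slope_action_finite:
  assumes "g \<in> L2 m"
  shows "(\<integral>\<^sup>+\<gamma>. action g \<gamma> 0 1 \<partial>\<pi>) < \<infinity>"
proof -
  have gm: "g \<in> borel_measurable m" and gi: "integrable m (\<lambda>x. (g x)\<^sup>2)" using assms by (auto simp: L2_def)
  obtain C where C: "C > 0"
    "\<And>h t. h \<in> borel_measurable m \<Longrightarrow> t \<in> {0..1} \<Longrightarrow> (\<integral>\<^sup>+\<gamma>. h (\<gamma> t) \<partial>\<pi>) \<le> ennreal C * (\<integral>\<^sup>+x. h x \<partial>m)"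
    using compression by blast
  have hm: "(\<lambda>x. ennreal ((g x)\<^sup>2)) \<in> borel_measurable m" using gm by simp
  have ab: "a * b \<le> a\<^sup>2 + b\<^sup>2" for a b :: ennreal
  proof (cases "a \<le> b")
    case True
    then have "a * b \<le> b * b" by (rule mult_right_mono) simp
    then show ?thesis by (simp add: power2_eq_square add_increasing)
  next
    case False
    then have "a * b \<le> a * a" by (intro mult_left_mono) simp_all
    then show ?thesis by (simp add: power2_eq_square add_increasing2)
  qed
  have sq: "(ennreal a)\<^sup>2 \<le> ennreal (a\<^sup>2)" for a
    by (cases "0 \<le> a") (simp_all add: ennreal_power ennreal_neg)
  have m2: "(\<lambda>\<gamma>. kinetic \<gamma>) \<in> borel_measurable \<pi>"
    using energy_measurable by (simp add: measurable_plan)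
  have 1: "(\<lambda>p. ennreal ((g (fst p (clamp01 (snd p))))\<^sup>2)) \<in> borel_measurable (\<pi> \<Otimes>\<^sub>M lborel)"
    by (rule measurable_compose[OF eval_joint_plan hm])
  have [measurable]: "(\<lambda>(\<gamma>, r). ennreal ((g (\<gamma> (clamp01 r)))\<^sup>2)) \<in> borel_measurable (\<pi> \<Otimes>\<^sub>M lborel)"
    using 1 by (simp add: split_beta')
  have m1: "(\<lambda>\<gamma>. \<integral>\<^sup>+t\<in>{0..1}. ennreal ((g (\<gamma> (clamp01 t)))\<^sup>2) \<partial>lborel) \<in> borel_measurable \<pi>"
    by measurable
  have "(\<integral>\<^sup>+\<gamma>. action g \<gamma> 0 1 \<partial>\<pi>)
    \<le> (\<integral>\<^sup>+\<gamma>. (\<integral>\<^sup>+t\<in>{0..1}. ennreal ((g (\<gamma> (clamp01 t)))\<^sup>2) \<partial>lborel) + kinetic \<gamma> \<partial>\<pi>)"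
  proof (rule nn_integral_mono)
    fix \<gamma> assume \<gamma>: "\<gamma> \<in> space \<pi>"
    have s: "speed \<gamma> \<in> borel_measurable borel" using \<gamma> by (intro speed_path_measurable) (simp add: space_plan)
    have e: "(\<lambda>t. ennreal ((g (\<gamma> (clamp01 t)))\<^sup>2)) \<in> borel_measurable lborel"
      using measurable_compose[OF measurable_Pair1'[OF \<gamma>] 1] by simp
    have "action g \<gamma> 0 1 \<le> (\<integral>\<^sup>+t. ennreal ((g (\<gamma> (clamp01 t)))\<^sup>2) * indicator {0..1} t + (speed \<gamma> t)\<^sup>2 * indicator {0..1} t \<partial>lborel)"
    proof (rule nn_integral_mono)
      fix t :: real
      have "slope_action g \<gamma> t \<le> (ennreal (g (\<gamma> (clamp01 t))))\<^sup>2 + (speed \<gamma> t)\<^sup>2"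
        unfolding slope_action_def by (rule ab)
      also have "\<dots> \<le> ennreal ((g (\<gamma> (clamp01 t)))\<^sup>2) + (speed \<gamma> t)\<^sup>2" by (intro add_right_mono sq)
      finally show "slope_action g \<gamma> t * indicator {0..1} t \<le> ennreal ((g (\<gamma> (clamp01 t)))\<^sup>2) * indicator {0..1} t + (speed \<gamma> t)\<^sup>2 * indicator {0..1} t"
        by (simp add: indicator_def)
    qed
    also have "\<dots> = (\<integral>\<^sup>+t\<in>{0..1}. ennreal ((g (\<gamma> (clamp01 t)))\<^sup>2) \<partial>lborel) + kinetic \<gamma>"
      using s e by (intro nn_integral_add) auto
    finally show "action g \<gamma> 0 1 \<le> (\<integral>\<^sup>+t\<in>{0..1}. ennreal ((g (\<gamma> (clamp01 t)))\<^sup>2) \<partial>lborel) + kinetic \<gamma>" .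
  qed
  also have "\<dots> = (\<integral>\<^sup>+\<gamma>. (\<integral>\<^sup>+t\<in>{0..1}. ennreal ((g (\<gamma> (clamp01 t)))\<^sup>2) \<partial>lborel) \<partial>\<pi>) + (\<integral>\<^sup>+\<gamma>. kinetic \<gamma> \<partial>\<pi>)"
    by (rule nn_integral_add[OF m1 m2])
  also have "(\<integral>\<^sup>+\<gamma>. (\<integral>\<^sup>+t\<in>{0..1}. ennreal ((g (\<gamma> (clamp01 t)))\<^sup>2) \<partial>lborel) \<partial>\<pi>) = (\<integral>\<^sup>+\<gamma>. (\<integral>\<^sup>+t\<in>{0..1}. ennreal ((g (\<gamma> t))\<^sup>2) \<partial>lborel) \<partial>\<pi>)"
  proof (intro nn_integral_cong)
    fix \<gamma> and t :: real
    show "ennreal ((g (\<gamma> (clamp01 t)))\<^sup>2) * indicator {0..1} t = ennreal ((g (\<gamma> t))\<^sup>2) * indicator {0..1} t"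
      by (cases "t \<in> {0..1}") (simp_all add: clamp01_id)
  qed
  also have "\<dots> \<le> ennreal C * (\<integral>\<^sup>+x. ennreal ((g x)\<^sup>2) \<partial>m)"
    by (rule nn_integral_occupation[OF C hm])
  also have "(\<integral>\<^sup>+x. ennreal ((g x)\<^sup>2) \<partial>m) = ennreal (\<integral>x. (g x)\<^sup>2 \<partial>m)"
    using gi by (intro nn_integral_eq_integral) auto
  finally have "(\<integral>\<^sup>+\<gamma>. action g \<gamma> 0 1 \<partial>\<pi>)
    \<le> ennreal C * ennreal (\<integral>x. (g x)\<^sup>2 \<partial>m) + (\<integral>\<^sup>+\<gamma>. kinetic \<gamma> \<partial>\<pi>)"
    by (simp add: add_right_mono)
  also have "\<dots> < \<infinity>"
    using test_plan by (simp add: test_plan_iff ennreal_mult_less_top)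
  finally show ?thesis .
qed

lemma wug_plan:
  assumes "weak_upper_gradient m f g"
  shows "(\<integral>\<^sup>+\<gamma>. ennreal \<bar>f (\<gamma> 1) - f (\<gamma> 0)\<bar> \<partial>\<pi>) \<le> (\<integral>\<^sup>+\<gamma>. action g \<gamma> 0 1 \<partial>\<pi>)"
  using assms test_plan unfolding weak_upper_gradient_def action_eq[symmetric] by blast

lemma slope_action_stop:
  assumes "0 \<le> s" "s \<le> t" "t \<le> 1"
  shows "action g (stop s t \<gamma>) 0 1 = action g \<gamma> s t"
proof (rule nn_integral_cong_AE)
  show "AE r in lborel. slope_action g (stop s t \<gamma>) r * indicator {0..1} r = slope_action g \<gamma> r * indicator {s..t} r"
    using speed_stop_AE[OF assms, of \<gamma>]
  proof eventually_elim
    case (elim r)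
    show ?case
    proof (cases "r \<in> {s..t}")
      case True
      then have r: "r \<in> {0..1}" "max s (min t r) = r" using assms by auto
      then show ?thesis using True elim by (simp add: slope_action_def clamp01_id stop_apply)
    next
      case False
      then show ?thesis using elim by (simp add: slope_action_def)
    qed
  qed
qed

text \<open>The integrated inequality, applied to the plan conditioned on an arbitrary event and
  stopped to \<open>{s..t}\<close>, carries the same normalising factor on both sides. As the event
  is arbitrary, the inequality holds curve by curve; the exceptional curves still depend on s and
  t.\<close>

lemma wug_curve:
  assumes wug: "weak_upper_gradient m f g" and f: "f \<in> borel_measurable m" and st: "0 \<le> s" "s \<le> t" "t \<le> 1"
  shows "AE \<gamma> in \<pi>. ennreal \<bar>f (\<gamma> t) - f (\<gamma> s)\<bar> \<le> action g \<gamma> s t"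
proof (rule AE_le_if_nn_integral_le)
  have g2: "g \<in> L2 m" using wugD[OF wug] by simp
  then have g: "g \<in> borel_measurable m" by (simp add: L2_def)
  have "t \<in> {0..1}" "s \<in> {0..1}" using st by auto
  note fm = measurable_compose[OF eval_plan[OF this(1)] f] measurable_compose[OF eval_plan[OF this(2)] f]
  show meas_u: "(\<lambda>\<gamma>. ennreal \<bar>f (\<gamma> t) - f (\<gamma> s)\<bar>) \<in> borel_measurable \<pi>"
    using fm by simp
  show meas_v: "(\<lambda>\<gamma>. action g \<gamma> s t) \<in> borel_measurable \<pi>"
    by (rule slope_action_integral_measurable[OF g]) simp
  have "(\<integral>\<^sup>+\<gamma>. action g \<gamma> s t \<partial>\<pi>) \<le> (\<integral>\<^sup>+\<gamma>. action g \<gamma> 0 1 \<partial>\<pi>)"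
    using st by (intro nn_integral_mono mult_left_mono) (auto simp: indicator_def)
  then show "(\<integral>\<^sup>+\<gamma>. action g \<gamma> s t \<partial>\<pi>) < \<infinity>"
    using slope_action_finite[OF g2] by (rule le_less_trans)
  fix A assume A: "A \<in> sets \<pi>" "emeasure \<pi> A \<noteq> 0"
  let ?U = "uniform_measure \<pi> A" and ?D = "distr (uniform_measure \<pi> A) path_borel (stop s t)"
  interpret D: plan m ?D by (rule plan_stop[OF st A])
  have stopU: "stop s t \<in> ?U \<rightarrow>\<^sub>M path_borel"
    by (subst measurable_cong_sets[OF sets_uniform_measure refl], subst measurable_plan) (rule stop_measurable[OF st])
  have D_meas: "h \<in> borel_measurable \<pi> \<Longrightarrow> h \<in> borel_measurable ?D" for h :: "_ \<Rightarrow> ennreal"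
    by (simp add: measurable_plan)
  have 01: "(\<lambda>\<gamma>. \<gamma> 1) \<in> \<pi> \<rightarrow>\<^sub>M m" "(\<lambda>\<gamma>. \<gamma> 0) \<in> \<pi> \<rightarrow>\<^sub>M m" by (auto intro: eval_plan)
  have "(\<integral>\<^sup>+\<gamma>. ennreal \<bar>f (\<gamma> 1) - f (\<gamma> 0)\<bar> \<partial>?D) \<le> (\<integral>\<^sup>+\<gamma>. action g \<gamma> 0 1 \<partial>?D)"
    by (rule D.wug_plan[OF wug])
  also have "(\<integral>\<^sup>+\<gamma>. ennreal \<bar>f (\<gamma> 1) - f (\<gamma> 0)\<bar> \<partial>?D) = (\<integral>\<^sup>+\<gamma>. ennreal \<bar>f (stop s t \<gamma> 1) - f (stop s t \<gamma> 0)\<bar> \<partial>?U)"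
    using measurable_compose[OF 01(1) f] measurable_compose[OF 01(2) f]
    by (subst nn_integral_distr[OF stopU]) (simp_all add: measurable_plan)
  also have "\<dots> = (\<integral>\<^sup>+\<gamma>. ennreal \<bar>f (\<gamma> t) - f (\<gamma> s)\<bar> \<partial>?U)"
  proof -
    have "max s (min t 1) = t" "max s (min t 0) = s" using st by linarith+
    then show ?thesis by (simp add: stop_apply)
  qed
  also have "\<dots> = (\<integral>\<^sup>+\<gamma>. ennreal \<bar>f (\<gamma> t) - f (\<gamma> s)\<bar> * indicator A \<gamma> \<partial>\<pi>) / emeasure \<pi> A"
    by (rule nn_integral_uniform_measure[OF meas_u A(1)])
  also have "(\<integral>\<^sup>+\<gamma>. action g \<gamma> 0 1 \<partial>?D) = (\<integral>\<^sup>+\<gamma>. action g (stop s t \<gamma>) 0 1 \<partial>?U)"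
    using slope_action_integral_measurable[OF g, of "{0..1}"]
    by (subst nn_integral_distr[OF stopU]) (simp_all add: measurable_plan)
  also have "\<dots> = (\<integral>\<^sup>+\<gamma>. action g \<gamma> s t \<partial>?U)"
    by (simp add: slope_action_stop[OF st])
  also have "\<dots> = (\<integral>\<^sup>+\<gamma>. action g \<gamma> s t * indicator A \<gamma> \<partial>\<pi>) / emeasure \<pi> A"
    by (rule nn_integral_uniform_measure[OF meas_v A(1)])
  finally have le: "(\<integral>\<^sup>+\<gamma>. ennreal \<bar>f (\<gamma> t) - f (\<gamma> s)\<bar> * indicator A \<gamma> \<partial>\<pi>) / emeasure \<pi> A
    \<le> (\<integral>\<^sup>+\<gamma>. action g \<gamma> s t * indicator A \<gamma> \<partial>\<pi>) / emeasure \<pi> A" .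
  have cancel: "x / emeasure \<pi> A * emeasure \<pi> A = x" for x :: ennreal
    using A(2) by (simp add: ennreal_times_divide ennreal_divide_times mult_divide_eq_ennreal)
  show "(\<integral>\<^sup>+\<gamma>. ennreal \<bar>f (\<gamma> t) - f (\<gamma> s)\<bar> * indicator A \<gamma> \<partial>\<pi>)
    \<le> (\<integral>\<^sup>+\<gamma>. action g \<gamma> s t * indicator A \<gamma> \<partial>\<pi>)"
    using mult_right_mono[OF le, of "emeasure \<pi> A"] by (simp add: cancel)
qed

end

text \<open>A continuous representative \<open>F\<close> of f along \<open>\<gamma>\<close>, whose
  modulus has as density \<open>k\<close> the product of g and the speed on [0,1]. Agreement with f
  is asked at the rational times, which include both endpoints, and at almost every time: the
  exceptional curves of \<open>wug_curve\<close> depend on the pair of times, and f along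
  \<open>\<gamma>\<close> may jump at the remaining ones.\<close>

definition ac_lift :: "('a::metric_space \<Rightarrow> real) \<Rightarrow> ('a \<Rightarrow> real) \<Rightarrow> (real \<Rightarrow> 'a) \<Rightarrow> (real \<Rightarrow> real) \<Rightarrow> (real \<Rightarrow> real) \<Rightarrow> bool" where
  "ac_lift f g \<gamma> k F \<longleftrightarrow> integrable lborel k \<and> (\<forall>x. 0 \<le> k x) \<and>
     (AE r in lborel. r \<in> {0..1} \<longrightarrow> ennreal (k r) = slope_action g \<gamma> r) \<and>
     (\<forall>s t. \<bar>F s - F t\<bar> \<le> \<bar>primitive k s - primitive k t\<bar>) \<and>
     (\<forall>q::rat. 0 \<le> q \<and> q \<le> 1 \<longrightarrow> F (real_of_rat q) = f (\<gamma> (real_of_rat q))) \<and>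
     (AE r in lborel. r \<in> {0..1} \<longrightarrow> F r = f (\<gamma> r))"

text \<open>On rational times the inequality holds for every pair, so f extends from them with
  modulus \<open>primitive k\<close>. A good time r is compared with a nearby rational after it:
  both f along the curve and the extension change by at most e/2 on the way, so they agree at
  r.\<close>

lemma ac_liftI:
  fixes \<gamma> :: "real \<Rightarrow> 'a::polish_space"
  assumes meas: "slope_action g \<gamma> \<in> borel_measurable borel"
    and fin: "action g \<gamma> 0 1 < \<infinity>"
    and rat: "\<And>p q::rat. 0 \<le> p \<Longrightarrow> p \<le> q \<Longrightarrow> q \<le> 1 \<Longrightarrow>
      ennreal \<bar>f (\<gamma> (real_of_rat q)) - f (\<gamma> (real_of_rat p))\<bar> \<le> action g \<gamma> (real_of_rat p) (real_of_rat q)"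
    and ae: "AE r in lborel. r \<in> {0..1} \<longrightarrow> (\<forall>q::rat. 0 \<le> q \<and> q \<le> 1 \<longrightarrow>
      ennreal \<bar>f (\<gamma> r) - f (\<gamma> (real_of_rat q))\<bar> \<le> action g \<gamma> (min r (real_of_rat q)) (max r (real_of_rat q)))"
  shows "\<exists>k F. ac_lift f g \<gamma> k F"
proof -
  define k where "k r = enn2real (slope_action g \<gamma> r) * indicator {0..1} r" for r
  have k0: "0 \<le> k r" for r by (simp add: k_def)
  have km: "k \<in> borel_measurable lborel" unfolding k_def[abs_def] using meas by simp
  have "AE r in lborel. slope_action g \<gamma> r * indicator {0..1} r \<noteq> \<infinity>"
    by (rule nn_integral_PInf_AE) (use fin meas in auto)
  then have kae: "AE r in lborel. slope_action g \<gamma> r * indicator {0..1} r = ennreal (k r)"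
    by eventually_elim (auto simp: k_def indicator_def ennreal_enn2real_if)
  have "(\<integral>\<^sup>+r. ennreal (k r) \<partial>lborel) = action g \<gamma> 0 1"
    by (rule nn_integral_cong_AE) (use kae in eventually_elim, simp)
  then have kint: "integrable lborel k" using fin km k0 by (intro integrableI_nonneg) auto
  let ?K = "primitive k"
  have int_K: "action g \<gamma> s t = ennreal \<bar>?K t - ?K s\<bar>"
    if "0 \<le> s" "s \<le> t" "t \<le> 1" for s t
  proof -
    have "action g \<gamma> s t = (\<integral>\<^sup>+r\<in>{s..t}. ennreal (k r) \<partial>lborel)"
    proof (rule nn_integral_cong_AE)
      show "AE r in lborel. slope_action g \<gamma> r * indicator {s..t} r = ennreal (k r) * indicator {s..t} r"
        using kae
      proof eventually_elim
        case (elim r)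
        show ?case
        proof (cases "r \<in> {s..t}")
          case True
          then have "r \<in> {0..1}" using that by auto
          then show ?thesis using True elim by simp
        qed simp
      qed
    qed
    also have "\<dots> = ennreal \<bar>?K t - ?K s\<bar>"
      using primitive_mono[OF kint k0 that(2)] by (subst nn_integral_primitive[OF kint k0 that(2)]) simp
    finally show ?thesis .
  qed
  let ?S = "real_of_rat ` {q. 0 \<le> q \<and> q \<le> 1}"
  have S: "\<bar>f (\<gamma> p) - f (\<gamma> q)\<bar> \<le> \<bar>?K p - ?K q\<bar>" if pqS: "p \<in> ?S" "q \<in> ?S" for p q
  proof -
    obtain p' q' where pq: "p = real_of_rat p'" "q = real_of_rat q'" "0 \<le> p'" "p' \<le> 1" "0 \<le> q'" "q' \<le> 1" using pqS by auto
    have *: "\<bar>f (\<gamma> (real_of_rat b)) - f (\<gamma> (real_of_rat a))\<bar> \<le> \<bar>?K (real_of_rat b) - ?K (real_of_rat a)\<bar>"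
      if "0 \<le> a" "a \<le> b" "b \<le> 1" for a b :: rat
      using rat[OF that] int_K[of "real_of_rat a" "real_of_rat b"] that by (simp add: of_rat_less_eq)
    show ?thesis
      using *[of p' q'] *[of q' p'] pq by (cases "p' \<le> q'") (simp_all add: abs_minus_commute)
  qed
  have "0 \<in> ?S" by (auto intro!: image_eqI[of _ _ 0])
  then obtain F where F: "\<And>q. q \<in> ?S \<Longrightarrow> F q = f (\<gamma> q)" "\<And>s t. \<bar>F s - F t\<bar> \<le> \<bar>?K s - ?K t\<bar>"
    by (rule mcshane_extension[where K="?K" and \<phi>="\<lambda>t. f (\<gamma> t)"]) (use S in blast)+
  have "AE r in lborel. r \<in> {0..1} \<longrightarrow> F r = f (\<gamma> r)"
    using ae AE_lborel_singleton[of 1]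
  proof eventually_elim
    case (elim r)
    show ?case
    proof
      assume "r \<in> {0..1}"
      then have r: "0 \<le> r" "r < 1" using elim(2) by auto
      have "\<bar>F r - f (\<gamma> r)\<bar> \<le> 0 + e" if "e > 0" for e
      proof -
        obtain d where d: "d > 0" "\<And>x. \<bar>x - r\<bar> < d \<Longrightarrow> \<bar>?K x - ?K r\<bar> < e / 2"
          using primitive_isCont[OF kint, of r] \<open>e > 0\<close> unfolding isCont_def LIM_def dist_real_def
          by (metis abs_zero diff_self half_gt_zero)
        obtain q where q: "r < real_of_rat q" "real_of_rat q < min 1 (r + d)"
          using of_rat_dense[of r "min 1 (r + d)"] d r by auto
        have q': "0 \<le> q" "q \<le> 1"
          using q r zero_le_of_rat_iff[where 'a=real, of q] of_rat_le_1_iff[where 'a=real, of q] by linarith+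
        have "ennreal \<bar>f (\<gamma> r) - f (\<gamma> (real_of_rat q))\<bar> \<le> ennreal \<bar>?K (real_of_rat q) - ?K r\<bar>"
        proof -
          have "min r (real_of_rat q) = r" "max r (real_of_rat q) = real_of_rat q" using q by linarith+
          then show ?thesis
            using elim(1)[rule_format, OF \<open>r \<in> {0..1}\<close>, of q] q' int_K[of r "real_of_rat q"] q r by simp
        qed
        then have "\<bar>f (\<gamma> r) - f (\<gamma> (real_of_rat q))\<bar> \<le> e / 2"
          using d(2)[of "real_of_rat q"] q by (simp add: abs_if split: if_splits)
        moreover have "F (real_of_rat q) = f (\<gamma> (real_of_rat q))" using F(1) q' by blast
        moreover have "\<bar>F (real_of_rat q) - F r\<bar> \<le> e / 2"
          using F(2)[of "real_of_rat q" r] d(2)[of "real_of_rat q"] q by linarith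
        ultimately show ?thesis by linarith
      qed
      then show "F r = f (\<gamma> r)" using field_le_epsilon[of "\<bar>F r - f (\<gamma> r)\<bar>" 0] by simp
    qed
  qed
  moreover have "AE r in lborel. r \<in> {0..1} \<longrightarrow> ennreal (k r) = slope_action g \<gamma> r"
    using kae by eventually_elim (auto simp: indicator_def)
  ultimately have "ac_lift f g \<gamma> k F"
    unfolding ac_lift_def using kint k0 F by blast
  then show ?thesis by blast
qed

context plan
begin

text \<open>Pairs of rational times cost only a countable union of null sets of curves. A pair of a
  rational and a real time is handled by Fubini, which yields the inequality for almost every real
  time along almost every curve; this is all that \<open>ac_liftI\<close> asks for.\<close>

lemma ac_lift_AE:
  assumes wug: "weak_upper_gradient m f g" and f: "f \<in> borel_measurable m"
  shows "AE \<gamma> in \<pi>. \<exists>k F. ac_lift f g \<gamma> k F"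
proof -
  have g2: "g \<in> L2 m" using wugD[OF wug] by simp
  then have g: "g \<in> borel_measurable m" by (simp add: L2_def)
  have fin: "AE \<gamma> in \<pi>. action g \<gamma> 0 1 \<noteq> \<infinity>"
    by (rule nn_integral_PInf_AE)
      (use slope_action_finite[OF g2] slope_action_integral_measurable[OF g, of "{0..1}"] in auto)
  have rat: "AE \<gamma> in \<pi>. \<forall>p q::rat. 0 \<le> p \<and> p \<le> q \<and> q \<le> 1 \<longrightarrow>
      ennreal \<bar>f (\<gamma> (real_of_rat q)) - f (\<gamma> (real_of_rat p))\<bar> \<le> action g \<gamma> (real_of_rat p) (real_of_rat q)"
    unfolding AE_all_countable
  proof (intro allI)
    fix p q :: rat
    show "AE \<gamma> in \<pi>. 0 \<le> p \<and> p \<le> q \<and> q \<le> 1 \<longrightarrow>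
      ennreal \<bar>f (\<gamma> (real_of_rat q)) - f (\<gamma> (real_of_rat p))\<bar> \<le> action g \<gamma> (real_of_rat p) (real_of_rat q)"
    proof (cases "0 \<le> p \<and> p \<le> q \<and> q \<le> 1")
      case True
      then have "0 \<le> real_of_rat p" "real_of_rat p \<le> real_of_rat q" "real_of_rat q \<le> 1"
        by (simp_all add: of_rat_less_eq)
      from wug_curve[OF wug f this] show ?thesis by eventually_elim simp
    next
      case False then show ?thesis by (intro AE_I2) blast
    qed
  qed
  \<comment> \<open>Covers both orders of the two times; clamping r extends the inequality to the
    whole line, as Fubini with \<open>lborel\<close> requires.\<close>
  let ?I = "\<lambda>q r. {min (clamp01 r) (real_of_rat q)..max (clamp01 r) (real_of_rat q)}"
  have "AE \<gamma> in \<pi>. \<forall>q::rat. 0 \<le> q \<and> q \<le> 1 \<longrightarrow> (AE r in lborel.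
      ennreal \<bar>f (\<gamma> (clamp01 r)) - f (\<gamma> (clamp01 (real_of_rat q)))\<bar> \<le> (\<integral>\<^sup>+u\<in>?I q r. slope_action g \<gamma> u \<partial>lborel))"
    unfolding AE_all_countable
  proof
    fix q :: rat
    have "AE \<gamma> in \<pi>. AE r in lborel.
      ennreal \<bar>f (\<gamma> (clamp01 r)) - f (\<gamma> (clamp01 (real_of_rat q)))\<bar> \<le> (\<integral>\<^sup>+u\<in>?I q r. slope_action g \<gamma> u \<partial>lborel)"
      if q: "0 \<le> q \<and> q \<le> 1"
    proof (rule AE_curve_of_AE)
      fix r
      have "AE \<gamma> in \<pi>. ennreal \<bar>f (\<gamma> b) - f (\<gamma> a)\<bar> \<le> action g \<gamma> a b"
        if "0 \<le> a" "a \<le> b" "b \<le> 1" for a b by (rule wug_curve[OF wug f that])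
      from this[of "clamp01 r" "real_of_rat q"] this[of "real_of_rat q" "clamp01 r"]
      show "AE \<gamma> in \<pi>. ennreal \<bar>f (\<gamma> (clamp01 r)) - f (\<gamma> (clamp01 (real_of_rat q)))\<bar> \<le> (\<integral>\<^sup>+u\<in>?I q r. slope_action g \<gamma> u \<partial>lborel)"
        using q by (cases "clamp01 r \<le> real_of_rat q") (simp_all add: clamp01_id min_def max_def abs_minus_commute)
    next
      have c: "clamp01 \<in> borel_measurable borel" unfolding clamp01_def[abs_def] by measurable
      have m1: "(\<lambda>p. f (fst p (clamp01 (snd p)))) \<in> borel_measurable (\<pi> \<Otimes>\<^sub>M lborel)"
        by (rule measurable_compose[OF eval_joint_plan f])
      have qq: "clamp01 (real_of_rat q) \<in> {0..1}" by simp
      have m2: "(\<lambda>p. f (fst p (clamp01 (real_of_rat q)))) \<in> borel_measurable (\<pi> \<Otimes>\<^sub>M lborel)"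
        by (rule measurable_compose[OF measurable_fst measurable_compose[OF eval_plan[OF qq] f]])
      have m3: "(\<lambda>p. ennreal \<bar>f (fst p (clamp01 (snd p))) - f (fst p (clamp01 (real_of_rat q)))\<bar>) \<in> borel_measurable (\<pi> \<Otimes>\<^sub>M lborel)"
        by (rule measurable_compose[OF borel_measurable_abs[OF borel_measurable_diff[OF m1 m2]] measurable_ennreal])
      \<comment> \<open>The endpoints of integration depend on r, so the integrand is regarded as a
        function of ((\<gamma>, r), u), and u alone is integrated out.\<close>
      have "(\<lambda>x. (fst (fst x), snd x)) \<in> (\<pi> \<Otimes>\<^sub>M lborel) \<Otimes>\<^sub>M lborel \<rightarrow>\<^sub>M \<pi> \<Otimes>\<^sub>M lborel" by measurable
      from measurable_compose[OF this slope_action_measurable[OF g]]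
      have s[measurable]: "(\<lambda>x. slope_action g (fst (fst x)) (snd x)) \<in> borel_measurable ((\<pi> \<Otimes>\<^sub>M lborel) \<Otimes>\<^sub>M lborel)"
        by simp
      have "(\<lambda>x. clamp01 (snd (fst x))) \<in> borel_measurable ((\<pi> \<Otimes>\<^sub>M lborel) \<Otimes>\<^sub>M lborel)"
        by (rule measurable_compose[OF _ c]) measurable
      note [measurable] = this
      have i[measurable]: "(\<lambda>x. indicator (?I q (snd (fst x))) (snd x) :: ennreal) \<in> borel_measurable ((\<pi> \<Otimes>\<^sub>M lborel) \<Otimes>\<^sub>M lborel)"
        unfolding indicator_def atLeastAtMost_iff by measurable
      have m4: "(\<lambda>p. \<integral>\<^sup>+u\<in>?I q (snd p). slope_action g (fst p) u \<partial>lborel) \<in> borel_measurable (\<pi> \<Otimes>\<^sub>M lborel)"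
        by (rule lborel.borel_measurable_nn_integral) (simp add: split_beta', measurable)
      show "{p \<in> space (\<pi> \<Otimes>\<^sub>M lborel). ennreal \<bar>f (fst p (clamp01 (snd p))) - f (fst p (clamp01 (real_of_rat q)))\<bar>
         \<le> (\<integral>\<^sup>+u\<in>?I q (snd p). slope_action g (fst p) u \<partial>lborel)} \<in> sets (\<pi> \<Otimes>\<^sub>M lborel)"
        by (rule borel_measurable_le[OF m3 m4])
    qed
    then show "AE \<gamma> in \<pi>. 0 \<le> q \<and> q \<le> 1 \<longrightarrow> (AE r in lborel.
      ennreal \<bar>f (\<gamma> (clamp01 r)) - f (\<gamma> (clamp01 (real_of_rat q)))\<bar> \<le> (\<integral>\<^sup>+u\<in>?I q r. slope_action g \<gamma> u \<partial>lborel))"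
      by (cases "0 \<le> q \<and> q \<le> 1") (auto elim: eventually_mono)
  qed
  then show ?thesis
    using fin rat AE_space[of \<pi>]
  proof eventually_elim
    case (elim \<gamma>)
    show ?case
    proof (rule ac_liftI)
      show "slope_action g \<gamma> \<in> borel_measurable borel"
        using measurable_compose[OF measurable_Pair1'[OF elim(4)] slope_action_measurable[OF g]] by simp
      show "action g \<gamma> 0 1 < \<infinity>" using elim(2) by (simp add: less_top)
      show "\<And>p q::rat. 0 \<le> p \<Longrightarrow> p \<le> q \<Longrightarrow> q \<le> 1 \<Longrightarrow>
        ennreal \<bar>f (\<gamma> (real_of_rat q)) - f (\<gamma> (real_of_rat p))\<bar> \<le> action g \<gamma> (real_of_rat p) (real_of_rat q)"
        using elim(3) by blast
      have "AE r in lborel. \<forall>q::rat. 0 \<le> q \<and> q \<le> 1 \<longrightarrow>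
        ennreal \<bar>f (\<gamma> (clamp01 r)) - f (\<gamma> (clamp01 (real_of_rat q)))\<bar> \<le> (\<integral>\<^sup>+u\<in>?I q r. slope_action g \<gamma> u \<partial>lborel)"
        unfolding AE_all_countable
      proof
        fix q :: rat
        show "AE r in lborel. 0 \<le> q \<and> q \<le> 1 \<longrightarrow>
          ennreal \<bar>f (\<gamma> (clamp01 r)) - f (\<gamma> (clamp01 (real_of_rat q)))\<bar> \<le> (\<integral>\<^sup>+u\<in>?I q r. slope_action g \<gamma> u \<partial>lborel)"
          using elim(1) by (cases "0 \<le> q \<and> q \<le> 1") (auto elim: eventually_mono)
      qed
      then show "AE r in lborel. r \<in> {0..1} \<longrightarrow> (\<forall>q::rat. 0 \<le> q \<and> q \<le> 1 \<longrightarrow>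
        ennreal \<bar>f (\<gamma> r) - f (\<gamma> (real_of_rat q))\<bar> \<le> action g \<gamma> (min r (real_of_rat q)) (max r (real_of_rat q)))"
        by eventually_elim (auto simp: clamp01_id)
    qed
  qed
qed

end

subsection \<open>Square-integrable functions\<close>

lemma L2_mult_bounded:
  assumes "f \<in> L2 m" "\<phi> \<in> borel_measurable m" "\<And>x. \<bar>\<phi> x\<bar> \<le> M"
  shows "(\<lambda>x. \<phi> x * f x) \<in> L2 m"
proof -
  have fm[measurable]: "f \<in> borel_measurable m" and i: "integrable m (\<lambda>x. M\<^sup>2 * (f x)\<^sup>2)" using assms by (auto simp: L2_def)
  note assms(2)[measurable]
  have "integrable m (\<lambda>x. (\<phi> x * f x)\<^sup>2)"
  proof (rule Bochner_Integration.integrable_bound[OF i])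
    have "(\<phi> x)\<^sup>2 \<le> M\<^sup>2" for x using assms(3)[of x] by (intro abs_le_square_iff[THEN iffD1]) linarith
    then show "AE x in m. norm ((\<phi> x * f x)\<^sup>2) \<le> norm (M\<^sup>2 * (f x)\<^sup>2)"
      by (intro AE_I2) (simp add: power_mult_distrib mult_right_mono)
  qed simp
  then show ?thesis by (simp add: L2_def)
qed

lemma L2_add:
  assumes "f \<in> L2 m" "g \<in> L2 m"
  shows "(\<lambda>x. f x + g x) \<in> L2 m"
proof -
  have [measurable]: "f \<in> borel_measurable m" "g \<in> borel_measurable m"
    and i: "integrable m (\<lambda>x. 2 * (f x)\<^sup>2 + 2 * (g x)\<^sup>2)" using assms by (auto simp: L2_def)
  have "integrable m (\<lambda>x. (f x + g x)\<^sup>2)"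
  proof (rule Bochner_Integration.integrable_bound[OF i])
    have "(a + b)\<^sup>2 \<le> 2 * a\<^sup>2 + 2 * b\<^sup>2" for a b :: real
      using zero_le_power2[of "a - b"] by (simp add: power2_eq_square algebra_simps)
    then show "AE x in m. norm ((f x + g x)\<^sup>2) \<le> norm (2 * (f x)\<^sup>2 + 2 * (g x)\<^sup>2)" by (intro AE_I2) simp
  qed simp
  then show ?thesis by (simp add: L2_def)
qed

lemma L2_diff: "f \<in> L2 m \<Longrightarrow> g \<in> L2 m \<Longrightarrow> (\<lambda>x. f x - g x) \<in> L2 m"
  using L2_add[of f m "\<lambda>x. - g x"] by (simp add: L2_def)

lemma L2_cmult: "f \<in> L2 m \<Longrightarrow> (\<lambda>x. c * f x) \<in> L2 m"
  by (rule L2_mult_bounded[of f m "\<lambda>_. c" "\<bar>c\<bar>"]) auto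

lemma L2_bound:
  assumes "f \<in> L2 m" "g \<in> borel_measurable m" "\<And>x. \<bar>g x\<bar> \<le> C * \<bar>f x\<bar>"
  shows "g \<in> L2 m"
proof -
  have i: "integrable m (\<lambda>x. C\<^sup>2 * (f x)\<^sup>2)" using assms by (auto simp: L2_def)
  note assms(2)[measurable]
  have "integrable m (\<lambda>x. (g x)\<^sup>2)"
  proof (rule Bochner_Integration.integrable_bound[OF i])
    show "AE x in m. norm ((g x)\<^sup>2) \<le> norm (C\<^sup>2 * (f x)\<^sup>2)"
    proof (rule AE_I2)
      fix x
      have "(g x)\<^sup>2 \<le> (C * \<bar>f x\<bar>)\<^sup>2" using power_mono[OF assms(3)[of x], of 2] by simp
      then show "norm ((g x)\<^sup>2) \<le> norm (C\<^sup>2 * (f x)\<^sup>2)" by (simp add: power_mult_distrib)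
    qed
  qed simp
  then show ?thesis using assms by (simp add: L2_def)
qed

lemma L2_mult_integrable:
  assumes "f \<in> L2 m" "g \<in> L2 m"
  shows "integrable m (\<lambda>x. f x * g x)"
proof -
  have [measurable]: "f \<in> borel_measurable m" "g \<in> borel_measurable m"
    and i: "integrable m (\<lambda>x. (f x)\<^sup>2 + (g x)\<^sup>2)" using assms by (auto simp: L2_def)
  show ?thesis
  proof (rule Bochner_Integration.integrable_bound[OF i])
    have "\<bar>a * b\<bar> \<le> a\<^sup>2 + b\<^sup>2" for a b :: real
    proof -
      have "2 * (\<bar>a\<bar> * \<bar>b\<bar>) \<le> a\<^sup>2 + b\<^sup>2" using sum_squares_bound[of "\<bar>a\<bar>" "\<bar>b\<bar>"] by (simp add: mult.assoc)
      moreover have "0 \<le> \<bar>a\<bar> * \<bar>b\<bar>" by simp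
      ultimately show ?thesis by (simp only: abs_mult)
    qed
    then show "AE x in m. norm (f x * g x) \<le> norm ((f x)\<^sup>2 + (g x)\<^sup>2)" by (intro AE_I2) simp
  qed simp
qed

lemma l2norm_nonneg[simp]: "0 \<le> l2norm m f" by (simp add: l2norm_def)

lemma l2norm_square: "(l2norm m f)\<^sup>2 = (\<integral>x. (f x)\<^sup>2 \<partial>m)" by (simp add: l2norm_def)

lemma L2_Cauchy_Schwarz:
  assumes f: "f \<in> L2 m" and g: "g \<in> L2 m"
  shows "\<bar>\<integral>x. f x * g x \<partial>m\<bar> \<le> l2norm m f * l2norm m g"
proof -
  let ?I = "\<integral>x. f x * g x \<partial>m" and ?a = "\<integral>x. (f x)\<^sup>2 \<partial>m" and ?b = "\<integral>x. (g x)\<^sup>2 \<partial>m"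
  have if2: "integrable m (\<lambda>x. (f x)\<^sup>2)" and ig: "integrable m (\<lambda>x. (g x)\<^sup>2)" using f g by (auto simp: L2_def)
  have quad: "0 \<le> ?a + 2 * s * ?I + s\<^sup>2 * ?b" for s
  proof -
    have "0 \<le> (\<integral>x. (f x + s * g x)\<^sup>2 \<partial>m)" by (rule integral_nonneg_AE) simp
    also have "\<dots> = (\<integral>x. (f x)\<^sup>2 + 2 * s * (f x * g x) + s\<^sup>2 * (g x)\<^sup>2 \<partial>m)"
      by (intro Bochner_Integration.integral_cong) (simp_all add: power2_eq_square algebra_simps)
    also have "\<dots> = ?a + 2 * s * ?I + s\<^sup>2 * ?b"
      using if2 ig L2_mult_integrable[OF f g] by (simp add: Bochner_Integration.integral_add)
    finally show ?thesis .
  qed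
  have a0: "0 \<le> ?a" and b0: "0 \<le> ?b" by (auto intro!: integral_nonneg_AE)
  have "?I\<^sup>2 \<le> ?a * ?b"
  proof (cases "?b = 0")
    case True
    have "?I = 0"
    proof (rule ccontr)
      assume "?I \<noteq> 0"
      \<comment> \<open>With \<open>?b = 0\<close> the polynomial is affine in s, and this s would
        give it the value -1.\<close>
      then have "2 * (- (?a + 1) / (2 * ?I)) * ?I = - (?a + 1)" by simp
      then show False using quad[of "- (?a + 1) / (2 * ?I)"] True by simp
    qed
    then show ?thesis using a0 b0 by simp
  next
    case False
    then have "0 < ?b" using b0 by linarith
    moreover have "0 \<le> ?a + 2 * (- ?I / ?b) * ?I + (- ?I / ?b)\<^sup>2 * ?b" by (rule quad)
    ultimately show ?thesis by (simp add: field_simps power2_eq_square)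
  qed
  then have "sqrt (?I\<^sup>2) \<le> sqrt (?a * ?b)" by (rule real_sqrt_le_mono)
  then show ?thesis by (simp add: l2norm_def real_sqrt_mult)
qed

lemma l2norm_triangle:
  assumes f: "f \<in> L2 m" and g: "g \<in> L2 m"
  shows "l2norm m (\<lambda>x. f x + g x) \<le> l2norm m f + l2norm m g"
proof (rule power2_le_imp_le)
  have if2: "integrable m (\<lambda>x. (f x)\<^sup>2)" and ig: "integrable m (\<lambda>x. (g x)\<^sup>2)" using f g by (auto simp: L2_def)
  have "(l2norm m (\<lambda>x. f x + g x))\<^sup>2 = (\<integral>x. (f x)\<^sup>2 + 2 * (f x * g x) + (g x)\<^sup>2 \<partial>m)"
    unfolding l2norm_square by (intro Bochner_Integration.integral_cong) (simp_all add: power2_eq_square algebra_simps)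
  also have "\<dots> = (l2norm m f)\<^sup>2 + 2 * (\<integral>x. f x * g x \<partial>m) + (l2norm m g)\<^sup>2"
    using if2 ig L2_mult_integrable[OF f g] by (simp add: Bochner_Integration.integral_add l2norm_square)
  also have "\<dots> \<le> (l2norm m f + l2norm m g)\<^sup>2"
    using L2_Cauchy_Schwarz[OF f g] by (simp add: power2_sum)
  finally show "(l2norm m (\<lambda>x. f x + g x))\<^sup>2 \<le> (l2norm m f + l2norm m g)\<^sup>2" .
qed simp

lemma l2norm_cmult: "l2norm m (\<lambda>x. c * f x) = \<bar>c\<bar> * l2norm m f"
  by (simp add: l2norm_def power_mult_distrib real_sqrt_mult)

subsection \<open>Minimal weak upper gradients\<close>

text \<open>It is enough to argue curve by curve, where calculus on the line is available.\<close>

lemma wugI: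
  fixes m :: "'a::polish_space measure"
  assumes "sets m = sets borel" "g \<in> L2 m" "AE x in m. 0 \<le> g x"
    and "\<And>\<pi>. plan m \<pi> \<Longrightarrow> AE \<gamma> in \<pi>. ennreal \<bar>f (\<gamma> 1) - f (\<gamma> 0)\<bar> \<le> action g \<gamma> 0 1"
  shows "weak_upper_gradient m f g"
  unfolding weak_upper_gradient_def
proof (intro conjI allI impI)
  fix \<pi> assume "test_plan m \<pi>"
  then interpret plan m \<pi> using assms(1) by unfold_locales
  show "(\<integral>\<^sup>+\<gamma>. ennreal \<bar>f (\<gamma> 1) - f (\<gamma> 0)\<bar> \<partial>\<pi>)
          \<le> (\<integral>\<^sup>+\<gamma>. (\<integral>\<^sup>+t\<in>{0..1}. ennreal (g (\<gamma> t) * metric_speed \<gamma> t) \<partial>lborel) \<partial>\<pi>)"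
    unfolding action_eq by (intro nn_integral_mono_AE assms(4)) unfold_locales
qed (use assms in auto)

lemma ac_lift_endpoints:
  assumes "ac_lift f g \<gamma> k F"
  shows "F 0 = f (\<gamma> 0)" "F 1 = f (\<gamma> 1)"
proof -
  have "F (real_of_rat q) = f (\<gamma> (real_of_rat q))" if "0 \<le> q" "q \<le> 1" for q
    using assms that unfolding ac_lift_def by blast
  from this[of 0] this[of 1] show "F 0 = f (\<gamma> 0)" "F 1 = f (\<gamma> 1)" by simp_all
qed

lemma ac_lift_abs:
  assumes "ac_lift f g \<gamma> k F" "s \<le> t"
  shows "\<bar>F t - F s\<bar> \<le> primitive k t - primitive k s"
proof -
  have "\<bar>F t - F s\<bar> \<le> \<bar>primitive k t - primitive k s\<bar>" "primitive k s \<le> primitive k t"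
    using assms primitive_mono[of k s t] unfolding ac_lift_def by blast+
  then show ?thesis by simp
qed

lemma ac_lift_isCont: "ac_lift f g \<gamma> k F \<Longrightarrow> isCont F t"
  unfolding ac_lift_def by (intro isCont_if_primitive_bound[of k]) blast+

text \<open>Both lifts are continuous and coincide with f along \<open>\<gamma>\<close> at rational
  times. Hence a derivative of one is a derivative of the other, even when they come from different
  upper gradients.\<close>

lemma ac_lift_unique:
  assumes "ac_lift f g1 \<gamma> k1 F1" "ac_lift f g2 \<gamma> k2 F2" "t \<in> {0<..<1}"
  shows "F1 t = F2 t"
proof (rule ccontr)
  assume "F1 t \<noteq> F2 t"
  have "isCont (\<lambda>s. F1 s - F2 s) t"
    using ac_lift_isCont[OF assms(1)] ac_lift_isCont[OF assms(2)] by (rule isCont_diff)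
  then have "\<forall>\<^sub>F s in at t. F1 s - F2 s \<noteq> 0"
    using \<open>F1 t \<noteq> F2 t\<close> unfolding isCont_def by (intro tendsto_imp_eventually_ne) auto
  moreover have "\<forall>\<^sub>F s in at t. s \<in> {0<..<1}" using assms(3) by (intro eventually_at_in_open') auto
  ultimately have "\<forall>\<^sub>F s in at t. F1 s - F2 s \<noteq> 0 \<and> s \<in> {0<..<1}" by eventually_elim simp
  then obtain d where d: "d > 0" "\<And>s. s \<noteq> t \<Longrightarrow> \<bar>s - t\<bar> < d \<Longrightarrow> F1 s - F2 s \<noteq> 0 \<and> s \<in> {0<..<1}"
    unfolding eventually_at dist_real_def by auto
  obtain q where q: "t < real_of_rat q" "real_of_rat q < t + d" using of_rat_dense[of t "t + d"] d(1) by auto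
  then have *: "F1 (real_of_rat q) \<noteq> F2 (real_of_rat q)" "0 < real_of_rat q" "real_of_rat q < 1"
    using d(2)[of "real_of_rat q"] by auto
  then have "0 \<le> q" "q \<le> 1" by simp_all
  then show False using *(1) assms(1,2) unfolding ac_lift_def by metis
qed

lemma ac_lift_derivative_le:
  assumes "ac_lift f g \<gamma> k F"
  shows "AE r in lborel. \<forall>u. (F has_real_derivative u) (at r) \<longrightarrow> \<bar>u\<bar> \<le> k r"
proof -
  have k: "integrable lborel k" "\<And>x. 0 \<le> k x" and le: "\<And>s t. \<bar>F s - F t\<bar> \<le> \<bar>primitive k s - primitive k t\<bar>"
    using assms unfolding ac_lift_def by auto
  show ?thesis using primitive_has_derivative_AE[OF k(1)]
  proof (eventually_elim, intro allI impI)
    fix r u assume "(primitive k has_real_derivative k r) (at r)" "(F has_real_derivative u) (at r)"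
    then have "\<bar>u\<bar> \<le> \<bar>k r\<bar>" by (intro has_derivative_abs_bound[of F u r]) (auto simp: le)
    then show "\<bar>u\<bar> \<le> k r" using k(2)[of r] by simp
  qed
qed

lemma L2_min:
  assumes "g1 \<in> L2 m" "g2 \<in> L2 m"
  shows "(\<lambda>x. min (g1 x) (g2 x)) \<in> L2 m"
proof -
  have [measurable]: "g1 \<in> borel_measurable m" "g2 \<in> borel_measurable m"
    and i: "integrable m (\<lambda>x. (g1 x)\<^sup>2 + (g2 x)\<^sup>2)" using assms by (auto simp: L2_def)
  have "integrable m (\<lambda>x. (min (g1 x) (g2 x))\<^sup>2)"
    by (rule Bochner_Integration.integrable_bound[OF i]) (auto simp: min_def)
  then show ?thesis by (simp add: L2_def)
qed

text \<open>The integrated inequalities for g1 and g2 do not combine directly, but their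
  consequences along a single curve do: the two lifts are one function on (0,1), whose derivative
  obeys both bounds at almost every time.\<close>

lemma wug_min:
  fixes m :: "'a::polish_space measure"
  assumes sm: "sets m = sets borel" and f: "f \<in> borel_measurable m"
    and 1: "weak_upper_gradient m f g1" and 2: "weak_upper_gradient m f g2"
  shows "weak_upper_gradient m f (\<lambda>x. min (g1 x) (g2 x))"
proof (rule wugI[OF sm L2_min])
  show "g1 \<in> L2 m" "g2 \<in> L2 m" using wugD 1 2 by auto
  show "AE x in m. 0 \<le> min (g1 x) (g2 x)" using wugD(2)[OF 1] wugD(2)[OF 2] by eventually_elim simp
  fix \<pi> assume "plan m \<pi>"
  then interpret plan m \<pi> .
  show "AE \<gamma> in \<pi>. ennreal \<bar>f (\<gamma> 1) - f (\<gamma> 0)\<bar> \<le> action (\<lambda>x. min (g1 x) (g2 x)) \<gamma> 0 1"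
    using ac_lift_AE[OF 1 f] ac_lift_AE[OF 2 f]
  proof eventually_elim
    case (elim \<gamma>)
    then obtain k1 F1 k2 F2 where L: "ac_lift f g1 \<gamma> k1 F1" "ac_lift f g2 \<gamma> k2 F2" by blast
    have k1: "integrable lborel k1" "\<And>x. 0 \<le> k1 x"
      and s1: "AE r in lborel. r \<in> {0..1} \<longrightarrow> ennreal (k1 r) = slope_action g1 \<gamma> r"
      and s2: "AE r in lborel. r \<in> {0..1} \<longrightarrow> ennreal (k2 r) = slope_action g2 \<gamma> r"
      using L unfolding ac_lift_def by blast+
    have "ennreal \<bar>F1 1 - F1 0\<bar> \<le> action (\<lambda>x. min (g1 x) (g2 x)) \<gamma> 0 1"
    proof (rule derivative_bound_imp_increment_bound[OF k1])
      show "\<And>s t. s \<le> t \<Longrightarrow> \<bar>F1 t - F1 s\<bar> \<le> primitive k1 t - primitive k1 s" by (rule ac_lift_abs[OF L(1)])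
      show "AE r in lborel. r \<in> {0<..<1} \<longrightarrow> (\<forall>u. (F1 has_real_derivative u) (at r) \<longrightarrow>
          ennreal \<bar>u\<bar> \<le> slope_action (\<lambda>x. min (g1 x) (g2 x)) \<gamma> r)"
        using s1 s2 ac_lift_derivative_le[OF L(1)] ac_lift_derivative_le[OF L(2)]
      proof (eventually_elim, intro impI allI)
        fix r u
        assume a: "r \<in> {0..1} \<longrightarrow> ennreal (k1 r) = slope_action g1 \<gamma> r" "r \<in> {0..1} \<longrightarrow> ennreal (k2 r) = slope_action g2 \<gamma> r"
          "\<forall>u. (F1 has_real_derivative u) (at r) \<longrightarrow> \<bar>u\<bar> \<le> k1 r" "\<forall>u. (F2 has_real_derivative u) (at r) \<longrightarrow> \<bar>u\<bar> \<le> k2 r"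
          and r: "r \<in> {0<..<1}" and u: "(F1 has_real_derivative u) (at r)"
        have "(F2 has_real_derivative u) (at r)"
          by (rule has_field_derivative_transform_within_open[OF u open_greaterThanLessThan r ac_lift_unique[OF L]])
        then have "ennreal \<bar>u\<bar> \<le> ennreal (k1 r)" "ennreal \<bar>u\<bar> \<le> ennreal (k2 r)"
          using a(3,4) u by (blast intro: ennreal_leI)+
        moreover have "ennreal (k1 r) = slope_action g1 \<gamma> r" "ennreal (k2 r) = slope_action g2 \<gamma> r"
          using a(1,2) r by simp_all
        ultimately have "ennreal \<bar>u\<bar> \<le> slope_action g1 \<gamma> r" "ennreal \<bar>u\<bar> \<le> slope_action g2 \<gamma> r"
          by simp_all
        then show "ennreal \<bar>u\<bar> \<le> slope_action (\<lambda>x. min (g1 x) (g2 x)) \<gamma> r"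
          by (simp add: slope_action_def min_def)
      qed
    qed
    then show ?case using ac_lift_endpoints[OF L(1)] by simp
  qed
qed

text \<open>Along almost every curve the actions of \<open>h n\<close> converge by dominated
  convergence, with the action of \<open>h 0\<close> as majorant. The maximum with 0 secures a lower
  bound for the infimum at every point, as weak upper gradients are nonnegative only almost
  everywhere.\<close>

lemma wug_limit:
  fixes m :: "'a::polish_space measure" and h :: "nat \<Rightarrow> 'a \<Rightarrow> real"
  assumes sm: "sets m = sets borel" and f: "f \<in> borel_measurable m"
    and h: "\<And>n. weak_upper_gradient m f (h n)" and dec: "\<And>x. decseq (\<lambda>n. h n x)"
  shows "weak_upper_gradient m f (\<lambda>x. INF n. max 0 (h n x))"
proof (rule wugI[OF sm])
  let ?h = "\<lambda>x. INF n. max 0 (h n x)"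
  have bdd: "bdd_below (range (\<lambda>n. max 0 (h n x)))" for x by (intro bdd_belowI[of _ 0]) auto
  have hm[measurable]: "h n \<in> borel_measurable m" for n by (rule wugD(3)[OF h])
  have meas: "?h \<in> borel_measurable m" by (intro borel_measurable_cINF) (auto simp: bdd)
  have pos: "0 \<le> ?h x" for x by (intro cINF_greatest) auto
  have le: "?h x \<le> max 0 (h 0 x)" for x by (intro cINF_lower bdd) simp
  have "integrable m (\<lambda>x. (?h x)\<^sup>2)"
  proof (rule Bochner_Integration.integrable_bound[OF wugD(4)[OF h[of 0]]])
    show "AE x in m. norm ((?h x)\<^sup>2) \<le> norm ((h 0 x)\<^sup>2)"
      using wugD(2)[OF h[of 0]]
    proof eventually_elim
      case (elim x)
      then have "?h x \<le> h 0 x" using le[of x] by simp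
      then show ?case using pos[of x] by (simp add: power_mono)
    qed
  qed (use meas in simp)
  then show "?h \<in> L2 m" using meas by (simp add: L2_def)
  show "AE x in m. 0 \<le> ?h x" using pos by simp
  have lim: "(\<lambda>n. ennreal (h n x)) \<longlonglongrightarrow> ennreal (?h x)" for x
  proof -
    have "(\<lambda>n. max 0 (h n x)) \<longlonglongrightarrow> ?h x"
    proof (rule LIMSEQ_decseq_INF[OF bdd])
      show "decseq (\<lambda>n. max 0 (h n x))"
      proof (rule decseq_SucI)
        fix n
        have "h (Suc n) x \<le> h n x" using decseqD[OF dec[of x], of n "Suc n"] by simp
        then show "max 0 (h (Suc n) x) \<le> max 0 (h n x)" by simp
      qed
    qed
    then have "(\<lambda>n. ennreal (max 0 (h n x))) \<longlonglongrightarrow> ennreal (?h x)" by (rule tendsto_ennrealI)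
    then show ?thesis by (simp add: ennreal_max_0 max.commute)
  qed
  fix \<pi> assume "plan m \<pi>"
  then interpret plan m \<pi> .
  have "AE \<gamma> in \<pi>. \<forall>n. ennreal \<bar>f (\<gamma> 1) - f (\<gamma> 0)\<bar> \<le> action (h n) \<gamma> 0 1"
    unfolding AE_all_countable using wug_curve[OF h f, of 0 1] by simp
  moreover have "AE \<gamma> in \<pi>. action (h 0) \<gamma> 0 1 \<noteq> \<infinity>"
  proof (rule nn_integral_PInf_AE)
    have "h 0 \<in> L2 m" by (rule wugD(1)[OF h])
    then show "(\<integral>\<^sup>+\<gamma>. action (h 0) \<gamma> 0 1 \<partial>\<pi>) \<noteq> \<infinity>"
      using slope_action_finite[of "h 0"] by simp
  qed (rule slope_action_integral_measurable[OF hm], simp)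
  ultimately show "AE \<gamma> in \<pi>. ennreal \<bar>f (\<gamma> 1) - f (\<gamma> 0)\<bar> \<le> action ?h \<gamma> 0 1"
    using regular_AE AE_space[of \<pi>]
  proof eventually_elim
    case (elim \<gamma>)
    have sl: "slope_action k \<gamma> \<in> borel_measurable borel" if "k \<in> borel_measurable m" for k
      using measurable_compose[OF measurable_Pair1'[OF elim(4)] slope_action_measurable[OF that]] by simp
    have "(\<lambda>n. action (h n) \<gamma> 0 1) \<longlonglongrightarrow> action ?h \<gamma> 0 1"
    proof (rule nn_integral_dominated_convergence)
      show "(\<lambda>r. slope_action (h n) \<gamma> r * indicator {0..1} r) \<in> borel_measurable lborel" for n
        using sl[OF hm] by simp
      show "(\<lambda>r. slope_action ?h \<gamma> r * indicator {0..1} r) \<in> borel_measurable lborel"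
        using sl[OF meas] by simp
      show "(\<lambda>r. slope_action (h 0) \<gamma> r * indicator {0..1} r) \<in> borel_measurable lborel"
        using sl[OF hm] by simp
      show "(\<integral>\<^sup>+r. slope_action (h 0) \<gamma> r * indicator {0..1} r \<partial>lborel) < \<infinity>"
        using elim(2) by (simp add: less_top)
      show "AE r in lborel. slope_action (h n) \<gamma> r * indicator {0..1} r \<le> slope_action (h 0) \<gamma> r * indicator {0..1} r" for n
      proof (intro AE_I2 mult_right_mono)
        fix r
        have "h n (\<gamma> (clamp01 r)) \<le> h 0 (\<gamma> (clamp01 r))"
          using dec[of "\<gamma> (clamp01 r)"] unfolding decseq_def by blast
        then show "slope_action (h n) \<gamma> r \<le> slope_action (h 0) \<gamma> r"
          unfolding slope_action_def by (intro mult_right_mono ennreal_leI) auto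
      qed simp
      have "abs_cont_path \<gamma>" using elim(3) by (simp add: regular_curve_abs_cont)
      from abs_cont_metric_speed[OF this]
      show "AE r in lborel. (\<lambda>n. slope_action (h n) \<gamma> r * indicator {0..1} r) \<longlonglongrightarrow> slope_action ?h \<gamma> r * indicator {0..1} r"
      proof eventually_elim
        case (elim r)
        show ?case
        proof (cases "r \<in> {0..1}")
          case True
          then have "speed \<gamma> r < top" using elim by simp
          then have "(\<lambda>n. speed \<gamma> r * ennreal (h n (\<gamma> (clamp01 r)))) \<longlonglongrightarrow> speed \<gamma> r * ennreal (?h (\<gamma> (clamp01 r)))"
            by (intro ennreal_tendsto_cmult lim)
          then show ?thesis using True by (simp add: slope_action_def mult.commute)
        qed simp
      qed
    qed
    then show ?case
      by (rule LIMSEQ_le_const) (use elim(1) in blast)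
  qed
qed

text \<open>Gives meaning to the choice in \<open>min_weak_upper_gradient\<close>. A weak upper
  gradient of least L2 norm is least almost everywhere as well, because its minimum with any
  competitor is again a weak upper gradient and cannot have smaller norm.\<close>

lemma minimal_wug_exists:
  fixes m :: "'a::polish_space measure"
  assumes sm: "sets m = sets borel" and f: "f \<in> sobolev_class m"
  shows "\<exists>g. weak_upper_gradient m f g \<and> (\<forall>g'. weak_upper_gradient m f g' \<longrightarrow> (AE x in m. g x \<le> g' x))"
proof -
  have fm: "f \<in> borel_measurable m" using f by (simp add: sobolev_class_def)
  define W where "W = {g. weak_upper_gradient m f g}"
  define E where "E g = (\<integral>x. (g x)\<^sup>2 \<partial>m)" for g :: "'a \<Rightarrow> real"
  have W: "W \<noteq> {}" using f by (auto simp: W_def sobolev_class_def)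
  have E0: "0 \<le> E g" for g by (simp add: E_def)
  have bdd: "bdd_below (E ` W)" using E0 by (intro bdd_belowI2[of _ 0])
  define I where "I = (INF g\<in>W. E g)"
  have "\<exists>g\<in>W. E g < I + 1 / real (Suc n)" for n
  proof -
    have "I < I + 1 / real (Suc n)" by simp
    then show ?thesis unfolding I_def using cINF_less_iff[OF W bdd] by blast
  qed
  then obtain g where g: "\<And>n. g n \<in> W" "\<And>n. E (g n) < I + 1 / real (Suc n)" by metis
  \<comment> \<open>The running minima of the minimising sequence decrease, so no weak compactness is needed.\<close>
  define h where "h n x = (MIN i\<in>{..n}. g i x)" for n x
  have hS: "h (Suc n) = (\<lambda>x. min (g (Suc n) x) (h n x))" for n
    unfolding h_def by (simp add: atMost_Suc)
  have hW: "weak_upper_gradient m f (h n)" for n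
  proof (induction n)
    case 0
    have "h 0 = g 0" by (simp add: h_def fun_eq_iff)
    then show ?case using g(1)[of 0] by (simp add: W_def)
  next
    case (Suc n)
    then show ?case unfolding hS using g(1)[of "Suc n"] by (intro wug_min[OF sm fm]) (simp_all add: W_def)
  qed
  have dec: "decseq (\<lambda>n. h n x)" for x by (intro decseq_SucI) (simp add: hS)
  have hg: "h n x \<le> g n x" for n x unfolding h_def by (intro Min_le) auto
  define k where "k x = (INF n. max 0 (h n x))" for x
  have kW: "weak_upper_gradient m f k"
    unfolding k_def[abs_def] by (rule wug_limit[OF sm fm hW dec])
  have k0: "0 \<le> k x" for x unfolding k_def by (intro cINF_greatest) auto
  have kle: "k x \<le> max 0 (h n x)" for n x
    unfolding k_def by (intro cINF_lower bdd_belowI[of _ 0]) auto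
  have "E k \<le> E (g n)" for n
    unfolding E_def
  proof (rule integral_mono_AE)
    show "integrable m (\<lambda>x. (k x)\<^sup>2)" "integrable m (\<lambda>x. (g n x)\<^sup>2)"
      using kW g(1)[of n] by (auto intro: wugD simp: W_def)
    have "AE x in m. 0 \<le> g n x" using g(1)[of n] by (auto intro: wugD simp: W_def)
    then show "AE x in m. (k x)\<^sup>2 \<le> (g n x)\<^sup>2"
    proof eventually_elim
      case (elim x)
      have "k x \<le> g n x" using kle[of x n] hg[of n x] elim by linarith
      then show ?case using k0[of x] by (rule power_mono)
    qed
  qed
  then have "E k \<le> I + 1 / real (Suc n)" for n using g(2)[of n] by (meson less_imp_le order_trans)
  moreover have "(\<lambda>n. I + 1 / real (Suc n)) \<longlonglongrightarrow> I"
    using LIMSEQ_inverse_real_of_nat_add[of I] by (simp add: inverse_eq_divide)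
  ultimately have kI: "E k \<le> I" by (meson LIMSEQ_le_const)
  have "AE x in m. k x \<le> g' x" if g': "weak_upper_gradient m f g'" for g'
  proof -
    let ?j = "\<lambda>x. min (k x) (g' x)"
    have j: "weak_upper_gradient m f ?j" by (rule wug_min[OF sm fm kW g'])
    have "I \<le> E ?j" unfolding I_def using j by (intro cINF_lower bdd) (simp add: W_def)
    then have Ekj: "E k \<le> E ?j" using kI by simp
    have i: "integrable m (\<lambda>x. (k x)\<^sup>2)" "integrable m (\<lambda>x. (?j x)\<^sup>2)"
      by (fact wugD(4)[OF kW], fact wugD(4)[OF j])
    have nn: "AE x in m. 0 \<le> (k x)\<^sup>2 - (?j x)\<^sup>2"
      using wugD(2)[OF j]
    proof eventually_elim
      case (elim x)
      then have "(?j x)\<^sup>2 \<le> (k x)\<^sup>2" by (intro power_mono) auto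
      then show ?case by simp
    qed
    have "(\<integral>x. (k x)\<^sup>2 - (?j x)\<^sup>2 \<partial>m) = E k - E ?j"
      unfolding E_def by (rule Bochner_Integration.integral_diff[OF i])
    moreover have "0 \<le> (\<integral>x. (k x)\<^sup>2 - (?j x)\<^sup>2 \<partial>m)" by (rule integral_nonneg_AE[OF nn])
    ultimately have "(\<integral>x. (k x)\<^sup>2 - (?j x)\<^sup>2 \<partial>m) = 0" using Ekj by simp
    then have "AE x in m. (k x)\<^sup>2 - (?j x)\<^sup>2 = 0"
      using integral_nonneg_eq_0_iff_AE[OF Bochner_Integration.integrable_diff[OF i] nn] by simp
    then show ?thesis using wugD(2)[OF j]
    proof eventually_elim
      case (elim x)
      then have "(k x)\<^sup>2 = (?j x)\<^sup>2" by simp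
      then have "k x = ?j x" using k0[of x] elim(2) by (rule power2_eq_imp_eq)
      then show ?case by linarith
    qed
  qed
  then show ?thesis using kW by blast
qed

lemma min_wug:
  fixes m :: "'a::polish_space measure"
  assumes sm: "sets m = sets borel" and f: "f \<in> sobolev_class m"
  shows "weak_upper_gradient m f (min_weak_upper_gradient m f)"
    and "weak_upper_gradient m f g' \<Longrightarrow> AE x in m. min_weak_upper_gradient m f x \<le> g' x"
  using someI_ex[OF minimal_wug_exists[OF assms]] unfolding min_weak_upper_gradient_def[symmetric] by blast+

lemma cheeger_le:
  fixes m :: "'a::polish_space measure"
  assumes sm: "sets m = sets borel" and f: "f \<in> L2 m" and g: "weak_upper_gradient m f g"
  shows "cheeger m f \<le> ereal (1/2 * (\<integral>x. (g x)\<^sup>2 \<partial>m))"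
proof -
  have fS: "f \<in> sobolev_class m" using f g by (auto simp: sobolev_class_def L2_def)
  note M = min_wug[OF sm fS]
  have "(\<integral>x. (min_weak_upper_gradient m f x)\<^sup>2 \<partial>m) \<le> (\<integral>x. (g x)\<^sup>2 \<partial>m)"
  proof (rule integral_mono_AE)
    show "AE x in m. (min_weak_upper_gradient m f x)\<^sup>2 \<le> (g x)\<^sup>2"
      using M(2)[OF g] wugD(2)[OF M(1)] by eventually_elim (rule power_mono)
  qed (use M(1) g in \<open>auto intro: wugD\<close>)
  then show ?thesis using fS f by (simp add: cheeger_def W12_def)
qed

lemma wug_contraction:
  assumes "weak_upper_gradient m f g" "\<And>a b. \<bar>\<phi> a - \<phi> b\<bar> \<le> \<bar>a - b\<bar>"
  shows "weak_upper_gradient m (\<lambda>x. \<phi> (f x)) g"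
  unfolding weak_upper_gradient_def
proof (intro conjI allI impI)
  fix \<pi> assume \<pi>: "test_plan m \<pi>"
  have "(\<integral>\<^sup>+\<gamma>. ennreal \<bar>\<phi> (f (\<gamma> 1)) - \<phi> (f (\<gamma> 0))\<bar> \<partial>\<pi>) \<le> (\<integral>\<^sup>+\<gamma>. ennreal \<bar>f (\<gamma> 1) - f (\<gamma> 0)\<bar> \<partial>\<pi>)"
    by (intro nn_integral_mono ennreal_leI assms(2))
  also have "\<dots> \<le> (\<integral>\<^sup>+\<gamma>. (\<integral>\<^sup>+t\<in>{0..1}. ennreal (g (\<gamma> t) * metric_speed \<gamma> t) \<partial>lborel) \<partial>\<pi>)"
    using assms(1) \<pi> unfolding weak_upper_gradient_def by blast
  finally show "(\<integral>\<^sup>+\<gamma>. ennreal \<bar>\<phi> (f (\<gamma> 1)) - \<phi> (f (\<gamma> 0))\<bar> \<partial>\<pi>)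
    \<le> (\<integral>\<^sup>+\<gamma>. (\<integral>\<^sup>+t\<in>{0..1}. ennreal (g (\<gamma> t) * metric_speed \<gamma> t) \<partial>lborel) \<partial>\<pi>)" .
qed (use assms(1) in \<open>auto simp: weak_upper_gradient_def\<close>)

subsection \<open>The Leibniz bound\<close>

text \<open>The two bounds on \<open>\<phi>\<close> have different tasks. \<open>lip\<close> makes
  the product of \<open>\<phi>\<close> and the lift absolutely continuous; \<open>slope\<close>
  bounds its derivative, since the exponential factor tends to 1 as y approaches x and leaves
  \<open>l x\<close> as a local Lipschitz constant. The exponential factor is tailored to weights of
  the form exp (\<alpha> w).\<close>

lemma leibniz_curve:
  fixes \<gamma> :: "real \<Rightarrow> 'a::polish_space" and \<phi> l :: "'a \<Rightarrow> real"
  assumes L: "ac_lift f g \<gamma> k F" and ac: "abs_cont_path \<gamma>"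
    and gpos: "AE r in lborel. r \<in> {0..1} \<longrightarrow> 0 \<le> g (\<gamma> r)"
    and \<phi>: "\<And>x. 0 \<le> \<phi> x" "\<And>x. \<phi> x \<le> M" and l: "\<And>x. 0 \<le> l x"
    and slope: "\<And>x y. \<bar>\<phi> y - \<phi> x\<bar> \<le> l x * exp (\<beta> * dist y x) * dist y x"
    and lip: "\<And>x y. \<bar>\<phi> y - \<phi> x\<bar> \<le> C * dist y x"
  shows "ennreal \<bar>\<phi> (\<gamma> 1) * f (\<gamma> 1) - \<phi> (\<gamma> 0) * f (\<gamma> 0)\<bar>
    \<le> action (\<lambda>x. \<phi> x * g x + l x * \<bar>f x\<bar>) \<gamma> 0 1"
proof -
  let ?\<eta> = "\<lambda>t. \<gamma> (clamp01 t)"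
  obtain v where v: "integrable lborel v" "\<And>x. 0 \<le> v x"
    "\<And>s t. s \<le> t \<Longrightarrow> dist (\<gamma> (clamp01 s)) (\<gamma> (clamp01 t)) \<le> primitive v t - primitive v s"
    "AE t in lborel. ((\<lambda>s. dist (\<gamma> (clamp01 s)) (\<gamma> (clamp01 t)) / \<bar>s - t\<bar>) \<longlongrightarrow> v t) (at t)"
    "AE t in lborel. speed \<gamma> t = ennreal (v t)"
    by (rule abs_cont_curve_speed[OF ac]; (rule that)?; assumption)
  have k: "integrable lborel k" "\<And>x. 0 \<le> k x"
    and kae: "AE r in lborel. r \<in> {0..1} \<longrightarrow> ennreal (k r) = slope_action g \<gamma> r"
    and Fle: "\<And>s t. \<bar>F s - F t\<bar> \<le> \<bar>primitive k s - primitive k t\<bar>"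
    and Fae: "AE r in lborel. r \<in> {0..1} \<longrightarrow> F r = f (\<gamma> r)"
    using L unfolding ac_lift_def by blast+
  define B where "B = \<bar>F 0\<bar> + (LINT x|lborel. k x)"
  have FB: "\<bar>F t\<bar> \<le> B" for t
    using Fle[of t 0] primitive_bounds[OF k, of t] primitive_bounds[OF k, of 0] by (simp add: B_def)
  have M0: "0 \<le> M" using \<phi>(1) \<phi>(2) order_trans by blast
  have B0: "0 \<le> B" using FB[of 0] by linarith
  define P where "P r = \<phi> (?\<eta> r) * F r" for r
  define k' where "k' x = M * k x + (B * \<bar>C\<bar>) * v x" for x
  have k'int: "integrable lborel k'" unfolding k'_def using k v by auto
  have k'0: "0 \<le> k' x" for x unfolding k'_def using M0 B0 k v by simp
  have lip': "\<bar>\<phi> y - \<phi> x\<bar> \<le> \<bar>C\<bar> * dist y x" for x y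
    using lip[of y x] by (meson abs_ge_self mult_right_mono order_trans zero_le_dist)
  have P_AC: "\<bar>P t - P s\<bar> \<le> primitive k' t - primitive k' s" if "s \<le> t" for s t
  proof -
    have "P t - P s = \<phi> (?\<eta> t) * (F t - F s) + F s * (\<phi> (?\<eta> t) - \<phi> (?\<eta> s))"
      unfolding P_def by (simp add: algebra_simps)
    then have "\<bar>P t - P s\<bar> \<le> \<bar>\<phi> (?\<eta> t)\<bar> * \<bar>F t - F s\<bar> + \<bar>F s\<bar> * \<bar>\<phi> (?\<eta> t) - \<phi> (?\<eta> s)\<bar>"
      by (metis abs_mult abs_triangle_ineq)
    also have "\<dots> \<le> M * (primitive k t - primitive k s) + B * (\<bar>C\<bar> * (primitive v t - primitive v s))"
    proof (intro add_mono mult_mono)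
      show "\<bar>\<phi> (?\<eta> t)\<bar> \<le> M" using \<phi>[of "?\<eta> t"] by simp
      show "\<bar>F t - F s\<bar> \<le> primitive k t - primitive k s" by (rule ac_lift_abs[OF L that])
      have "\<bar>\<phi> (?\<eta> t) - \<phi> (?\<eta> s)\<bar> \<le> \<bar>C\<bar> * dist (?\<eta> s) (?\<eta> t)" using lip'[of "?\<eta> t" "?\<eta> s"] by (simp add: dist_commute)
      also have "\<dots> \<le> \<bar>C\<bar> * (primitive v t - primitive v s)" by (intro mult_left_mono v that) simp
      finally show "\<bar>\<phi> (?\<eta> t) - \<phi> (?\<eta> s)\<bar> \<le> \<bar>C\<bar> * (primitive v t - primitive v s)" .
    qed (use FB M0 B0 in auto)
    also have "\<dots> = primitive k' t - primitive k' s"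
      unfolding k'_def primitive_lincomb[OF k(1) v(1)] by (simp add: algebra_simps)
    finally show ?thesis .
  qed
  have "ennreal \<bar>P 1 - P 0\<bar> \<le> action (\<lambda>x. \<phi> x * g x + l x * \<bar>f x\<bar>) \<gamma> 0 1"
  proof (rule derivative_bound_imp_increment_bound[OF k'int k'0 P_AC])
    show "AE r in lborel. r \<in> {0<..<1} \<longrightarrow> (\<forall>u. (P has_real_derivative u) (at r) \<longrightarrow>
        ennreal \<bar>u\<bar> \<le> slope_action (\<lambda>x. \<phi> x * g x + l x * \<bar>f x\<bar>) \<gamma> r)"
      using kae Fae v(4,5) gpos primitive_has_derivative_AE[OF k(1)]
    proof (eventually_elim, intro impI allI)
      fix r u
      assume a: "r \<in> {0..1} \<longrightarrow> ennreal (k r) = slope_action g \<gamma> r" "r \<in> {0..1} \<longrightarrow> F r = f (\<gamma> r)"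
        "((\<lambda>s. dist (?\<eta> s) (?\<eta> r) / \<bar>s - r\<bar>) \<longlongrightarrow> v r) (at r)" "speed \<gamma> r = ennreal (v r)"
        "r \<in> {0..1} \<longrightarrow> 0 \<le> g (\<gamma> r)" "(primitive k has_real_derivative k r) (at r)"
        and r: "r \<in> {0<..<1}" and u: "(P has_real_derivative u) (at r)"
      have r': "r \<in> {0..1}" "clamp01 r = r" using r by (auto simp: clamp01_id)
      let ?\<delta> = "\<lambda>s. dist (?\<eta> s) (?\<eta> r)"
      have \<delta>0: "(?\<delta> \<longlongrightarrow> 0) (at r)"
      proof -
        have "\<bar>?\<delta> s - ?\<delta> r\<bar> \<le> \<bar>primitive v s - primitive v r\<bar>" for s
          using v(3)[of s r] v(3)[of r s] by (cases "s \<le> r") (auto simp: dist_commute)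
        then have "isCont ?\<delta> r" by (rule isCont_if_primitive_bound[OF v(1)])
        then show ?thesis by (simp add: isCont_def)
      qed
      have \<phi>lim: "((\<lambda>s. \<phi> (?\<eta> s)) \<longlongrightarrow> \<phi> (?\<eta> r)) (at r)"
      proof (rule LIM_zero_cancel, rule Lim_null_comparison[OF always_eventually])
        show "\<forall>s. norm (\<phi> (?\<eta> s) - \<phi> (?\<eta> r)) \<le> \<bar>C\<bar> * ?\<delta> s" using lip' by simp
        show "((\<lambda>s. \<bar>C\<bar> * ?\<delta> s) \<longlongrightarrow> 0) (at r)" using tendsto_mult_left[OF \<delta>0, of "\<bar>C\<bar>"] by simp
      qed
      have klim: "((\<lambda>s. \<bar>(primitive k s - primitive k r) / (s - r)\<bar>) \<longlongrightarrow> \<bar>k r\<bar>) (at r)"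
        using a(6) by (intro tendsto_rabs) (simp add: has_field_derivative_iff)
      have elim: "((\<lambda>s. exp (\<beta> * ?\<delta> s)) \<longlongrightarrow> exp (\<beta> * 0)) (at r)"
        by (intro tendsto_exp tendsto_mult_left \<delta>0)
      have rhs: "((\<lambda>s. \<phi> (?\<eta> s) * \<bar>(primitive k s - primitive k r) / (s - r)\<bar> + \<bar>F r\<bar> * l (?\<eta> r) * exp (\<beta> * ?\<delta> s) * (?\<delta> s / \<bar>s - r\<bar>))
          \<longlongrightarrow> \<phi> (?\<eta> r) * \<bar>k r\<bar> + \<bar>F r\<bar> * l (?\<eta> r) * exp (\<beta> * 0) * v r) (at r)"
        by (rule tendsto_add[OF tendsto_mult[OF \<phi>lim klim] tendsto_mult[OF tendsto_mult_left[OF elim] a(3)]])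
      have lhs: "((\<lambda>s. \<bar>(P s - P r) / (s - r)\<bar>) \<longlongrightarrow> \<bar>u\<bar>) (at r)"
        using u by (intro tendsto_rabs) (simp add: has_field_derivative_iff)
      have "\<bar>u\<bar> \<le> \<phi> (?\<eta> r) * \<bar>k r\<bar> + \<bar>F r\<bar> * l (?\<eta> r) * exp (\<beta> * 0) * v r"
      proof (rule tendsto_le[OF _ rhs lhs])
        show "\<forall>\<^sub>F s in at r. \<bar>(P s - P r) / (s - r)\<bar> \<le> \<phi> (?\<eta> s) * \<bar>(primitive k s - primitive k r) / (s - r)\<bar> + \<bar>F r\<bar> * l (?\<eta> r) * exp (\<beta> * ?\<delta> s) * (?\<delta> s / \<bar>s - r\<bar>)"
        proof (rule always_eventually, rule allI)
          fix s
          have "P s - P r = \<phi> (?\<eta> s) * (F s - F r) + F r * (\<phi> (?\<eta> s) - \<phi> (?\<eta> r))"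
            unfolding P_def by (simp add: algebra_simps)
          then have "\<bar>P s - P r\<bar> \<le> \<bar>\<phi> (?\<eta> s)\<bar> * \<bar>F s - F r\<bar> + \<bar>F r\<bar> * \<bar>\<phi> (?\<eta> s) - \<phi> (?\<eta> r)\<bar>"
            by (metis abs_mult abs_triangle_ineq)
          also have "\<dots> \<le> \<phi> (?\<eta> s) * \<bar>primitive k s - primitive k r\<bar> + \<bar>F r\<bar> * (l (?\<eta> r) * exp (\<beta> * ?\<delta> s) * ?\<delta> s)"
            using Fle[of s r] slope[of "?\<eta> s" "?\<eta> r"] \<phi>(1)[of "?\<eta> s"] by (intro add_mono mult_mono) auto
          finally have "\<bar>P s - P r\<bar> / \<bar>s - r\<bar> \<le> (\<phi> (?\<eta> s) * \<bar>primitive k s - primitive k r\<bar> + \<bar>F r\<bar> * (l (?\<eta> r) * exp (\<beta> * ?\<delta> s) * ?\<delta> s)) / \<bar>s - r\<bar>"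
            by (rule divide_right_mono) simp
          then show "\<bar>(P s - P r) / (s - r)\<bar> \<le> \<phi> (?\<eta> s) * \<bar>(primitive k s - primitive k r) / (s - r)\<bar> + \<bar>F r\<bar> * l (?\<eta> r) * exp (\<beta> * ?\<delta> s) * (?\<delta> s / \<bar>s - r\<bar>)"
            by (simp add: add_divide_distrib mult.assoc)
        qed
      qed simp
      then have "\<bar>u\<bar> \<le> \<phi> (\<gamma> r) * k r + \<bar>f (\<gamma> r)\<bar> * l (\<gamma> r) * v r"
        using r' a(2) k(2)[of r] by simp
      \<comment> \<open>Both sides are nonnegative reals at this r, so the identity of extended
        reals descends to them.\<close>
      also have "k r = g (\<gamma> r) * v r"
      proof -
        have "ennreal (k r) = ennreal (g (\<gamma> r) * v r)"
          using a(1,4,5) r' v(2)[of r] by (simp add: slope_action_def ennreal_mult)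
        then show ?thesis using k(2)[of r] v(2)[of r] a(5) r' by simp
      qed
      also have "\<phi> (\<gamma> r) * (g (\<gamma> r) * v r) + \<bar>f (\<gamma> r)\<bar> * l (\<gamma> r) * v r
        = (\<phi> (\<gamma> r) * g (\<gamma> r) + l (\<gamma> r) * \<bar>f (\<gamma> r)\<bar>) * v r" by (simp add: algebra_simps)
      finally have "ennreal \<bar>u\<bar> \<le> ennreal ((\<phi> (\<gamma> r) * g (\<gamma> r) + l (\<gamma> r) * \<bar>f (\<gamma> r)\<bar>) * v r)"
        by (rule ennreal_leI)
      also have "\<dots> = slope_action (\<lambda>x. \<phi> x * g x + l x * \<bar>f x\<bar>) \<gamma> r"
        using r' a(4) v(2)[of r] by (simp add: slope_action_def ennreal_mult'')
      finally show "ennreal \<bar>u\<bar> \<le> slope_action (\<lambda>x. \<phi> x * g x + l x * \<bar>f x\<bar>) \<gamma> r" .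
    qed
  qed
  then show ?thesis
    using ac_lift_endpoints[OF L] by (simp add: P_def)
qed

lemma wug_leibniz:
  fixes m :: "'a::polish_space measure" and \<phi> l :: "'a \<Rightarrow> real"
  assumes sm: "sets m = sets borel" and f: "f \<in> L2 m" and wug: "weak_upper_gradient m f g"
    and \<phi>m: "\<phi> \<in> borel_measurable m" and lm: "l \<in> borel_measurable m"
    and \<phi>: "\<And>x. 0 \<le> \<phi> x" "\<And>x. \<phi> x \<le> M" and l: "\<And>x. 0 \<le> l x" "\<And>x. l x \<le> N"
    and slope: "\<And>x y. \<bar>\<phi> y - \<phi> x\<bar> \<le> l x * exp (\<beta> * dist y x) * dist y x"
    and lip: "\<And>x y. \<bar>\<phi> y - \<phi> x\<bar> \<le> C * dist y x"
  shows "weak_upper_gradient m (\<lambda>x. \<phi> x * f x) (\<lambda>x. \<phi> x * g x + l x * \<bar>f x\<bar>)"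
proof (rule wugI[OF sm])
  have g: "g \<in> L2 m" "AE x in m. 0 \<le> g x" using wugD[OF wug] by auto
  have fm: "f \<in> borel_measurable m" using f by (simp add: L2_def)
  have "(\<lambda>x. \<bar>f x\<bar>) \<in> L2 m" using f by (simp add: L2_def borel_measurable_abs)
  then show "(\<lambda>x. \<phi> x * g x + l x * \<bar>f x\<bar>) \<in> L2 m"
    using \<phi> l by (intro L2_add L2_mult_bounded[where M=M] L2_mult_bounded[where M=N] g \<phi>m lm) auto
  show "AE x in m. 0 \<le> \<phi> x * g x + l x * \<bar>f x\<bar>"
    using g(2) by eventually_elim (simp add: \<phi> l)
  fix \<pi> assume "plan m \<pi>"
  then interpret plan m \<pi> .
  show "AE \<gamma> in \<pi>. ennreal \<bar>\<phi> (\<gamma> 1) * f (\<gamma> 1) - \<phi> (\<gamma> 0) * f (\<gamma> 0)\<bar>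
    \<le> action (\<lambda>x. \<phi> x * g x + l x * \<bar>f x\<bar>) \<gamma> 0 1"
    using ac_lift_AE[OF wug fm] regular_AE AE_eval_AE[OF g(2)]
  proof eventually_elim
    case (elim \<gamma>)
    then obtain k F where L: "ac_lift f g \<gamma> k F" by blast
    show ?case
      by (rule leibniz_curve[OF L _ elim(3) \<phi> l(1) slope lip]) (use elim(2) regular_curve_abs_cont in blast)
  qed
qed

subsection \<open>Energies along the heat flow\<close>

text \<open>Two instances are used: \<open>Q v = v\<^sup>2\<close> with an exponential weight for
  the Gaussian estimate, and the square of the negative part with weight 1 for the sign of the flow.
  \<open>Q_taylor\<close> makes \<open>Q'\<close> the derivative of \<open>Q\<close> with a uniform
  quadratic remainder, which can be integrated against the bounded weight.\<close>

locale weighted_energy =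
  fixes m :: "'a::polish_space measure" and \<psi> :: "'a \<Rightarrow> real" and M :: real and Q Q' :: "real \<Rightarrow> real"
  assumes \<psi>_meas: "\<psi> \<in> borel_measurable m" and \<psi>: "\<And>x. 0 \<le> \<psi> x" "\<And>x. \<psi> x \<le> M"
    and Q_meas: "Q \<in> borel_measurable borel" and Q'_meas: "Q' \<in> borel_measurable borel"
    and Q_taylor: "\<And>a b. \<bar>Q b - Q a - Q' a * (b - a)\<bar> \<le> (b - a)\<^sup>2"
    and Q'_bound: "\<And>a. \<bar>Q' a\<bar> \<le> 2 * \<bar>a\<bar>" and Q_bound: "\<And>a. \<bar>Q a\<bar> \<le> a\<^sup>2"
begin

definition energy :: "('a \<Rightarrow> real) \<Rightarrow> real" where "energy v = (\<integral>x. \<psi> x * Q (v x) \<partial>m)"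

lemma M_nonneg: "0 \<le> M" using \<psi> order_trans by blast

lemma energy_integrable:
  assumes "v \<in> L2 m"
  shows "integrable m (\<lambda>x. \<psi> x * Q (v x))"
proof -
  have vm: "v \<in> borel_measurable m" and i: "integrable m (\<lambda>x. M * (v x)\<^sup>2)" using assms by (auto simp: L2_def)
  show ?thesis
  proof (rule Bochner_Integration.integrable_bound[OF i])
    show "(\<lambda>x. \<psi> x * Q (v x)) \<in> borel_measurable m"
      by (intro borel_measurable_times \<psi>_meas measurable_compose[OF vm Q_meas])
    have "\<bar>\<psi> x\<bar> * \<bar>Q (v x)\<bar> \<le> M * (v x)\<^sup>2" for x
      using \<psi>[of x] Q_bound[of "v x"] M_nonneg by (intro mult_mono) auto
    then show "AE x in m. norm (\<psi> x * Q (v x)) \<le> norm (M * (v x)\<^sup>2)"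
      using M_nonneg by (intro AE_I2) (simp add: abs_mult)
  qed
qed

lemma gradient_L2:
  assumes "v \<in> L2 m"
  shows "(\<lambda>x. \<psi> x * Q' (v x)) \<in> L2 m"
proof (rule L2_bound[OF assms])
  have vm: "v \<in> borel_measurable m" using assms by (auto simp: L2_def)
  show "(\<lambda>x. \<psi> x * Q' (v x)) \<in> borel_measurable m"
    by (intro borel_measurable_times \<psi>_meas measurable_compose[OF vm Q'_meas])
  fix x
  have "\<bar>\<psi> x\<bar> * \<bar>Q' (v x)\<bar> \<le> M * (2 * \<bar>v x\<bar>)"
    using \<psi>[of x] Q'_bound[of "v x"] M_nonneg by (intro mult_mono) auto
  then show "\<bar>\<psi> x * Q' (v x)\<bar> \<le> (2 * M) * \<bar>v x\<bar>" by (simp add: abs_mult)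
qed

lemma gradient_bound:
  assumes v: "v \<in> L2 m" and g: "g \<in> L2 m"
  shows "\<bar>\<integral>x. \<psi> x * Q' (v x) * g x \<partial>m\<bar> \<le> 2 * M * l2norm m v * l2norm m g"
proof -
  have "\<bar>\<integral>x. \<psi> x * Q' (v x) * g x \<partial>m\<bar> \<le> l2norm m (\<lambda>x. \<psi> x * Q' (v x)) * l2norm m g"
    by (rule L2_Cauchy_Schwarz[OF gradient_L2[OF v] g])
  also have "l2norm m (\<lambda>x. \<psi> x * Q' (v x)) \<le> l2norm m (\<lambda>x. (2 * M) * v x)"
    unfolding l2norm_def
  proof (rule real_sqrt_le_mono, rule integral_mono)
    show "integrable m (\<lambda>x. (\<psi> x * Q' (v x))\<^sup>2)" using gradient_L2[OF v] by (simp add: L2_def)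
    show "integrable m (\<lambda>x. (2 * M * v x)\<^sup>2)" using L2_cmult[OF v, of "2 * M"] by (simp add: L2_def)
    fix x
    have "\<bar>\<psi> x\<bar> * \<bar>Q' (v x)\<bar> \<le> M * (2 * \<bar>v x\<bar>)"
      using \<psi>[of x] Q'_bound[of "v x"] M_nonneg by (intro mult_mono) auto
    then have "\<bar>\<psi> x * Q' (v x)\<bar> \<le> \<bar>2 * M * v x\<bar>" using M_nonneg by (simp add: abs_mult)
    then show "(\<psi> x * Q' (v x))\<^sup>2 \<le> (2 * M * v x)\<^sup>2" by (simp only: abs_le_square_iff)
  qed
  also have "\<dots> = 2 * M * l2norm m v" using M_nonneg by (subst l2norm_cmult) simp
  finally show ?thesis by (simp add: mult_right_mono)
qed

lemma energy_taylor:
  assumes v: "v \<in> L2 m" and w: "w \<in> L2 m"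
  shows "\<bar>energy w - energy v - (\<integral>x. \<psi> x * Q' (v x) * (w x - v x) \<partial>m)\<bar> \<le> M * (l2norm m (\<lambda>x. w x - v x))\<^sup>2"
proof -
  note d = L2_diff[OF w v]
  note i = energy_integrable[OF w] energy_integrable[OF v] L2_mult_integrable[OF gradient_L2[OF v] d]
  define e where "e x = \<psi> x * Q (w x) - \<psi> x * Q (v x) - \<psi> x * Q' (v x) * (w x - v x)" for x
  have ie: "integrable m e"
    unfolding e_def[abs_def]
    by (rule Bochner_Integration.integrable_diff[OF Bochner_Integration.integrable_diff[OF i(1,2)] i(3)])
  have id: "integrable m (\<lambda>x. M * (w x - v x)\<^sup>2)" using d by (simp add: L2_def)
  have eb: "\<bar>e x\<bar> \<le> M * (w x - v x)\<^sup>2" for x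
  proof -
    have "e x = \<psi> x * (Q (w x) - Q (v x) - Q' (v x) * (w x - v x))" by (simp add: e_def algebra_simps)
    then have "\<bar>e x\<bar> = \<psi> x * \<bar>Q (w x) - Q (v x) - Q' (v x) * (w x - v x)\<bar>" using \<psi>(1)[of x] by (simp add: abs_mult)
    also have "\<dots> \<le> M * (w x - v x)\<^sup>2" by (rule mult_mono[OF \<psi>(2) Q_taylor M_nonneg]) simp
    finally show ?thesis .
  qed
  have "energy w - energy v - (\<integral>x. \<psi> x * Q' (v x) * (w x - v x) \<partial>m) = (\<integral>x. e x \<partial>m)"
    unfolding energy_def e_def
    by (simp only: Bochner_Integration.integral_diff[OF Bochner_Integration.integrable_diff[OF i(1,2)] i(3)]
        Bochner_Integration.integral_diff[OF i(1,2)])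
  also have "\<bar>\<dots>\<bar> \<le> (\<integral>x. \<bar>e x\<bar> \<partial>m)" by (rule integral_abs_bound)
  also have "\<dots> \<le> (\<integral>x. M * (w x - v x)\<^sup>2 \<partial>m)" by (rule integral_mono[OF integrable_abs[OF ie] id eb])
  also have "\<dots> = M * (l2norm m (\<lambda>x. w x - v x))\<^sup>2" by (simp add: l2norm_square)
  finally show ?thesis .
qed

lemma energy_increment:
  assumes v: "v \<in> L2 m" and w: "w \<in> L2 m"
  shows "\<bar>energy w - energy v\<bar> \<le> 2 * M * l2norm m v * l2norm m (\<lambda>x. w x - v x) + M * (l2norm m (\<lambda>x. w x - v x))\<^sup>2"
  using energy_taylor[OF v w] gradient_bound[OF v L2_diff[OF w v]] by linarith

text \<open>The error has two parts: the L2 distance of the difference quotient from l/2, paired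
  with the gradient of the energy, and the quadratic Taylor remainder divided by h, which is of
  order |h| because the difference quotients stay bounded in L2 near 0.\<close>

lemma energy_has_derivative:
  assumes u: "\<And>s. 0 \<le> s \<Longrightarrow> u s \<in> L2 m" and t: "0 < t" and l: "l \<in> L2 m"
    and lim: "((\<lambda>h. l2norm m (\<lambda>x. (u (t + h) x - u t x) / h - 1/2 * l x)) \<longlongrightarrow> 0) (at 0)"
  shows "((\<lambda>s. energy (u s)) has_real_derivative (1/2 * (\<integral>x. \<psi> x * Q' (u t x) * l x \<partial>m))) (at t)"
proof -
  let ?r = "\<lambda>h. l2norm m (\<lambda>x. (u (t + h) x - u t x) / h - 1/2 * l x)"
  let ?D = "1/2 * (\<integral>x. \<psi> x * Q' (u t x) * l x \<partial>m)"
  have ut: "u t \<in> L2 m" using u t by simp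
  have bound: "\<bar>(energy (u (t + h)) - energy (u t)) / h - ?D\<bar>
      \<le> 2 * M * l2norm m (u t) * ?r h + M * \<bar>h\<bar> * (?r h + 1/2 * l2norm m l)\<^sup>2" if h: "h \<noteq> 0" "\<bar>h\<bar> < t" for h
  proof -
    have uth: "u (t + h) \<in> L2 m" using h by (intro u) linarith
    note d = L2_diff[OF uth ut]
    have half: "(\<lambda>x. 1/2 * l x) \<in> L2 m" by (rule L2_cmult[OF l])
    have q: "(\<lambda>x. (u (t + h) x - u t x) / h) \<in> L2 m" using L2_cmult[OF d, of "1 / h"] by simp
    note e = L2_diff[OF q half]
    define I where "I = (\<integral>x. \<psi> x * Q' (u t x) * (u (t + h) x - u t x) \<partial>m)"
    have "I / h - ?D = (\<integral>x. \<psi> x * Q' (u t x) * ((u (t + h) x - u t x) / h) \<partial>m) - (\<integral>x. \<psi> x * Q' (u t x) * (1/2 * l x) \<partial>m)"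
      unfolding I_def by (simp add: algebra_simps)
    also have "\<dots> = (\<integral>x. \<psi> x * Q' (u t x) * ((u (t + h) x - u t x) / h) - \<psi> x * Q' (u t x) * (1/2 * l x) \<partial>m)"
      by (rule Bochner_Integration.integral_diff[symmetric, OF L2_mult_integrable[OF gradient_L2[OF ut] q] L2_mult_integrable[OF gradient_L2[OF ut] half]])
    also have "\<dots> = (\<integral>x. \<psi> x * Q' (u t x) * ((u (t + h) x - u t x) / h - 1/2 * l x) \<partial>m)"
      by (simp only: right_diff_distrib)
    finally have 1: "\<bar>I / h - ?D\<bar> \<le> 2 * M * l2norm m (u t) * ?r h"
      using gradient_bound[OF ut e] by simp
    have "l2norm m (\<lambda>x. u (t + h) x - u t x) = l2norm m (\<lambda>x. h * ((u (t + h) x - u t x) / h))"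
      using h by simp
    also have "\<dots> = \<bar>h\<bar> * l2norm m (\<lambda>x. (u (t + h) x - u t x) / h)" by (rule l2norm_cmult)
    also have "l2norm m (\<lambda>x. (u (t + h) x - u t x) / h) \<le> ?r h + l2norm m (\<lambda>x. 1/2 * l x)"
      using l2norm_triangle[OF e half] by simp
    also have "l2norm m (\<lambda>x. 1/2 * l x) = 1/2 * l2norm m l" by (subst l2norm_cmult) simp
    finally have "l2norm m (\<lambda>x. u (t + h) x - u t x) \<le> \<bar>h\<bar> * (?r h + 1/2 * l2norm m l)"
      by (simp add: mult_left_mono)
    then have "(l2norm m (\<lambda>x. u (t + h) x - u t x))\<^sup>2 \<le> (\<bar>h\<bar> * (?r h + 1/2 * l2norm m l))\<^sup>2"
      by (rule power_mono) simp
    then have "M * (l2norm m (\<lambda>x. u (t + h) x - u t x))\<^sup>2 \<le> M * (\<bar>h\<bar> * (?r h + 1/2 * l2norm m l))\<^sup>2"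
      using M_nonneg by (rule mult_left_mono)
    then have "\<bar>energy (u (t + h)) - energy (u t) - I\<bar> \<le> M * (\<bar>h\<bar> * (?r h + 1/2 * l2norm m l))\<^sup>2"
      using energy_taylor[OF ut uth] unfolding I_def by linarith
    then have "\<bar>energy (u (t + h)) - energy (u t) - I\<bar> / \<bar>h\<bar> \<le> M * (\<bar>h\<bar> * (?r h + 1/2 * l2norm m l))\<^sup>2 / \<bar>h\<bar>"
      by (rule divide_right_mono) simp
    also have "\<dots> = M * \<bar>h\<bar> * (?r h + 1/2 * l2norm m l)\<^sup>2"
      using h by (simp add: power_mult_distrib power2_eq_square)
    finally have 2: "\<bar>(energy (u (t + h)) - energy (u t) - I) / h\<bar> \<le> M * \<bar>h\<bar> * (?r h + 1/2 * l2norm m l)\<^sup>2"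
      by simp
    have "(energy (u (t + h)) - energy (u t)) / h - ?D = (energy (u (t + h)) - energy (u t) - I) / h + (I / h - ?D)"
      by (simp add: diff_divide_distrib)
    then show ?thesis using 1 2 by linarith
  qed
  have "((\<lambda>h. 2 * M * l2norm m (u t) * ?r h + M * \<bar>h\<bar> * (?r h + 1/2 * l2norm m l)\<^sup>2)
    \<longlongrightarrow> 2 * M * l2norm m (u t) * 0 + M * \<bar>0\<bar> * (0 + 1/2 * l2norm m l)\<^sup>2) (at 0)"
    by (intro tendsto_intros lim)
  then have z: "((\<lambda>h. 2 * M * l2norm m (u t) * ?r h + M * \<bar>h\<bar> * (?r h + 1/2 * l2norm m l)\<^sup>2) \<longlongrightarrow> 0) (at 0)" by simp
  have "((\<lambda>h. (energy (u (t + h)) - energy (u t)) / h - ?D) \<longlongrightarrow> 0) (at 0)"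
  proof (rule Lim_null_comparison[OF _ z])
    have "\<forall>\<^sub>F h in at (0::real). h \<noteq> 0 \<and> \<bar>h\<bar> < t"
      unfolding eventually_at using t by (intro exI[of _ t]) (auto simp: dist_real_def)
    then show "\<forall>\<^sub>F h in at 0. norm ((energy (u (t + h)) - energy (u t)) / h - ?D)
      \<le> 2 * M * l2norm m (u t) * ?r h + M * \<bar>h\<bar> * (?r h + 1/2 * l2norm m l)\<^sup>2"
      by eventually_elim (simp only: real_norm_def, rule bound, simp_all)
  qed
  then show ?thesis unfolding DERIV_def by (rule LIM_zero_cancel)
qed

end

section \<open>Differential inequalities for energies along the flow\<close>

lemma has_laplacian_L2:
  assumes "has_laplacian m f l"
  shows "f \<in> L2 m" "l \<in> L2 m" "f \<in> W12 m"
proof -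
  obtain h where h: "h \<in> L2 m" "l = (\<lambda>x. - h x)" "f \<in> W12 m"
    using assms unfolding has_laplacian_def cheeger_subdifferential_def by auto
  show "f \<in> L2 m" "f \<in> W12 m" using h(3) by (auto simp: W12_def)
  show "l \<in> L2 m" using L2_cmult[OF h(1), of "-1"] h(2) by simp
qed

text \<open>Gronwall applies on \<open>{a..b}\<close> with a > 0, where the trajectory is absolutely
  continuous; then a tends to 0, by continuity of the trajectory in L2. The left side of
  \<open>diss\<close> is the derivative of the energy along the flow, its 1/2 being that of the flow
  equation.\<close>

lemma (in weighted_energy) gradient_flow_energy:
  fixes T :: "real \<Rightarrow> ('a \<Rightarrow> real) \<Rightarrow> ('a \<Rightarrow> real)"
  assumes T: "heat_semigroup m T" and f: "f \<in> L2 m" and c: "0 \<le> c"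
    and diss: "\<And>v l. has_laplacian m v l \<Longrightarrow> 1/2 * (\<integral>x. \<psi> x * Q' (v x) * l x \<partial>m) \<le> c * energy v"
    and b: "0 < b"
  shows "energy (T b f) \<le> exp (c * b) * energy f"
proof -
  let ?u = "\<lambda>s. T s f"
  note hs = T[unfolded heat_semigroup_def]
  note flow = bspec[OF hs[THEN conjunct2, THEN conjunct2, THEN conjunct2, THEN conjunct2] f]
  have u: "?u s \<in> L2 m" if "0 \<le> s" for s using hs[THEN conjunct1] f that by blast
  have T0: "AE x in m. T 0 f x = f x" using hs[THEN conjunct2, THEN conjunct1] f by blast
  have lim0: "((\<lambda>s. l2norm m (\<lambda>x. T s f x - T 0 f x)) \<longlongrightarrow> 0) (at 0 within {0..})"
    using flow[THEN conjunct1] by blast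
  have ac: "abs_cont_curve a' b' (\<lambda>s t. l2norm m (\<lambda>x. T t f x - T s f x))" if "0 < a'" "a' < b'" for a' b'
    using flow[THEN conjunct2, THEN conjunct1] that by blast
  note der = flow[THEN conjunct2, THEN conjunct2]
  have decay: "energy (?u b) \<le> exp (c * (b - a)) * energy (?u a)" if a: "0 < a" "a < b" for a
  proof -
    obtain g where g: "set_integrable lborel {a..b} g"
      "\<And>s t. a \<le> s \<Longrightarrow> s \<le> t \<Longrightarrow> t \<le> b \<Longrightarrow> l2norm m (\<lambda>x. T t f x - T s f x) \<le> (LINT r:{s..t}|lborel. g r)"
      using ac[OF a] unfolding abs_cont_curve_def by blast
    define R where "R = l2norm m (?u a) + (LINT r:{a..b}|lborel. \<bar>g r\<bar>)"
    have uR: "l2norm m (?u s) \<le> R" if s: "a \<le> s" "s \<le> b" for s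
    proof -
      have us: "?u s \<in> L2 m" "?u a \<in> L2 m" using a s by (auto intro: u)
      have "l2norm m (?u s) \<le> l2norm m (?u a) + l2norm m (\<lambda>x. ?u s x - ?u a x)"
        using l2norm_triangle[OF us(2) L2_diff[OF us]] by simp
      also have "l2norm m (\<lambda>x. ?u s x - ?u a x) \<le> (LINT r:{a..s}|lborel. g r)" using s by (intro g) auto
      also have "\<dots> \<le> (LINT r:{a..b}|lborel. \<bar>g r\<bar>)" by (rule set_integral_le_abs[OF g(1) s])
      finally show ?thesis by (simp add: R_def)
    qed
    show ?thesis
    proof (rule gronwall_abs_cont[of a b c "\<lambda>r. 4 * M * R * g r"])
      show "set_integrable lborel {a..b} (\<lambda>r. 4 * M * R * g r)" using g(1) by simp
      fix s t assume st: "a \<le> s" "s \<le> t" "t \<le> b"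
      let ?d = "l2norm m (\<lambda>x. ?u t x - ?u s x)"
      have us: "?u t \<in> L2 m" "?u s \<in> L2 m" using a st by (auto intro: u)
      have "?d \<le> l2norm m (?u t) + l2norm m (\<lambda>x. - ?u s x)"
        using l2norm_triangle[OF us(1) L2_cmult[OF us(2), of "-1"]] by simp
      also have "l2norm m (\<lambda>x. - ?u s x) = l2norm m (?u s)" by (simp add: l2norm_def)
      finally have dR: "?d \<le> 2 * R" using uR[of t] uR[of s] st by simp
      have "\<bar>energy (?u t) - energy (?u s)\<bar> \<le> 2 * M * l2norm m (?u s) * ?d + M * ?d\<^sup>2"
        by (rule energy_increment[OF us(2,1)])
      \<comment> \<open>Bounding one of the two factors \<open>?d\<close> by 2 R makes the quadratic
        term linear in \<open>?d\<close>, so that 4 M R times the modulus of the trajectory is a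
        modulus of the energy.\<close>
      also have "\<dots> \<le> 2 * M * R * ?d + M * (2 * R * ?d)"
        using uR[of s] st dR M_nonneg
        by (intro add_mono mult_right_mono mult_left_mono) (auto simp: power2_eq_square intro: mult_right_mono)
      also have "\<dots> = 4 * M * R * ?d" by simp
      also have "\<dots> \<le> 4 * M * R * (LINT r:{s..t}|lborel. g r)"
      proof (rule mult_left_mono[OF g(2)[OF st]])
        show "0 \<le> 4 * M * R" using M_nonneg dR l2norm_nonneg[of m "\<lambda>x. ?u t x - ?u s x"] by (intro mult_nonneg_nonneg) linarith+
      qed
      finally show "\<bar>energy (?u t) - energy (?u s)\<bar> \<le> (LINT r:{s..t}|lborel. 4 * M * R * g r)" by simp
    next
      show "AE t in lborel. t \<in> {a<..<b} \<longrightarrow> (\<exists>D. ((\<lambda>s. energy (?u s)) has_real_derivative D) (at t) \<and> D \<le> c * energy (?u t))"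
      proof (rule eventually_mono[OF der], rule impI)
        fix t assume *: "0 < t \<longrightarrow> (\<exists>l. has_laplacian m (T t f) l \<and>
          ((\<lambda>h. l2norm m (\<lambda>x. (T (t + h) f x - T t f x) / h - 1/2 * l x)) \<longlongrightarrow> 0) (at 0))" and t: "t \<in> {a<..<b}"
        then have t0: "0 < t" using a by auto
        then obtain l where l: "has_laplacian m (T t f) l"
          "((\<lambda>h. l2norm m (\<lambda>x. (T (t + h) f x - T t f x) / h - 1/2 * l x)) \<longlongrightarrow> 0) (at 0)" using * by blast
        show "\<exists>D. ((\<lambda>s. energy (?u s)) has_real_derivative D) (at t) \<and> D \<le> c * energy (?u t)"
          using energy_has_derivative[OF u t0 has_laplacian_L2(2)[OF l(1)] l(2)] diss[OF l(1)] by blast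
      qed
    qed (use a c in auto)
  qed
  have at0: "((\<lambda>s. l2norm m (\<lambda>x. T s f x - T 0 f x)) \<longlongrightarrow> 0) (at_right 0)"
    by (rule tendsto_within_subset[OF lim0]) auto
  have "((\<lambda>s. energy (?u s)) \<longlongrightarrow> energy (?u 0)) (at_right 0)"
  proof (rule LIM_zero_cancel, rule Lim_null_comparison)
    show "\<forall>\<^sub>F s in at_right 0. norm (energy (?u s) - energy (?u 0)) \<le> 2 * M * l2norm m (?u 0) * l2norm m (\<lambda>x. T s f x - T 0 f x) + M * (l2norm m (\<lambda>x. T s f x - T 0 f x))\<^sup>2"
      using eventually_at_right_less[of 0] by eventually_elim (simp only: real_norm_def, rule energy_increment, simp_all add: u)
    have "((\<lambda>s. 2 * M * l2norm m (?u 0) * l2norm m (\<lambda>x. T s f x - T 0 f x) + M * (l2norm m (\<lambda>x. T s f x - T 0 f x))\<^sup>2)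
      \<longlongrightarrow> 2 * M * l2norm m (?u 0) * 0 + M * 0\<^sup>2) (at_right 0)"
      by (intro tendsto_intros at0)
    then show "((\<lambda>s. 2 * M * l2norm m (?u 0) * l2norm m (\<lambda>x. T s f x - T 0 f x) + M * (l2norm m (\<lambda>x. T s f x - T 0 f x))\<^sup>2) \<longlongrightarrow> 0) (at_right 0)"
      by simp
  qed
  then have "((\<lambda>a. exp (c * (b - a)) * energy (?u a)) \<longlongrightarrow> exp (c * (b - 0)) * energy (?u 0)) (at_right 0)"
    by (intro tendsto_intros)
  moreover have "\<forall>\<^sub>F a in at_right 0. energy (?u b) \<le> exp (c * (b - a)) * energy (?u a)"
    unfolding eventually_at_right[OF b] using b decay by (intro exI[of _ b]) auto
  ultimately have "energy (?u b) \<le> exp (c * (b - 0)) * energy (?u 0)"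
    by (rule tendsto_lowerbound) simp
  also have "energy (?u 0) = energy f"
    unfolding energy_def
  proof (rule integral_cong_AE)
    show "AE x in m. \<psi> x * Q (T 0 f x) = \<psi> x * Q (f x)" using T0 by eventually_elim simp
  qed (use energy_integrable[OF f] energy_integrable[OF u[of 0]] in auto)
  finally show ?thesis by simp
qed

subsection \<open>The Gaussian upper bound\<close>

lemma W12_cheeger:
  assumes "f \<in> W12 m"
  shows "cheeger m f = ereal (1/2 * (\<integral>x. (min_weak_upper_gradient m f x)\<^sup>2 \<partial>m))"
  using assms by (simp add: cheeger_def)

text \<open>The subgradient -l evaluated at the competitor g; this takes the place of integration by
  parts. Any weak upper gradient \<open>G\<close> of g is allowed, since it bounds the Cheeger
  energy of g from above.\<close>

lemma laplacian_inequality: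
  fixes m :: "'a::polish_space measure"
  assumes sm: "sets m = sets borel" and lap: "has_laplacian m f l" and g: "g \<in> L2 m"
    and wug: "weak_upper_gradient m g G"
  shows "(\<integral>x. l x * (f x - g x) \<partial>m) \<le> 1/2 * (\<integral>x. (G x)\<^sup>2 \<partial>m) - 1/2 * (\<integral>x. (min_weak_upper_gradient m f x)\<^sup>2 \<partial>m)"
proof -
  obtain h where h: "h \<in> cheeger_subdifferential m f" "l = (\<lambda>x. - h x)" and f: "f \<in> W12 m"
    using lap unfolding has_laplacian_def by blast
  have "cheeger m f + ereal (\<integral>x. h x * (g x - f x) \<partial>m) \<le> cheeger m g"
    using h(1) g unfolding cheeger_subdifferential_def by blast
  also have "\<dots> \<le> ereal (1/2 * (\<integral>x. (G x)\<^sup>2 \<partial>m))" by (rule cheeger_le[OF sm g wug])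
  finally have "1/2 * (\<integral>x. (min_weak_upper_gradient m f x)\<^sup>2 \<partial>m) + (\<integral>x. h x * (g x - f x) \<partial>m) \<le> 1/2 * (\<integral>x. (G x)\<^sup>2 \<partial>m)"
    unfolding W12_cheeger[OF f] by simp
  moreover have "(\<integral>x. l x * (f x - g x) \<partial>m) = (\<integral>x. h x * (g x - f x) \<partial>m)"
    unfolding h(2) by (intro Bochner_Integration.integral_cong) (simp_all add: algebra_simps)
  ultimately show ?thesis by linarith
qed

text \<open>The competitor is the positive part of f. It is a contraction of f, so the minimal weak
  upper gradient of f also serves for it and the difference of energies on the right vanishes; f
  minus its positive part is minus its negative part.\<close>

lemma laplacian_negative_part:
  fixes m :: "'a::polish_space measure"
  assumes sm: "sets m = sets borel" and lap: "has_laplacian m f l"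
  shows "0 \<le> (\<integral>x. l x * max 0 (- f x) \<partial>m)"
proof -
  have f: "f \<in> L2 m" "f \<in> W12 m" using has_laplacian_L2[OF lap] by auto
  have fm: "f \<in> borel_measurable m" using f by (simp add: L2_def)
  have wug: "weak_upper_gradient m f (min_weak_upper_gradient m f)"
    using f(2) by (intro min_wug[OF sm]) (simp add: W12_def)
  have g: "(\<lambda>x. max 0 (f x)) \<in> L2 m" by (rule L2_bound[OF f(1), of _ 1]) (use fm in auto)
  have "weak_upper_gradient m (\<lambda>x. max 0 (f x)) (min_weak_upper_gradient m f)"
    by (rule wug_contraction[OF wug]) (auto simp: max_def)
  from laplacian_inequality[OF sm lap g this]
  have "(\<integral>x. l x * (f x - max 0 (f x)) \<partial>m) \<le> 0" by simp
  moreover have "(\<integral>x. l x * (f x - max 0 (f x)) \<partial>m) = (\<integral>x. - (l x * max 0 (- f x)) \<partial>m)"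
    by (intro Bochner_Integration.integral_cong) (auto simp: max_def)
  ultimately show ?thesis by simp
qed

section \<open>Exponential weights and Davies' inequality\<close>

lemma exp_lipschitz_on:
  fixes a b :: real
  shows "\<bar>exp b - exp a\<bar> \<le> exp (max a b) * \<bar>b - a\<bar>"
proof -
  have *: "exp q - exp p \<le> exp q * (q - p)" if "p \<le> q" for p q :: real
  proof -
    have "1 - exp (p - q) \<le> q - p" using exp_ge_add_one_self[of "p - q"] by linarith
    then have "exp q * (1 - exp (p - q)) \<le> exp q * (q - p)" by (rule mult_left_mono) simp
    then show ?thesis by (simp add: algebra_simps flip: exp_add)
  qed
  show ?thesis
  proof (cases "a \<le> b")
    case True then show ?thesis using *[of a b] by (simp add: max_def)
  next
    case False
    then have "exp b \<le> exp a" by simp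
    then show ?thesis using *[of b a] False by (simp add: max_def)
  qed
qed

lemma lipschitz_measurable:
  fixes w :: "'a::polish_space \<Rightarrow> real"
  assumes sm: "sets m = sets borel" and w: "\<And>x y. \<bar>w x - w y\<bar> \<le> dist x y"
  shows "w \<in> borel_measurable m"
proof -
  have "continuous_on UNIV w"
    unfolding continuous_on_iff dist_real_def using w le_less_trans by blast
  then show ?thesis
    using borel_measurable_continuous_onI measurable_cong_sets[OF sm refl] by blast
qed

text \<open>In the inequality for the competitor (1 - \<epsilon> \<psi>) f, the left side is
  \<epsilon> times the integral of \<psi> f l. The difference of energies on the right has a term
  linear in \<epsilon> and a remainder \<epsilon>^2 R. Dividing by \<epsilon> and letting it tend to
  0 removes the remainder.\<close>

lemma davies_inequality:
  fixes m :: "'a::polish_space measure" and w :: "'a \<Rightarrow> real"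
  assumes sm: "sets m = sets borel" and lap: "has_laplacian m f l" and \<alpha>: "0 \<le> \<alpha>"
    and w: "\<And>x. w x \<le> D" "\<And>x y. \<bar>w x - w y\<bar> \<le> dist x y"
  shows "(\<integral>x. exp (\<alpha> * w x) * f x * l x \<partial>m) \<le> \<alpha>\<^sup>2 / 4 * (\<integral>x. exp (\<alpha> * w x) * (f x)\<^sup>2 \<partial>m)"
proof -
  let ?\<psi> = "\<lambda>x. exp (\<alpha> * w x)" and ?G = "min_weak_upper_gradient m f"
  define M where "M = exp (\<alpha> * D)"
  have M: "0 < M" by (simp add: M_def)
  have \<psi>M: "?\<psi> x \<le> M" for x unfolding M_def using w(1)[of x] \<alpha> by (simp add: mult_left_mono)
  have wm: "w \<in> borel_measurable m" by (rule lipschitz_measurable[OF sm w(2)])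
  from wm have \<psi>m: "?\<psi> \<in> borel_measurable m" by measurable
  have f: "f \<in> L2 m" "f \<in> W12 m" and l: "l \<in> L2 m" using has_laplacian_L2[OF lap] by auto
  have fm[measurable]: "f \<in> borel_measurable m" using f by (simp add: L2_def)
  have wug: "weak_upper_gradient m f ?G"
    using f(2) by (intro min_wug[OF sm]) (simp add: W12_def)
  have G: "?G \<in> L2 m" by (rule wugD(1)[OF wug])
  have G2: "integrable m (\<lambda>x. (?G x)\<^sup>2)" using G by (simp add: L2_def)
  have \<psi>f: "(\<lambda>x. ?\<psi> x * f x) \<in> L2 m" by (rule L2_mult_bounded[OF f(1) \<psi>m, of M]) (use \<psi>M in simp)
  have \<psi>f2: "integrable m (\<lambda>x. ?\<psi> x * (f x)\<^sup>2)"
    using L2_mult_integrable[OF \<psi>f f(1)] by (simp add: power2_eq_square mult.assoc)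
  have rest: "(\<lambda>x. ?\<psi> x * (\<alpha> * \<bar>f x\<bar> - ?G x)) \<in> L2 m"
  proof (rule L2_mult_bounded[OF L2_diff[OF L2_cmult G] \<psi>m, of _ M])
    show "(\<lambda>x. \<bar>f x\<bar>) \<in> L2 m" by (rule L2_bound[OF f(1), of _ 1]) auto
  qed (use \<psi>M in simp)
  define R where "R = 1/2 * (\<integral>x. (?\<psi> x * (\<alpha> * \<bar>f x\<bar> - ?G x))\<^sup>2 \<partial>m)"
  have rest2: "integrable m (\<lambda>x. (?\<psi> x * (\<alpha> * \<bar>f x\<bar> - ?G x))\<^sup>2)" using rest by (simp add: L2_def)
  let ?X = "\<integral>x. ?\<psi> x * f x * l x \<partial>m" and ?Y = "\<alpha>\<^sup>2 / 4 * (\<integral>x. ?\<psi> x * (f x)\<^sup>2 \<partial>m)"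
  have key: "?X \<le> ?Y + \<epsilon> * R" if \<epsilon>: "0 < \<epsilon>" "\<epsilon> * M \<le> 1" for \<epsilon>
  proof -
    \<comment> \<open>\<open>?s\<close> bounds the local Lipschitz constant of
      \<open>?\<phi>\<close>: w is 1-Lipschitz, so that of \<psi> = exp (\<alpha> w) is at most
      \<alpha> \<psi>.\<close>
    let ?\<phi> = "\<lambda>x. 1 - \<epsilon> * ?\<psi> x" and ?s = "\<lambda>x. \<epsilon> * \<alpha> * ?\<psi> x"
    have \<epsilon>\<psi>: "\<epsilon> * ?\<psi> x \<le> 1" for x
      using mult_left_mono[OF \<psi>M[of x], of \<epsilon>] \<epsilon> by linarith
    have diff: "\<bar>?\<phi> y - ?\<phi> x\<bar> \<le> \<epsilon> * (exp (max (\<alpha> * w x) (\<alpha> * w y)) * (\<alpha> * dist y x))" for x y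
    proof -
      have "\<bar>?\<phi> y - ?\<phi> x\<bar> = \<epsilon> * \<bar>?\<psi> y - ?\<psi> x\<bar>"
        using \<epsilon> by (simp add: abs_mult abs_minus_commute flip: right_diff_distrib)
      also have "\<bar>?\<psi> y - ?\<psi> x\<bar> \<le> exp (max (\<alpha> * w x) (\<alpha> * w y)) * \<bar>\<alpha> * w y - \<alpha> * w x\<bar>"
        by (rule exp_lipschitz_on)
      also have "\<bar>\<alpha> * w y - \<alpha> * w x\<bar> \<le> \<alpha> * dist y x"
        using mult_left_mono[OF w(2)[of y x] \<alpha>] \<alpha> by (simp add: abs_mult flip: right_diff_distrib)
      finally show ?thesis using \<epsilon> by (simp add: mult_left_mono)
    qed
    have slope: "\<bar>?\<phi> y - ?\<phi> x\<bar> \<le> ?s x * exp (\<alpha> * dist y x) * dist y x" for x y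
    proof -
      have "\<alpha> * w y \<le> \<alpha> * (w x + dist y x)" using w(2)[of y x] \<alpha> by (intro mult_left_mono) linarith+
      then have "max (\<alpha> * w x) (\<alpha> * w y) \<le> \<alpha> * w x + \<alpha> * dist y x" using \<alpha> by (simp add: algebra_simps)
      then have "exp (max (\<alpha> * w x) (\<alpha> * w y)) \<le> ?\<psi> x * exp (\<alpha> * dist y x)" by (simp flip: exp_add)
      then have "\<epsilon> * (exp (max (\<alpha> * w x) (\<alpha> * w y)) * (\<alpha> * dist y x)) \<le> \<epsilon> * ((?\<psi> x * exp (\<alpha> * dist y x)) * (\<alpha> * dist y x))"
        using \<epsilon> \<alpha> by (intro mult_left_mono mult_right_mono) simp_all
      with diff[of y x] show ?thesis by (simp add: mult_ac)
    qed
    have lip: "\<bar>?\<phi> y - ?\<phi> x\<bar> \<le> (\<epsilon> * M * \<alpha>) * dist y x" for x y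
    proof -
      have "exp (max (\<alpha> * w x) (\<alpha> * w y)) \<le> M" using \<psi>M[of x] \<psi>M[of y] by (simp add: max_def)
      then have "\<epsilon> * (exp (max (\<alpha> * w x) (\<alpha> * w y)) * (\<alpha> * dist y x)) \<le> \<epsilon> * (M * (\<alpha> * dist y x))"
        using \<epsilon> \<alpha> by (intro mult_left_mono mult_right_mono) simp_all
      with diff[of y x] show ?thesis by (simp add: mult_ac)
    qed
    let ?H = "\<lambda>x. ?\<phi> x * ?G x + ?s x * \<bar>f x\<bar>"
    have wugH: "weak_upper_gradient m (\<lambda>x. ?\<phi> x * f x) ?H"
    proof (rule wug_leibniz[OF sm f(1) wug, where M=1 and N="\<epsilon> * \<alpha> * M", OF _ _ _ _ _ _ slope lip])
      show "?\<phi> \<in> borel_measurable m" "?s \<in> borel_measurable m" using \<psi>m by simp_all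
      show "0 \<le> ?\<phi> x" "?\<phi> x \<le> 1" "0 \<le> ?s x" for x using \<epsilon>\<psi>[of x] \<epsilon> \<alpha> by simp_all
      show "?s x \<le> \<epsilon> * \<alpha> * M" for x using \<epsilon> \<alpha> \<psi>M by (intro mult_left_mono) simp_all
    qed
    have gL2: "(\<lambda>x. ?\<phi> x * f x) \<in> L2 m"
      using L2_diff[OF f(1) L2_cmult[OF \<psi>f, of \<epsilon>]] by (simp add: algebra_simps)
    have HL2: "integrable m (\<lambda>x. (?H x)\<^sup>2)" by (rule wugD(4)[OF wugH])
    have "(\<integral>x. l x * (f x - ?\<phi> x * f x) \<partial>m) \<le> 1/2 * (\<integral>x. (?H x)\<^sup>2 \<partial>m) - 1/2 * (\<integral>x. (?G x)\<^sup>2 \<partial>m)"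
      by (rule laplacian_inequality[OF sm lap gL2 wugH])
    also have "(\<integral>x. l x * (f x - ?\<phi> x * f x) \<partial>m) = (\<integral>x. \<epsilon> * (?\<psi> x * f x * l x) \<partial>m)"
      by (intro Bochner_Integration.integral_cong) (simp_all add: algebra_simps)
    also have "\<dots> = \<epsilon> * ?X" by simp
    also have "(\<integral>x. (?H x)\<^sup>2 \<partial>m) \<le> (\<integral>x. (?G x)\<^sup>2 + 2 * \<epsilon> * (\<alpha>\<^sup>2 / 4) * (?\<psi> x * (f x)\<^sup>2) + \<epsilon>\<^sup>2 * (?\<psi> x * (\<alpha> * \<bar>f x\<bar> - ?G x))\<^sup>2 \<partial>m)"
    proof (rule integral_mono[OF HL2])
      show "integrable m (\<lambda>x. (?G x)\<^sup>2 + 2 * \<epsilon> * (\<alpha>\<^sup>2 / 4) * (?\<psi> x * (f x)\<^sup>2) + \<epsilon>\<^sup>2 * (?\<psi> x * (\<alpha> * \<bar>f x\<bar> - ?G x))\<^sup>2)"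
        by (intro Bochner_Integration.integrable_add integrable_mult_right G2 \<psi>f2 rest2)
      fix x
      have "?H x = ?G x + \<epsilon> * (?\<psi> x * (\<alpha> * \<bar>f x\<bar> - ?G x))" by (simp add: algebra_simps)
      then have "(?H x)\<^sup>2 = (?G x)\<^sup>2 + 2 * \<epsilon> * (?\<psi> x * (\<alpha> * \<bar>f x\<bar> * ?G x - (?G x)\<^sup>2)) + \<epsilon>\<^sup>2 * (?\<psi> x * (\<alpha> * \<bar>f x\<bar> - ?G x))\<^sup>2"
        by (simp add: power2_eq_square algebra_simps)
      moreover have "?\<psi> x * (\<alpha> * \<bar>f x\<bar> * ?G x - (?G x)\<^sup>2) \<le> ?\<psi> x * (\<alpha>\<^sup>2 / 4 * (f x)\<^sup>2)"
      proof (rule mult_left_mono)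
        \<comment> \<open>The square is completed here, which is the origin of
          \<open>\<alpha>\<^sup>2 / 4\<close>. The negative term in G^2 comes from the coefficient 1
          - \<epsilon> \<psi> of G.\<close>
        have "0 \<le> (\<alpha> * \<bar>f x\<bar> / 2 - ?G x)\<^sup>2" by simp
        then show "\<alpha> * \<bar>f x\<bar> * ?G x - (?G x)\<^sup>2 \<le> \<alpha>\<^sup>2 / 4 * (f x)\<^sup>2"
          by (simp add: power2_diff power_mult_distrib power_divide)
      qed simp
      then have "2 * \<epsilon> * (?\<psi> x * (\<alpha> * \<bar>f x\<bar> * ?G x - (?G x)\<^sup>2)) \<le> 2 * \<epsilon> * (?\<psi> x * (\<alpha>\<^sup>2 / 4 * (f x)\<^sup>2))"
        using \<epsilon> by (intro mult_left_mono) simp_all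
      ultimately show "(?H x)\<^sup>2 \<le> (?G x)\<^sup>2 + 2 * \<epsilon> * (\<alpha>\<^sup>2 / 4) * (?\<psi> x * (f x)\<^sup>2) + \<epsilon>\<^sup>2 * (?\<psi> x * (\<alpha> * \<bar>f x\<bar> - ?G x))\<^sup>2"
        by (simp add: mult_ac)
    qed
    also have "\<dots> = (\<integral>x. (?G x)\<^sup>2 \<partial>m) + 2 * \<epsilon> * (\<alpha>\<^sup>2 / 4) * (\<integral>x. ?\<psi> x * (f x)\<^sup>2 \<partial>m) + \<epsilon>\<^sup>2 * (2 * R)"
      unfolding R_def
      by (simp only: Bochner_Integration.integral_add[OF Bochner_Integration.integrable_add[OF G2 integrable_mult_right[OF \<psi>f2]] integrable_mult_right[OF rest2]]
          Bochner_Integration.integral_add[OF G2 integrable_mult_right[OF \<psi>f2]] integral_mult_right_zero)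
    finally have "\<epsilon> * ?X \<le> \<epsilon> * (?Y + \<epsilon> * R)" by (simp add: algebra_simps power2_eq_square)
    then show ?thesis using \<epsilon>(1) by simp
  qed
  have R0: "0 \<le> R" unfolding R_def by (simp add: integral_nonneg_AE)
  show ?thesis
  proof (rule field_le_epsilon)
    fix e :: real assume e: "0 < e"
    \<comment> \<open>The first bound keeps the factor 1 - \<epsilon> \<psi> nonnegative, the second
      makes the remainder at most e; R + 1 avoids a division by 0.\<close>
    define \<epsilon> where "\<epsilon> = min (1 / M) (e / (R + 1))"
    have "0 < \<epsilon>" using M e R0 by (simp add: \<epsilon>_def)
    moreover have "\<epsilon> * M \<le> 1" using M by (simp add: \<epsilon>_def min_le_iff_disj flip: pos_le_divide_eq)
    moreover have "\<epsilon> * R \<le> e"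
    proof -
      have "\<epsilon> * R \<le> e / (R + 1) * (R + 1)" using R0 e by (intro mult_mono) (auto simp: \<epsilon>_def)
      then show ?thesis using R0 by simp
    qed
    ultimately show "?X \<le> ?Y + e" using key[of \<epsilon>] by linarith
  qed
qed

text \<open>
  The sign of \<open>T\<^sub>t 1\<^sub>B\<close> matters for the final estimate: \<^const>\<open>ln\<close> is unspecified on negative numbers.
\<close>
lemma heat_nonneg:
  fixes m :: "'a::polish_space measure"
  assumes sm: "sets m = sets borel" and T: "heat_semigroup m T" and f: "f \<in> L2 m" and nonneg: "\<And>x. 0 \<le> f x" and t: "0 < t"
  shows "AE x in m. 0 \<le> T t f x"
proof -
  \<comment> \<open>The squared negative part has the 2-Lipschitz derivative -2 max 0 (-v), which
    gives the Taylor remainder its constant 1.\<close>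
  interpret weighted_energy m "\<lambda>_. 1" 1 "\<lambda>v. (max 0 (- v))\<^sup>2" "\<lambda>v. - 2 * max 0 (- v)"
  proof
    fix a b :: real
    show "\<bar>(max 0 (- b))\<^sup>2 - (max 0 (- a))\<^sup>2 - - 2 * max 0 (- a) * (b - a)\<bar> \<le> (b - a)\<^sup>2"
    proof (cases "a < 0"; cases "b < 0")
      assume "a < 0" "b < 0"
      then have "(max 0 (- b))\<^sup>2 - (max 0 (- a))\<^sup>2 - - 2 * max 0 (- a) * (b - a) = (b - a)\<^sup>2"
        by (simp add: max_def power2_eq_square algebra_simps)
      then show ?thesis by simp
    next
      assume ab: "a < 0" "\<not> b < 0"
      then have "0 \<le> a * (a - 2 * b)" by (intro mult_nonpos_nonpos) simp_all
      then show ?thesis using ab by (simp add: max_def power2_eq_square algebra_simps)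
    next
      assume ab: "\<not> a < 0" "b < 0"
      then have "0 \<le> a * (a - 2 * b)" by (intro mult_nonneg_nonneg) simp_all
      then show ?thesis using ab by (simp add: max_def power2_eq_square algebra_simps)
    next
      assume "\<not> a < 0" "\<not> b < 0"
      then show ?thesis by (simp add: max_def)
    qed
    show "\<bar>- 2 * max 0 (- a)\<bar> \<le> 2 * \<bar>a\<bar>" by (simp add: max_def)
    show "\<bar>(max 0 (- a))\<^sup>2\<bar> \<le> a\<^sup>2" by (simp add: max_def)
  qed simp_all
  \<comment> \<open>With rate 0 the energy cannot increase, and it starts at 0 for nonnegative
    f.\<close>
  have "energy (T t f) \<le> exp (0 * t) * energy f"
  proof (rule gradient_flow_energy[OF T f _ _ t])
    fix v l assume lap: "has_laplacian m v l"
    have "(\<integral>x. 1 * (- 2 * max 0 (- v x)) * l x \<partial>m) = (\<integral>x. - 2 * (l x * max 0 (- v x)) \<partial>m)"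
      by (simp add: mult_ac)
    then show "1/2 * (\<integral>x. 1 * (- 2 * max 0 (- v x)) * l x \<partial>m) \<le> 0 * energy v"
      using laplacian_negative_part[OF sm lap] by simp
  qed simp
  moreover have "energy f = 0"
  proof -
    have "max 0 (- f x) = 0" for x using nonneg[of x] by simp
    then show ?thesis by (simp add: energy_def)
  qed
  moreover have u: "T t f \<in> L2 m" using T[unfolded heat_semigroup_def, THEN conjunct1] f t by simp
  ultimately have "(\<integral>x. (max 0 (- T t f x))\<^sup>2 \<partial>m) \<le> 0" by (simp add: energy_def)
  moreover have "0 \<le> (\<integral>x. (max 0 (- T t f x))\<^sup>2 \<partial>m)" by (rule integral_nonneg_AE) simp
  ultimately have "(\<integral>x. (max 0 (- T t f x))\<^sup>2 \<partial>m) = 0" by simp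
  then have "AE x in m. (max 0 (- T t f x))\<^sup>2 = 0"
    using integral_nonneg_eq_0_iff_AE[of m "\<lambda>x. (max 0 (- T t f x))\<^sup>2"] energy_integrable[OF u] by simp
  then show ?thesis by eventually_elim (simp add: max_def split: if_splits)
qed

text \<open>The 2 from differentiating v^2 cancels the 1/2 of the flow equation, so the growth rate
  is exactly the constant of \<open>davies_inequality\<close>.\<close>

lemma heat_davies:
  fixes m :: "'a::polish_space measure" and w :: "'a \<Rightarrow> real"
  assumes sm: "sets m = sets borel" and T: "heat_semigroup m T" and f: "f \<in> L2 m" and \<alpha>: "0 \<le> \<alpha>"
    and w: "\<And>x. w x \<le> D" "\<And>x y. \<bar>w x - w y\<bar> \<le> dist x y" and t: "0 < t"
  shows "integrable m (\<lambda>x. exp (\<alpha> * w x) * (T t f x)\<^sup>2)"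
    and "(\<integral>x. exp (\<alpha> * w x) * (T t f x)\<^sup>2 \<partial>m) \<le> exp (\<alpha>\<^sup>2 / 4 * t) * (\<integral>x. exp (\<alpha> * w x) * (f x)\<^sup>2 \<partial>m)"
proof -
  have wm: "w \<in> borel_measurable m" by (rule lipschitz_measurable[OF sm w(2)])
  interpret weighted_energy m "\<lambda>x. exp (\<alpha> * w x)" "exp (\<alpha> * D)" "\<lambda>v. v\<^sup>2" "\<lambda>v. 2 * v"
  proof
    show "(\<lambda>x. exp (\<alpha> * w x)) \<in> borel_measurable m" using wm by measurable
    show "exp (\<alpha> * w x) \<le> exp (\<alpha> * D)" for x using w(1)[of x] \<alpha> by (simp add: mult_left_mono)
    show "\<bar>b\<^sup>2 - a\<^sup>2 - 2 * a * (b - a)\<bar> \<le> (b - a)\<^sup>2" for a b :: real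
    proof -
      have "b\<^sup>2 - a\<^sup>2 - 2 * a * (b - a) = (b - a)\<^sup>2" by (simp add: power2_eq_square algebra_simps)
      then show ?thesis by simp
    qed
  qed simp_all
  have u: "T t f \<in> L2 m" using T[unfolded heat_semigroup_def, THEN conjunct1] f t by simp
  show "integrable m (\<lambda>x. exp (\<alpha> * w x) * (T t f x)\<^sup>2)" by (rule energy_integrable[OF u])
  have "energy (T t f) \<le> exp (\<alpha>\<^sup>2 / 4 * t) * energy f"
  proof (rule gradient_flow_energy[OF T f _ _ t])
    fix v l assume lap: "has_laplacian m v l"
    have "(\<integral>x. exp (\<alpha> * w x) * (2 * v x) * l x \<partial>m) = (\<integral>x. 2 * (exp (\<alpha> * w x) * v x * l x) \<partial>m)"
      by (simp add: mult_ac)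
    then show "1/2 * (\<integral>x. exp (\<alpha> * w x) * (2 * v x) * l x \<partial>m) \<le> \<alpha>\<^sup>2 / 4 * energy v"
      using davies_inequality[OF sm lap \<alpha> w] by (simp add: energy_def)
  qed simp
  then show "(\<integral>x. exp (\<alpha> * w x) * (T t f x)\<^sup>2 \<partial>m) \<le> exp (\<alpha>\<^sup>2 / 4 * t) * (\<integral>x. exp (\<alpha> * w x) * (f x)\<^sup>2 \<partial>m)"
    by (simp add: energy_def)
qed

section \<open>From weighted energies to pairs of sets\<close>

lemma indicator_L2:
  assumes "A \<in> sets m" "emeasure m A < \<infinity>"
  shows "(indicator A :: 'a \<Rightarrow> real) \<in> L2 m" "l2norm m (indicator A) = sqrt (measure m A)"
proof -
  have sq: "(indicator A x :: real)\<^sup>2 = indicator A x" for x by (simp add: indicator_def)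
  show "(indicator A :: 'a \<Rightarrow> real) \<in> L2 m"
    using assms by (simp add: L2_def sq integrable_indicator_iff)
  have "(\<integral>x. (indicator A x :: real) \<partial>m) = measure m A"
    using assms sets.sets_into_space[OF assms(1)] by (simp add: Int_absorb2)
  then show "l2norm m (indicator A) = sqrt (measure m A)" by (simp add: l2norm_def sq)
qed

text \<open>The weight equals exp (\<alpha> D) on A and 1 on B, where D is the distance of the sets.
  Restricting the weighted energy at time t to A therefore gains a factor exp (-\<alpha> D), while
  the initial weighted energy is just m(B). The Cauchy-Schwarz inequality halves the exponent and
  contributes the square root of m(A).\<close>

lemma heat_transition_bounds:
  fixes m :: "'a::polish_space measure"
  assumes sm: "sets m = sets borel" and T: "heat_semigroup m T"
    and A: "A \<in> sets m" "emeasure m A < \<infinity>" and B: "B \<in> sets m" "B \<noteq> {}" "emeasure m B < \<infinity>" and t: "0 < t"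
  shows "0 \<le> heat_transition m T t A B"
    and "heat_transition m T t A B \<le> sqrt (measure m A * measure m B) * exp (- (setdist A B)\<^sup>2 / (2 * t))"
proof -
  let ?D = "setdist A B" and ?u = "T t (indicator B)"
  \<comment> \<open>This \<alpha> minimises the total exponent
    \<open>- \<alpha> * ?D + \<alpha>\<^sup>2 / 4 * t\<close>; the minimum is
    \<open>- ?D\<^sup>2 / t\<close>.\<close>
  define \<alpha> where "\<alpha> = 2 * ?D / t"
  \<comment> \<open>The cut-off keeps the weight bounded and costs nothing on A, whose points all
    have distance at least \<open>?D\<close> from B.\<close>
  define w where "w x = min (infdist x B) ?D" for x
  let ?\<psi> = "\<lambda>x. exp (\<alpha> * w x)"
  note iA = indicator_L2[OF A] and iB = indicator_L2[OF B(1,3)]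
  have D0: "0 \<le> ?D" by (rule setdist_pos_le)
  have \<alpha>0: "0 \<le> \<alpha>" using D0 t by (simp add: \<alpha>_def)
  have w: "w x \<le> ?D" "\<bar>w x - w y\<bar> \<le> dist x y" for x y
    using infdist_triangle_abs[of x B y] by (auto simp: w_def)
  have wA: "w x = ?D" if "x \<in> A" for x
  proof -
    have "?D \<le> infdist x B"
      unfolding infdist_notempty[OF B(2)] using that B(2) by (intro cINF_greatest setdist_le_dist) auto
    then show ?thesis by (simp add: w_def)
  qed
  have wB: "w x = 0" if "x \<in> B" for x using that D0 by (simp add: w_def)
  have u: "?u \<in> L2 m" using T[unfolded heat_semigroup_def, THEN conjunct1] iB(1) t by simp
  have um: "?u \<in> borel_measurable m" using u by (simp add: L2_def)
  have Au: "(\<lambda>x. indicator A x * ?u x) \<in> L2 m"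
    using A by (intro L2_mult_bounded[OF u, of _ 1]) (auto simp: indicator_def)
  \<comment> \<open>The indicator is doubled so that Cauchy-Schwarz pairs the indicator of A with
    the restriction of \<open>?u\<close> to A.\<close>
  have eq: "heat_transition m T t A B = (\<integral>x. indicator A x * (indicator A x * ?u x) \<partial>m)"
    unfolding heat_transition_def set_lebesgue_integral_def
    by (intro Bochner_Integration.integral_cong) (simp_all add: indicator_def)
  show "0 \<le> heat_transition m T t A B"
    unfolding eq
  proof (rule integral_nonneg_AE)
    show "AE x in m. 0 \<le> indicator A x * (indicator A x * ?u x)"
      using heat_nonneg[OF sm T iB(1) _ t] by (auto elim!: eventually_mono simp: indicator_def)
  qed
  have "(l2norm m (\<lambda>x. indicator A x * ?u x))\<^sup>2 \<le> (\<integral>x. exp (- \<alpha> * ?D) * (?\<psi> x * (?u x)\<^sup>2) \<partial>m)"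
    unfolding l2norm_square
  proof (rule integral_mono)
    show "integrable m (\<lambda>x. (indicator A x * ?u x)\<^sup>2)" using Au by (simp add: L2_def)
    show "integrable m (\<lambda>x. exp (- \<alpha> * ?D) * (?\<psi> x * (?u x)\<^sup>2))"
      by (intro integrable_mult_right heat_davies(1)[OF sm T iB(1) \<alpha>0 w t])
    fix x
    show "(indicator A x * ?u x)\<^sup>2 \<le> exp (- \<alpha> * ?D) * (?\<psi> x * (?u x)\<^sup>2)"
    proof (cases "x \<in> A")
      case True
      then show ?thesis using wA[OF True] by (simp flip: mult.assoc exp_add)
    qed simp
  qed
  also have "\<dots> = exp (- \<alpha> * ?D) * (\<integral>x. ?\<psi> x * (?u x)\<^sup>2 \<partial>m)" by (rule integral_mult_right_zero)
  also have "\<dots> \<le> exp (- \<alpha> * ?D) * (exp (\<alpha>\<^sup>2 / 4 * t) * (\<integral>x. ?\<psi> x * (indicator B x)\<^sup>2 \<partial>m))"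
    by (intro mult_left_mono heat_davies(2)[OF sm T iB(1) \<alpha>0 w t]) simp
  also have "(\<integral>x. ?\<psi> x * (indicator B x)\<^sup>2 \<partial>m) = (\<integral>x. (indicator B x)\<^sup>2 \<partial>m)"
    by (intro Bochner_Integration.integral_cong) (simp_all add: indicator_def wB)
  also have "\<dots> = measure m B" using iB(2) by (simp add: l2norm_def)
  also have "exp (- \<alpha> * ?D) * (exp (\<alpha>\<^sup>2 / 4 * t) * measure m B) = exp (- ?D\<^sup>2 / t) * measure m B"
  proof -
    have "- \<alpha> * ?D + \<alpha>\<^sup>2 / 4 * t = - ?D\<^sup>2 / t"
      using t by (simp add: \<alpha>_def field_simps power2_eq_square)
    then show ?thesis by (simp flip: mult.assoc exp_add)
  qed
  also have "\<dots> = (sqrt (measure m B) * exp (- ?D\<^sup>2 / (2 * t)))\<^sup>2"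
    by (simp add: power_mult_distrib flip: exp_double)
  finally have "l2norm m (\<lambda>x. indicator A x * ?u x) \<le> sqrt (measure m B) * exp (- ?D\<^sup>2 / (2 * t))"
    by (rule power2_le_imp_le) simp
  then have "sqrt (measure m A) * l2norm m (\<lambda>x. indicator A x * ?u x) \<le> sqrt (measure m A) * (sqrt (measure m B) * exp (- ?D\<^sup>2 / (2 * t)))"
    by (rule mult_left_mono) simp
  moreover have "heat_transition m T t A B \<le> sqrt (measure m A) * l2norm m (\<lambda>x. indicator A x * ?u x)"
    using L2_Cauchy_Schwarz[OF iA(1) Au] unfolding eq iA(2) by linarith
  ultimately show "heat_transition m T t A B \<le> sqrt (measure m A * measure m B) * exp (- ?D\<^sup>2 / (2 * t))"
    by (simp add: real_sqrt_mult mult.assoc)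
qed

theorem theorem1p2:
  fixes m :: "'a::polish_space measure"
    and act :: "('a \<Rightarrow> real) \<Rightarrow> 'c::banach \<Rightarrow> 'c"
    and pn :: "'c \<Rightarrow> 'a \<Rightarrow> real"
    and d :: "('a \<Rightarrow> real) \<Rightarrow> 'c"
    and T :: "real \<Rightarrow> ('a \<Rightarrow> real) \<Rightarrow> ('a \<Rightarrow> real)"
    and A B :: "'a set"
  assumes "metric_measure_space m"
    and "cotangent_module m act pn d"
    and "infinitesimally_strictly_convex m act pn d"
    and "heat_semigroup m T"
    and "A \<in> sets m" and "0 < emeasure m A" and "emeasure m A < \<infinity>"
    and "B \<in> sets m" and "0 < emeasure m B" and "emeasure m B < \<infinity>"
  shows "Limsup (at_right 0) (\<lambda>t. ereal t * elog (heat_transition m T t A B))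
           \<le> ereal (- (1/2) * (setdist A B)\<^sup>2)"
proof -
  have sm: "sets m = sets borel" using assms(1) by (simp add: metric_measure_space_def)
  have "B \<noteq> {}" using assms(9) by auto
  note P = heat_transition_bounds[OF sm assms(4,5,7,8) this assms(10)]
  let ?D = "setdist A B"
  define C where "C = sqrt (measure m A * measure m B)"
  \<comment> \<open>Finiteness matters beside positivity: \<open>measure\<close> is 0 on sets of
    infinite measure.\<close>
  have C: "0 < C"
    using assms by (simp add: C_def measure_def enn2real_positive_iff)
  \<comment> \<open>The prefactor costs only t ln C, which vanishes as t tends to 0.\<close>
  have le: "ereal t * elog (heat_transition m T t A B) \<le> ereal (t * ln C - 1/2 * ?D\<^sup>2)" if t: "0 < t" for t
  proof (cases "heat_transition m T t A B = 0")
    case True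
    \<comment> \<open>Here \<open>elog\<close> is -\<infinity>, and the factor t > 0 keeps the
      product at -\<infinity>.\<close>
    then show ?thesis using t by (simp add: elog_def)
  next
    case False
    then have pos: "0 < heat_transition m T t A B" using P(1)[OF t] by simp
    then have "ln (heat_transition m T t A B) \<le> ln (C * exp (- ?D\<^sup>2 / (2 * t)))"
      using P(2)[OF t] by (intro ln_mono) (simp_all add: C_def)
    also have "\<dots> = ln C - ?D\<^sup>2 / (2 * t)" using C by (simp add: ln_mult)
    finally have "t * ln (heat_transition m T t A B) \<le> t * (ln C - ?D\<^sup>2 / (2 * t))"
      using t by (intro mult_left_mono) simp_all
    also have "\<dots> = t * ln C - 1/2 * ?D\<^sup>2" using t by (simp add: field_simps)
    finally show ?thesis using False by (simp add: elog_def)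
  qed
  have "Limsup (at_right 0) (\<lambda>t. ereal t * elog (heat_transition m T t A B))
      \<le> Limsup (at_right 0) (\<lambda>t. ereal (t * ln C - 1/2 * ?D\<^sup>2))"
    by (rule Limsup_mono) (use eventually_at_right_less[of 0] le in \<open>auto elim: eventually_mono\<close>)
  also have "\<dots> = ereal (0 * ln C - 1/2 * ?D\<^sup>2)"
    by (intro lim_imp_Limsup tendsto_intros) simp
  finally show ?thesis by simp
qed

end
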